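(* For a smooth and compactly supported function $\rho$ on $\mathbb{R}^d$ ($d=1,2,3$), assume that $\operatorname{supp}\{\rho\}\subsetneq\mathbf{R}_L$, and let $\Phi=U\ast\rho$. Then, for a multi-index $\boldsymbol\alpha$, the estimates $$\|\partial^{\boldsymbol\alpha}\Phi-(\partial^{\boldsymbol\alpha}\Phi)_N\|_{L^\infty(\mathbf{R}_L)}\lesssim N^{-(m-\frac d2-|\boldsymbol\alpha|)}\,|\rho|_{m,\mathbf{R}_L},$$ $$\|\partial^{\boldsymbol\alpha}\Phi-(\partial^{\boldsymbol\alpha}\Phi)_N\|_{L^2(\mathbf{R}_L)}\lesssim N^{-(m-|\boldsymbol\alpha|)}\,|\rho|_{m,\mathbf{R}_L}$$ hold true for any positive integer $m>\frac d2$, where $(\partial^{\boldsymbol\alpha}\Phi)_N$ denotes the numerical approximation of $\partial^{\boldsymbol\alpha}\Phi$ by the kernel truncation method (defined in the context) and $A\lesssim B$ means $A\le cB$ with a constant $c>0$ independent of $N$. Specially, when $\boldsymbol\alpha=\mathbf{0}$, writing $\Phi_N=(\partial^{\mathbf{0}}\Phi)_N$, $$\|\Phi-\Phi_N\|_{L^\infty(\mathbf{R}_L)}\lesssim N^{-(m-\frac d2)}|\rho|_{m,\mathbf{R}_L},\qquad \|\Phi-\Phi_N\|_{L^2(\mathbf{R}_L)}\lesssim N^{-m}|\rho|_{m,\mathbf{R}_L}.$$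
   Context: For $a>0$, $\mathbf{R}_a:=[-a,a]^d$; $L>0$ is fixed. $U$ is a convolution kernel on $\mathbb{R}^d$, possibly singular at the origin and/or at the far field, and $\Phi(\mathbf{x})=(U\ast\rho)(\mathbf{x})=\int_{\mathbb{R}^d}U(\mathbf{x}-\mathbf{y})\rho(\mathbf{y})\,d\mathbf{y}$. For $\boldsymbol\alpha=(\alpha_1,\dots,\alpha_d)$ with nonnegative integer entries, $|\boldsymbol\alpha|=\sum_{i=1}^d\alpha_i$ and $\partial^{\boldsymbol\alpha}=\partial_{x_1}^{\alpha_1}\cdots\partial_{x_d}^{\alpha_d}$. The semi-norm is $|\rho|_{m,\mathbf{R}_L}:=\big(\sum_{|\boldsymbol\alpha|=m}\|\partial^{\boldsymbol\alpha}\rho\|_{L^2(\mathbf{R}_L)}^2\big)^{1/2}$. Numerical approximation: $N$ (even) is the number of equally spaced grid points in each direction on $\mathbf{R}_L$, and $S=\sqrt d+1$ is the (optimal) zero-padding factor, in practice rounded up to $\lceil\sqrt d+1\rceil$ ($2$ for $d=1$, $3$ for $d=2,3$). The density is extended by zero to $\mathbf{R}_{SL}$. Let $\mathcal{T}_{SN}=\{\tfrac{2L}{N}(p_1,\dots,p_d): p_j=-\tfrac{SN}{2},\dots,\tfrac{SN}{2}-1\}$ and $\Lambda=\{\tfrac{\pi}{SL}(k_1,\dots,k_d): k_j=-\tfrac{SN}{2},\dots,\tfrac{SN}{2}-1\}$, and define $$\widetilde\rho_{\mathbf{k}}=\frac{1}{(SN)^d}\sum_{\mathbf{z}\in\mathcal{T}_{SN}}\rho(\mathbf{z})e^{-i\mathbf{k}\cdot\mathbf{z}}\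 \ (\mathbf{k}\in\Lambda),\qquad \rho_N(\mathbf{z})=\sum_{\mathbf{k}\in\Lambda}\widetilde\rho_{\mathbf{k}}\,e^{i\mathbf{k}\cdot\mathbf{z}},$$ the Fourier interpolant of $\rho$ on $\mathcal{T}_{SN}$, extended $2SL$-periodically in each direction to $\mathbb{R}^d$. With $G=2\sqrt d\,L$ the diameter of $\mathbf{R}_L$ and $\mathbf{B}_G$ the ball of radius $G$ centered at the origin, $$(\partial^{\boldsymbol\alpha}\Phi)_N(\mathbf{x})=\int_{\mathbf{B}_G}U(\mathbf{y})\,(\partial^{\boldsymbol\alpha}\rho_N)(\mathbf{x}-\mathbf{y})\,d\mathbf{y},\qquad \mathbf{x}\in\mathbf{R}_L.$$ *)

theory Defs
  imports "HOL-Analysis.Analysis" "HOL-Probability.Essential_Supremum"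
begin

text \<open>
  The space dimension is \<open>CARD('d)\<close>. The linear order on the index type \<open>'d\<close> only serves to number
  the coordinates \<open>x\<^sub>1, ..., x\<^sub>d\<close>. Densities and kernels are complex valued, which
  covers real data; the Fourier interpolant of a real density is in general not real, because the
  frequency set contains \<open>- S N / 2\<close> but not \<open>S N / 2\<close>.
\<close>

definition cube :: "real \<Rightarrow> (real^'d) set" where
  "cube a = cbox (\<chi> j. - a) (\<chi> j. a)"

definition partial :: "'d \<Rightarrow> (real^'d \<Rightarrow> complex) \<Rightarrow> real^'d \<Rightarrow> complex" where
  "partial i f = (\<lambda>x. vector_derivative (\<lambda>t. f (x + t *\<^sub>R axis i 1)) (at 0))"

text \<open>\<open>multi_partial \<alpha> f\<close> is \<open>\<partial>\<^sub>1\<close> applied \<open>\<alpha>\<^sub>1\<close> times to ... to \<open>\<partial>\<^sub>d\<close> applied \<open>\<alpha>\<^sub>d\<close> times to \<open>f\<close>.\<close>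

definition multi_partial ::
    "('d::{finite,linorder} \<Rightarrow> nat) \<Rightarrow> ((real, 'd) vec \<Rightarrow> complex) \<Rightarrow> (real, 'd) vec \<Rightarrow> complex" where
  "multi_partial \<alpha> f = foldr (\<lambda>i g. (partial i ^^ \<alpha> i) g) (sorted_list_of_set UNIV) f"

definition mi_size :: "('d::finite \<Rightarrow> nat) \<Rightarrow> nat" where
  "mi_size \<alpha> = (\<Sum>i\<in>UNIV. \<alpha> i)"

text \<open>All iterated partial derivatives, in any order, exist and are differentiable (hence continuous).\<close>

definition smooth :: "(real^'d \<Rightarrow> complex) \<Rightarrow> bool" where
  "smooth f \<longleftrightarrow> (\<forall>is x. foldr partial is f differentiable (at x))"

definition admissible_density :: "real \<Rightarrow> (real^'d \<Rightarrow> complex) \<Rightarrow> bool" where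
  "admissible_density L \<rho> \<longleftrightarrow>
     smooth \<rho> \<and> compact (closure {x. \<rho> x \<noteq> 0}) \<and> closure {x. \<rho> x \<noteq> 0} \<subset> cube L"

text \<open>Both norms take the value \<open>\<infinity>\<close> on functions outside the respective Lebesgue space.\<close>

definition L2_norm :: "(real^'d) set \<Rightarrow> (real^'d \<Rightarrow> complex) \<Rightarrow> ereal" where
  "L2_norm A f =
     (if set_borel_measurable lebesgue A f \<and> set_integrable lebesgue A (\<lambda>x. (cmod (f x))\<^sup>2)
      then ereal (sqrt (LINT x:A|lebesgue. (cmod (f x))\<^sup>2)) else \<infinity>)"

definition Linf_norm :: "(real^'d) set \<Rightarrow> (real^'d \<Rightarrow> complex) \<Rightarrow> ereal" where
  "Linf_norm A f = esssup (restrict_space lebesgue A) (\<lambda>x. ereal (cmod (f x)))"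

definition sobolev_seminorm ::
    "nat \<Rightarrow> ((real, 'd::{finite,linorder}) vec) set \<Rightarrow> ((real, 'd) vec \<Rightarrow> complex) \<Rightarrow> real" where
  "sobolev_seminorm m A \<rho> =
     sqrt (\<Sum>\<alpha> | mi_size \<alpha> = m. (real_of_ereal (L2_norm A (multi_partial \<alpha> \<rho>)))\<^sup>2)"

definition potential :: "(real^'d \<Rightarrow> complex) \<Rightarrow> (real^'d \<Rightarrow> complex) \<Rightarrow> real^'d \<Rightarrow> complex" where
  "potential U \<rho> x = (LINT y|lebesgue. U (x - y) * \<rho> y)"

text \<open>
  The optimal factor \<open>sqrt d + 1\<close> is rounded up to an integer, so that \<open>S N / 2\<close> is an integer
  for even \<open>N\<close>.
\<close>

definition pad_factor :: "nat \<Rightarrow> nat" where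
  "pad_factor d = nat \<lceil>sqrt (real d) + 1\<rceil>"

definition centered_grid :: "real \<Rightarrow> nat \<Rightarrow> (real^'d) set" where
  "centered_grid h M =
     {(\<chi> j. h * of_int (p j)) | p. \<forall>j. p j \<in> {- (int M div 2) .. int M div 2 - 1}}"

definition space_grid :: "real \<Rightarrow> nat \<Rightarrow> (real^'d) set" where
  "space_grid L N = centered_grid (2 * L / real N) (pad_factor CARD('d) * N)"

definition freq_grid :: "real \<Rightarrow> nat \<Rightarrow> (real^'d) set" where
  "freq_grid L N =
     centered_grid (pi / (real (pad_factor CARD('d)) * L)) (pad_factor CARD('d) * N)"

definition dft_coeff ::
    "real \<Rightarrow> nat \<Rightarrow> (real^'d \<Rightarrow> complex) \<Rightarrow> real^'d \<Rightarrow> complex" where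
  "dft_coeff L N \<rho> k =
     1 / of_nat (pad_factor CARD('d) * N) ^ CARD('d) *
     (\<Sum>z\<in>space_grid L N. \<rho> z * exp (- \<i> * of_real (k \<bullet> z)))"

text \<open>
  The trigonometric sum is already periodic with period \<open>2 S L\<close> in each direction, so it
  is its own periodic extension.
\<close>

definition fourier_interpolant ::
    "real \<Rightarrow> nat \<Rightarrow> (real^'d \<Rightarrow> complex) \<Rightarrow> real^'d \<Rightarrow> complex" where
  "fourier_interpolant L N \<rho> x =
     (\<Sum>k\<in>freq_grid L N. dft_coeff L N \<rho> k * exp (\<i> * of_real (k \<bullet> x)))"

definition ktm_approx ::
    "((real, 'd::{finite,linorder}) vec \<Rightarrow> complex) \<Rightarrow> real \<Rightarrow> nat \<Rightarrow> ('d \<Rightarrow> nat) \<Rightarrow>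
     ((real, 'd) vec \<Rightarrow> complex) \<Rightarrow> (real, 'd) vec \<Rightarrow> complex" where
  "ktm_approx U L N \<alpha> \<rho> x =
     (LINT y : ball 0 (2 * sqrt (real CARD('d)) * L) | lebesgue.
        U y * multi_partial \<alpha> (fourier_interpolant L N \<rho>) (x - y))"

definition ktm_error ::
    "((real, 'd::{finite,linorder}) vec \<Rightarrow> complex) \<Rightarrow> real \<Rightarrow> nat \<Rightarrow> ('d \<Rightarrow> nat) \<Rightarrow>
     ((real, 'd) vec \<Rightarrow> complex) \<Rightarrow> (real, 'd) vec \<Rightarrow> complex" where
  "ktm_error U L N \<alpha> \<rho> x = multi_partial \<alpha> (potential U \<rho>) x - ktm_approx U L N \<alpha> \<rho> x"

end

theory Submission
  imports Defs
begin

text \<open>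
  With \<open>H = S L\<close>, the Fourier series of \<open>\<rho>\<close> on \<open>[-H, H]\<^sup>d\<close> represents \<open>\<rho>\<close>, extended by zero, on
  \<open>|x\<^sub>j| < 2 H - L\<close>. Since \<open>S \<ge> sqrt d + 1\<close>, this region contains \<open>x - y\<close> for all \<open>x\<close> in the cube and
  all \<open>y\<close> in the truncation ball, so the error is the convolution of the truncated kernel \<open>W\<close> with
  the trigonometric series of \<open>\<partial>\<^sup>\<alpha>(\<rho> - \<rho>\<^sub>N)\<close>. Convolution multiplies each coefficient of that series
  by a number of modulus at most \<open>\<parallel>W\<parallel>\<close> in \<open>L\<^sup>1\<close>; hence it suffices to bound the coefficients in
  \<open>l\<^sup>1\<close> (for the maximum norm) and in \<open>l\<^sup>2\<close> (for the \<open>L\<^sup>2\<close> norm).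

  Outside the frequency box the coefficients are those of \<open>\<rho>\<close>, inside they are sums of aliased
  coefficients of \<open>\<rho>\<close> at the nonzero translates by multiples of \<open>S N\<close>. Both are controlled by
  Cauchy-Schwarz from \<open>\<Sum> |n|\<^sup>2\<^sup>m |c\<^sub>n|\<^sup>2\<close>, which Bessel's inequality for the pure derivatives of
  order \<open>m\<close> bounds by the seminorm of \<open>\<rho>\<close>.

  If the constant may depend on \<open>\<rho>\<close>, then \<open>m\<close> may be replaced by any larger exponent, unless the
  seminorm of order \<open>m\<close> vanishes; but then all coefficients except \<open>c\<^sub>0\<close> vanish, and so does the
  error bound.
\<close>

section \<open>Smooth functions and potentials\<close>

text \<open>The condition \<open>m > d/2\<close> enters through a lattice sum: Cauchy-Schwarz over
  the nonzero translates \<open>l\<close> leaves the weights \<open>(1 + |l|)^(-2m)\<close>, which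
  are summable over the integer lattice exactly when \<open>2m > d\<close>. The maximum norm needs a
  second sum of this kind, with exponent \<open>2(m - |\<alpha>|)\<close>, over the frequencies
  outside the box. Hence a constant uniform in the density is claimed there only for
  \<open>|\<alpha>| + d/2 < m\<close>, while the mean square estimate asks for
  \<open>|\<alpha>| \<le> m\<close>. The loss \<open>N^(d/2)\<close> in the maximum norm is the
  square root of the number of residues modulo \<open>S N\<close>.

  Interpolation reads point values, so the Fourier series has to represent the density pointwise,
  also at the grid points on the faces of the cube of half-width \<open>H\<close>; mean square
  convergence would not do.

  Derivatives are indexed by lists of coordinates. Each list acts on a mode as one scalar factor, so
  partial derivatives never have to be interchanged.\<close>

lemma has_vector_derivative_iff_quotient:
  fixes f :: "real \<Rightarrow> 'a::real_normed_vector"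
  shows "(f has_vector_derivative d) (at x) \<longleftrightarrow> ((\<lambda>h. (f (x + h) - f x) /\<^sub>R h) \<longlongrightarrow> d) (at 0)"
proof -
  have "(f has_vector_derivative d) (at x) \<longleftrightarrow>
      ((\<lambda>h. norm (f (x + h) - f x - h *\<^sub>R d) / norm h) \<longlongrightarrow> 0) (at 0)"
    by (simp add: has_vector_derivative_def has_derivative_at bounded_linear_scaleR_left)
  also have "\<dots> \<longleftrightarrow> ((\<lambda>h. norm ((f (x + h) - f x) /\<^sub>R h - d)) \<longlongrightarrow> 0) (at 0)"
  proof (rule filterlim_cong[OF refl refl])
    show "\<forall>\<^sub>F h in at 0. norm (f (x + h) - f x - h *\<^sub>R d) / norm h = norm ((f (x + h) - f x) /\<^sub>R h - d)"
      unfolding eventually_at_filter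
    proof (intro always_eventually allI impI)
      fix h :: real assume "h \<noteq> 0"
      hence "(f (x + h) - f x) /\<^sub>R h - d = (f (x + h) - f x - h *\<^sub>R d) /\<^sub>R h"
        by (simp add: scaleR_diff_right)
      thus "norm (f (x + h) - f x - h *\<^sub>R d) / norm h = norm ((f (x + h) - f x) /\<^sub>R h - d)"
        by (simp add: divide_inverse_commute)
    qed
  qed
  also have "\<dots> \<longleftrightarrow> ((\<lambda>h. (f (x + h) - f x) /\<^sub>R h) \<longlongrightarrow> d) (at 0)"
    by (simp add: tendsto_norm_zero_iff LIM_zero_iff)
  finally show ?thesis .
qed

text \<open>The strict inequality is available because the nonzero set of a continuous function is
  open and so lies in the interior of the cube. It makes \<open>f\<close> vanish on the faces as
  well.\<close>

definition test_fun :: "real \<Rightarrow> (real^'d \<Rightarrow> complex) \<Rightarrow> bool" where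
  "test_fun L f \<longleftrightarrow> smooth f \<and> (\<forall>x. f x \<noteq> 0 \<longrightarrow> (\<forall>j. \<bar>x $ j\<bar> < L))"

lemma partial_eq:
  assumes "(f has_derivative f') (at x)"
  shows "partial i f x = f' (axis i 1)"
    and "((\<lambda>t. f (x + t *\<^sub>R axis i 1)) has_vector_derivative f' (axis i 1)) (at 0)"
proof -
  show *: "((\<lambda>t. f (x + t *\<^sub>R axis i 1)) has_vector_derivative f' (axis i 1)) (at 0)"
  proof -
    have l: "linear f'" using assms has_derivative_linear by blast
    have "((\<lambda>t. x + t *\<^sub>R axis i 1) has_derivative (\<lambda>t. t *\<^sub>R axis i 1)) (at (0::real))"
      by (auto intro!: derivative_eq_intros)
    from has_derivative_compose[OF this, of f f'] assms
    have "((\<lambda>t. f (x + t *\<^sub>R axis i 1)) has_derivative (\<lambda>t. f' (t *\<^sub>R axis i 1))) (at 0)"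
      by simp
    thus ?thesis unfolding has_vector_derivative_def using l by (simp add: linear_scale)
  qed
  show "partial i f x = f' (axis i 1)"
    unfolding partial_def using * by (rule vector_derivative_at)
qed

lemma smooth_partial: "smooth f \<Longrightarrow> smooth (partial i f)"
  unfolding smooth_def
proof (intro allI)
  fix "is" x assume "\<forall>is x. foldr partial is f differentiable at x"
  hence "foldr partial (is @ [i]) f differentiable at x" by blast
  thus "foldr partial is (partial i f) differentiable at x" by simp
qed

lemma smooth_differentiable: "smooth f \<Longrightarrow> f differentiable (at x)"
  unfolding smooth_def by (metis foldr_Nil id_apply)

lemma smooth_continuous_on: "smooth f \<Longrightarrow> continuous_on S f"
  by (meson continuous_at_imp_continuous_on differentiable_imp_continuous_within smooth_differentiable)

lemma smooth_line_derivative: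
  assumes "smooth f"
  shows "((\<lambda>t. f (x + t *\<^sub>R axis i 1)) has_vector_derivative partial i f (x + s *\<^sub>R axis i 1)) (at s)"
proof -
  obtain f' where f': "(f has_derivative f') (at (x + s *\<^sub>R axis i 1))"
    using smooth_differentiable[OF assms] by (auto simp: differentiable_def)
  have l: "linear f'" using f' has_derivative_linear by blast
  have "((\<lambda>t. x + t *\<^sub>R axis i 1) has_derivative (\<lambda>t. t *\<^sub>R axis i 1)) (at s)"
    by (auto intro!: derivative_eq_intros)
  from has_derivative_compose[OF this, of f f'] f'
  have "((\<lambda>t. f (x + t *\<^sub>R axis i 1)) has_derivative (\<lambda>t. f' (t *\<^sub>R axis i 1))) (at s)"
    by simp
  thus ?thesis unfolding has_vector_derivative_def partial_eq(1)[OF f'] using l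
    by (simp add: linear_scale)
qed

lemma mem_cube: "x \<in> cube a \<longleftrightarrow> (\<forall>j. \<bar>x $ j\<bar> \<le> a)"
  unfolding cube_def mem_box_cart by (simp add: abs_le_iff minus_le_iff conj_commute)

lemma interior_cube: "interior (cube a) = {x. \<forall>j. \<bar>x $ j\<bar> < a}"
  unfolding cube_def interior_cbox by (simp add: set_eq_iff mem_box_cart abs_less_iff minus_less_iff conj_commute)

lemma compact_cube: "compact (cube a)"
  unfolding cube_def by (rule compact_cbox)

lemma continuous_support_interior:
  fixes f :: "real^'d \<Rightarrow> complex"
  assumes "continuous_on UNIV f" "\<And>x. f x \<noteq> 0 \<Longrightarrow> x \<in> cube L" "f x \<noteq> 0"
  shows "\<bar>x $ j\<bar> < L"
proof -
  have "open {x. f x \<noteq> 0}"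
    using assms(1) by (intro open_Collect_neq) auto
  moreover have "{x. f x \<noteq> 0} \<subseteq> cube L" using assms(2) by auto
  ultimately have "{x. f x \<noteq> 0} \<subseteq> interior (cube L)" by (rule interior_maximal[rotated])
  thus ?thesis using assms(3) unfolding interior_cube by auto
qed

lemma test_funD:
  assumes "test_fun L f"
  shows "smooth f" "f x \<noteq> 0 \<Longrightarrow> \<bar>x $ j\<bar> < L" "L \<le> \<bar>x $ j\<bar> \<Longrightarrow> f x = 0"
proof -
  show "smooth f" and *: "\<And>x j. f x \<noteq> 0 \<Longrightarrow> \<bar>x $ j\<bar> < L" using assms unfolding test_fun_def by blast+
  show "L \<le> \<bar>x $ j\<bar> \<Longrightarrow> f x = 0" using *[of x j] by (rule_tac ccontr) auto
qed

lemma test_fun_continuous: "test_fun L f \<Longrightarrow> continuous_on S f"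
  by (rule smooth_continuous_on[OF test_funD(1)])

lemma admissible_test_fun:
  assumes "admissible_density L \<rho>" shows "test_fun L \<rho>"
  unfolding test_fun_def
proof (intro conjI allI impI)
  show s: "smooth \<rho>" using assms by (simp add: admissible_density_def)
  fix x j assume "\<rho> x \<noteq> 0"
  moreover have "\<rho> x \<noteq> 0 \<Longrightarrow> x \<in> cube L" for x
    using assms closure_subset[of "{x. \<rho> x \<noteq> 0}"] unfolding admissible_density_def by blast
  ultimately show "\<bar>x $ j\<bar> < L"
    by (intro continuous_support_interior[OF smooth_continuous_on[OF s]])
qed

lemma test_fun_partial:
  assumes "test_fun L f" shows "test_fun L (partial i f)"
  unfolding test_fun_def
proof (intro conjI allI impI)
  show s: "smooth (partial i f)" by (rule smooth_partial[OF test_funD(1)[OF assms]])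
  have "x \<in> cube L" if "partial i f x \<noteq> 0" for x
  proof (rule ccontr)
    assume x: "x \<notin> cube L"
    have "(f has_derivative (\<lambda>_. 0)) (at x)"
    proof (rule has_derivative_transform_within_open[OF has_derivative_const])
      show "open (- cube L :: (real^'a) set)" by (simp add: compact_cube compact_imp_closed open_Compl)
      show "x \<in> - cube L" using x by simp
      show "\<And>y. y \<in> - cube L \<Longrightarrow> 0 = f y"
        using test_funD(2)[OF assms] by (fastforce simp: mem_cube dest: less_imp_le)
    qed
    from partial_eq(1)[OF this] that show False by simp
  qed
  moreover fix x j assume "partial i f x \<noteq> 0"
  ultimately show "\<bar>x $ j\<bar> < L"
    by (intro continuous_support_interior[OF smooth_continuous_on[OF s]])
qed

lemma test_fun_foldr_partial: "test_fun L f \<Longrightarrow> test_fun L (foldr partial is f)"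
  by (induction "is") (auto intro: test_fun_partial)

lemma test_fun_bounded:
  assumes "test_fun L f" obtains B where "0 < B" "\<And>x. cmod (f x) \<le> B"
proof -
  have "bounded (f ` cube L)"
    by (intro compact_imp_bounded compact_continuous_image test_fun_continuous[OF assms] compact_cube)
  then obtain B where B: "B > 0" "\<And>x. x \<in> cube L \<Longrightarrow> cmod (f x) \<le> B"
    unfolding bounded_pos by auto
  have "cmod (f x) \<le> B" for x
  proof (cases "f x = 0")
    case False
    thus ?thesis using B(2) test_funD(2)[OF assms False] by (auto simp: mem_cube less_imp_le)
  qed (use B in auto)
  with B that show ?thesis by blast
qed

text \<open>Supplies the constant that dominates the difference quotients in
  \<open>partial_potential\<close>.\<close>

lemma test_fun_line_lipschitz:
  assumes "test_fun L f" "\<And>x. cmod (partial i f x) \<le> B"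
  shows "cmod (f (x + t *\<^sub>R axis i 1) - f x) \<le> B * \<bar>t\<bar>"
proof -
  have "norm ((\<lambda>t. f (x + t *\<^sub>R axis i 1)) t - (\<lambda>t. f (x + t *\<^sub>R axis i 1)) 0) \<le> B * norm (t - 0)"
  proof (rule differentiable_bound[of UNIV])
    fix s
    show "((\<lambda>t. f (x + t *\<^sub>R axis i 1)) has_derivative (\<lambda>h. h *\<^sub>R partial i f (x + s *\<^sub>R axis i 1))) (at s)"
      using smooth_line_derivative[OF test_funD(1)[OF assms(1)]] by (simp add: has_vector_derivative_def)
    show "onorm (\<lambda>h. h *\<^sub>R partial i f (x + s *\<^sub>R axis i 1)) \<le> B"
      using assms(2) 
      by (intro onorm_le) (auto intro!: mult_left_mono simp: mult.commute[of B])
  qed auto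
  thus ?thesis by simp
qed

section \<open>Differentiation of the potential under the integral sign\<close>

definition locally_integrable :: "(real^'d \<Rightarrow> complex) \<Rightarrow> bool" where
  "locally_integrable U \<longleftrightarrow> (\<forall>K. compact K \<longrightarrow> set_integrable lebesgue K U)"

lemma locally_integrable_measurable:
  fixes U :: "real^'d \<Rightarrow> complex"
  assumes "locally_integrable U" shows "U \<in> borel_measurable lebesgue"
proof (rule borel_measurable_LIMSEQ_metric)
  show "(\<lambda>x. indicator (cube (real k)) x *\<^sub>R U x) \<in> borel_measurable lebesgue" for k
    using assms unfolding locally_integrable_def set_integrable_def
    by (intro borel_measurable_integrable) (simp add: compact_cube)
  fix x :: "real^'d"
  obtain k0 :: nat where k0: "norm x \<le> real k0" using real_arch_simple by blast
  have "\<forall>\<^sub>F k in sequentially. indicator (cube (real k)) x *\<^sub>R U x = U x"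
    unfolding eventually_sequentially
  proof (intro exI[of _ k0] allI impI)
    fix k assume "k0 \<le> k"
    hence "\<bar>x $ j\<bar> \<le> real k" for j using component_le_norm_cart[of x j] k0 by linarith
    thus "indicator (cube (real k)) x *\<^sub>R U x = U x" by (simp add: mem_cube)
  qed
  thus "(\<lambda>k. indicator (cube (real k)) x *\<^sub>R U x) \<longlonglongrightarrow> U x" by (rule tendsto_eventually)
qed

lemma continuous_measurable_lebesgue:
  fixes g :: "real^'d \<Rightarrow> complex"
  assumes "continuous_on UNIV g" shows "g \<in> borel_measurable lebesgue"
  using assms by (simp add: borel_measurable_continuous_onI measurable_completion)

lemma integrable_mult_bounded:
  fixes W h :: "real^'d \<Rightarrow> complex"
  assumes "integrable lebesgue W" "h \<in> borel_measurable lebesgue" "\<And>y. cmod (h y) \<le> B"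
  shows "integrable lebesgue (\<lambda>y. W y * h y)"
proof (rule Bochner_Integration.integrable_bound)
  show "integrable lebesgue (\<lambda>y. B * cmod (W y))" using assms(1) by auto
  show "(\<lambda>y. W y * h y) \<in> borel_measurable lebesgue" using assms by measurable
  show "AE y in lebesgue. norm (W y * h y) \<le> norm (B * cmod (W y))"
  proof (rule AE_I2)
    fix y
    have "cmod (W y) * cmod (h y) \<le> cmod (W y) * B" by (intro mult_left_mono assms) auto
    also have "\<dots> \<le> \<bar>B * cmod (W y)\<bar>" by (simp add: mult.commute)
    finally show "norm (W y * h y) \<le> norm (B * cmod (W y))" by (simp add: norm_mult)
  qed
qed

lemma locally_integrable_indicator:
  assumes "locally_integrable U" "compact K"
  shows "integrable lebesgue (\<lambda>y. indicator K y * U y)"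
proof -
  have "(\<lambda>y. indicator K y * U y) = (\<lambda>y. indicat_real K y *\<^sub>R U y)"
    by (auto simp: indicator_def)
  thus ?thesis using assms by (simp add: locally_integrable_def set_integrable_def)
qed

text \<open>Only a reflected translate of the cube contributes. It is compact, so local
  integrability of the kernel is enough, whatever its far field.\<close>

lemma conv_integrable:
  fixes U f :: "real^'d \<Rightarrow> complex"
  assumes U: "locally_integrable U" and f: "test_fun L f"
  shows "integrable lebesgue (\<lambda>y. U y * f (x - y))"
proof -
  define K where "K = (\<lambda>y. x - y) ` cube L"
  have K: "compact K" unfolding K_def
    by (intro compact_continuous_image compact_cube continuous_intros)
  obtain B where B: "\<And>x. cmod (f x) \<le> B" using test_fun_bounded[OF f] by metis
  have "integrable lebesgue (\<lambda>y. (indicator K y * U y) * f (x - y))"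
  proof (rule integrable_mult_bounded[OF locally_integrable_indicator[OF U K]])
    show "(\<lambda>y. f (x - y)) \<in> borel_measurable lebesgue"
      by (intro continuous_measurable_lebesgue continuous_on_compose2[OF test_fun_continuous[OF f, of UNIV]])
         (auto intro!: continuous_intros)
  qed (rule B)
  moreover have "(indicator K y * U y) * f (x - y) = U y * f (x - y)" for y
  proof (cases "f (x - y) = 0")
    case False
    hence "x - y \<in> cube L" using test_funD(2)[OF f False] unfolding mem_cube by (simp add: less_imp_le)
    hence "y \<in> K" unfolding K_def by (rule_tac image_eqI[of _ _ "x - y"]) auto
    thus ?thesis by simp
  qed simp
  ultimately show ?thesis by simp
qed

lemma integral_lebesgue_reflect:
  fixes f :: "real^'d \<Rightarrow> complex"
  assumes "f \<in> borel_measurable lebesgue"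
  shows "(LINT y|lebesgue. f y) = (LINT y|lebesgue. f (x - y))"
proof -
  have eq: "(\<lambda>y::real^'d. x + (\<Sum>j\<in>Basis. (-1 * (y \<bullet> j)) *\<^sub>R j)) = (\<lambda>y. x - y)"
    by (auto simp: sum_negf euclidean_representation)
  have d: "lebesgue = density (distr lebesgue lebesgue (\<lambda>y. x - y)) (\<lambda>_. 1)"
    and m: "(\<lambda>y. x - y) \<in> lebesgue \<rightarrow>\<^sub>M lebesgue"
    using lebesgue_affine_euclidean[of "\<lambda>_. -1" x] lebesgue_affine_measurable[of "\<lambda>_. -1" x]
    unfolding eq by simp_all
  have "lebesgue = distr lebesgue lebesgue (\<lambda>y. x - y)" using d by (simp add: density_1)
  hence "(LINT y|lebesgue. f y) = (LINT y|distr lebesgue lebesgue (\<lambda>y. x - y). f y)" by simp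
  also have "\<dots> = (LINT y|lebesgue. f (x - y))" by (rule integral_distr[OF m assms])
  finally show ?thesis .
qed

text \<open>The reflection moves \<open>x\<close> into the smooth factor, so that differentiating
  the potential never touches the possibly singular kernel.\<close>

lemma potential_eq:
  fixes U f :: "real^'d \<Rightarrow> complex"
  assumes U: "locally_integrable U" and f: "test_fun L f"
  shows "potential U f x = (LINT y|lebesgue. U y * f (x - y))"
  using integral_lebesgue_reflect[OF borel_measurable_integrable[OF conv_integrable[OF assms]], of x x]
  unfolding potential_def by simp

text \<open>Dominated convergence for difference quotients along an arbitrary null sequence; the
  majorant is a bound for the derivative times the kernel cut off to one compact set.\<close>

lemma partial_potential:
  fixes U f :: "real^'d \<Rightarrow> complex"
  assumes U: "locally_integrable U" and f: "test_fun L f"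
  shows "partial i (potential U f) = potential U (partial i f)"
proof
  fix x :: "real^'d"
  let ?e = "axis i 1 :: real^'d"
  note pf = test_fun_partial[OF f, of i]
  obtain B where B: "0 < B" "\<And>x. cmod (partial i f x) \<le> B" using test_fun_bounded[OF pf] by metis
  \<comment> \<open>The margin 1 makes a single compact set contain the supports for all shifts
    \<open>t\<close> with \<open>\<bar>t\<bar> < 1\<close>.\<close>
  define K where "K = (\<lambda>y. x - y) ` cube (L + 1)"
  have K: "compact K" unfolding K_def
    by (intro compact_continuous_image compact_cube continuous_intros)
  define F where "F t = (LINT y|lebesgue. U y * f (x + t *\<^sub>R ?e - y))" for t
  define F' where "F' = (LINT y|lebesgue. U y * partial i f (x - y))"
  have quot: "((\<lambda>t. (F t - F 0) /\<^sub>R t) \<longlongrightarrow> F') (at 0)"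
    unfolding tendsto_at_iff_sequentially
  proof (intro allI impI)
    fix X :: "nat \<Rightarrow> real"
    assume X: "\<forall>k. X k \<in> UNIV - {0}" "X \<longlonglongrightarrow> 0"
    define Q where "Q k y = (f (x + X k *\<^sub>R ?e - y) - f (x - y)) /\<^sub>R X k" for k y
    have Qlim: "(\<lambda>k. U y * Q k y) \<longlonglongrightarrow> U y * partial i f (x - y)" for y
    proof (rule tendsto_mult_left)
      have "((\<lambda>t. f ((x - y) + t *\<^sub>R ?e)) has_vector_derivative partial i f (x - y)) (at 0)"
        using smooth_line_derivative[OF test_funD(1)[OF f], of "x - y" i 0] by simp
      hence "((\<lambda>h. (f ((x - y) + h *\<^sub>R ?e) - f (x - y)) /\<^sub>R h) \<longlongrightarrow> partial i f (x - y)) (at 0)"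
        by (simp add: has_vector_derivative_iff_quotient)
      hence "((\<lambda>h. (f ((x - y) + h *\<^sub>R ?e) - f (x - y)) /\<^sub>R h) \<circ> X) \<longlonglongrightarrow> partial i f (x - y)"
        using X unfolding tendsto_at_iff_sequentially by blast
      thus "(\<lambda>k. Q k y) \<longlonglongrightarrow> partial i f (x - y)"
        by (simp add: Q_def o_def algebra_simps)
    qed
    have Qb: "cmod (Q k y) \<le> B" for k y
    proof -
      have "cmod (f ((x - y) + X k *\<^sub>R ?e) - f (x - y)) \<le> B * \<bar>X k\<bar>"
        by (rule test_fun_line_lipschitz[OF f B(2)])
      moreover have "x - y + X k *\<^sub>R ?e = x + X k *\<^sub>R ?e - y" by simp
      moreover have "0 < \<bar>X k\<bar>" using X(1) by simp
      ultimately show ?thesis by (simp add: Q_def pos_divide_le_eq divide_inverse_commute[symmetric])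
    qed
    have "\<forall>\<^sub>F k in sequentially. \<bar>X k\<bar> < 1"
      using order_tendstoD(2)[OF tendsto_rabs_zero[OF X(2)], of 1] by simp
    then obtain k0 where k0: "\<And>k. k \<ge> k0 \<Longrightarrow> \<bar>X k\<bar> < 1" unfolding eventually_sequentially by blast
    have QK: "U y * Q k y = (indicator K y * U y) * Q k y" if "k \<ge> k0" for k y
    proof (cases "y \<in> K")
      case False
      have "x - y \<notin> cube (L + 1)" using False unfolding K_def by force
      then obtain j where j: "\<bar>(x - y) $ j\<bar> > L + 1" by (auto simp: mem_cube not_le)
      have "\<bar>(X k *\<^sub>R ?e) $ j\<bar> \<le> 1" using k0[OF that] by (simp add: axis_def)
      hence "\<bar>(x + X k *\<^sub>R ?e - y) $ j\<bar> \<ge> L" using j by (simp add: axis_def)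
      hence "f (x + X k *\<^sub>R ?e - y) = 0" by (rule test_funD(3)[OF f])
      moreover have "f (x - y) = 0" using j by (intro test_funD(3)[OF f, of _ j]) linarith
      ultimately show ?thesis by (simp add: Q_def)
    qed simp
    have fm: "(\<lambda>y. f (z - y)) \<in> borel_measurable lebesgue" for z
      by (intro continuous_measurable_lebesgue continuous_on_compose2[OF test_fun_continuous[OF f, of UNIV]])
         (auto intro!: continuous_intros)
    have Qm: "Q k \<in> borel_measurable lebesgue" for k
      unfolding Q_def by (intro borel_measurable_scaleR borel_measurable_diff fm) auto
    \<comment> \<open>The majorant is valid only from index \<open>k0\<close> on, where the shifts
      are below 1; \<open>LIMSEQ_offset\<close> removes the offset at the end.\<close>
    have lim: "(\<lambda>k. LINT y|lebesgue. U y * Q (k + k0) y) \<longlonglongrightarrow> F'"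
      unfolding F'_def
    proof (rule integral_dominated_convergence)
      show "(\<lambda>y. U y * partial i f (x - y)) \<in> borel_measurable lebesgue"
        by (rule borel_measurable_integrable[OF conv_integrable[OF U pf]])
      show "(\<lambda>y. U y * Q (k + k0) y) \<in> borel_measurable lebesgue" for k
        using locally_integrable_measurable[OF U] Qm by measurable
      show "integrable lebesgue (\<lambda>y. B * cmod (indicator K y * U y))"
        using locally_integrable_indicator[OF U K] by auto
      show "AE y in lebesgue. (\<lambda>k. U y * Q (k + k0) y) \<longlonglongrightarrow> U y * partial i f (x - y)"
        using LIMSEQ_ignore_initial_segment[OF Qlim] by auto
      show "AE y in lebesgue. norm (U y * Q (k + k0) y) \<le> B * cmod (indicator K y * U y)" for k
      proof (rule AE_I2)
        fix y
        show "norm (U y * Q (k + k0) y) \<le> B * cmod (indicator K y * U y)"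
          unfolding QK[OF le_add2] norm_mult[of _ "Q (k+k0) y"]
          using Qb by (subst mult.commute) (intro mult_right_mono, auto)
      qed
    qed
    have "(F (X k) - F 0) /\<^sub>R X k = (LINT y|lebesgue. U y * Q k y)" for k
    proof -
      have "F (X k) - F 0 = (LINT y|lebesgue. U y * f (x + X k *\<^sub>R ?e - y) - U y * f (x - y))"
        unfolding F_def using conv_integrable[OF U f, of x] conv_integrable[OF U f, of "x + X k *\<^sub>R ?e"]
        by (subst Bochner_Integration.integral_diff) simp_all
      thus ?thesis by (simp add: Q_def right_diff_distrib scaleR_diff_right flip: integral_scaleR_right)
    qed
    with lim have "(\<lambda>k. (F (X (k + k0)) - F 0) /\<^sub>R X (k + k0)) \<longlonglongrightarrow> F'" by simp
    thus "((\<lambda>t. (F t - F 0) /\<^sub>R t) \<circ> X) \<longlonglongrightarrow> F'" unfolding o_def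
      by (rule LIMSEQ_offset)
  qed
  have "(F has_vector_derivative F') (at 0)"
    using quot by (simp add: has_vector_derivative_iff_quotient)
  moreover have "(\<lambda>t. potential U f (x + t *\<^sub>R ?e)) = F"
    unfolding F_def potential_eq[OF U f] by simp
  ultimately show "partial i (potential U f) x = potential U (partial i f) x"
    unfolding partial_def[of i "potential U f"] potential_eq[OF U pf] F'_def
    by (simp add: vector_derivative_at)
qed

lemma foldr_partial_potential:
  assumes "locally_integrable U" "test_fun L f"
  shows "foldr partial is (potential U f) = potential U (foldr partial is f)"
  by (induction "is") (auto simp: partial_potential[OF assms(1) test_fun_foldr_partial[OF assms(2)]])

section \<open>Trigonometric modes\<close>

text \<open>Modes are indexed by integer vectors instead of wave vectors, so that aliasing becomes
  congruence of indices.\<close>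

definition mode :: "real \<Rightarrow> ('d::finite \<Rightarrow> int) \<Rightarrow> real^'d \<Rightarrow> complex" where
  "mode H n x = cis (pi / H * (\<Sum>j\<in>UNIV. of_int (n j) * x $ j))"

lemma norm_mode [simp]: "cmod (mode H n x) = 1"
  by (simp add: mode_def)

lemma mode_zero [simp]: "mode H (\<lambda>_. 0) x = 1"
  by (simp add: mode_def)

lemma mode_mult: "mode H n x * mode H k x = mode H (\<lambda>j. n j + k j) x"
  by (simp add: mode_def cis_mult sum.distrib algebra_simps)

lemma mode_cnj: "cnj (mode H n x) = mode H (\<lambda>j. - n j) x"
  by (simp add: mode_def cis_cnj sum_negf)

lemma mode_diff: "mode H n (x - y) = mode H n x * cnj (mode H n y)"
  by (simp add: mode_def cis_cnj cis_mult sum_subtractf algebra_simps)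

lemma mode_mult_cnj: "mode H n x * cnj (mode H k x) = mode H (\<lambda>j. n j - k j) x"
  by (simp add: mode_cnj mode_mult)

lemma continuous_on_mode [continuous_intros]: "continuous_on S (mode H n)"
  unfolding mode_def by (intro continuous_intros)

definition wavenumber :: "real \<Rightarrow> int \<Rightarrow> complex" where
  "wavenumber H a = \<i> * of_real (pi / H * of_int a)"

text \<open>The Fourier multiplier of the iterated derivative
  \<open>foldr partial is\<close>.\<close>

definition symbol :: "real \<Rightarrow> 'd list \<Rightarrow> ('d \<Rightarrow> int) \<Rightarrow> complex" where
  "symbol H is n = prod_list (map (\<lambda>i. wavenumber H (n i)) is)"

lemma symbol_Nil [simp]: "symbol H [] n = 1"
  and symbol_Cons: "symbol H (i # is) n = wavenumber H (n i) * symbol H is n"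
  by (simp_all add: symbol_def)

lemma mode_line_derivative:
  "((\<lambda>t. mode H n (x + t *\<^sub>R axis i 1)) has_vector_derivative
     wavenumber H (n i) * mode H n x) (at 0)"
proof -
  have "(\<Sum>j\<in>UNIV. of_int (n j) * (x + t *\<^sub>R axis i 1) $ j)
      = (\<Sum>j\<in>UNIV. of_int (n j) * x $ j) + t * of_int (n i)" for t :: real
  proof -
    have "(\<Sum>j\<in>UNIV. of_int (n j) * (x + t *\<^sub>R axis i 1) $ j)
      = (\<Sum>j\<in>UNIV. of_int (n j) * x $ j + (if j = i then t * of_int (n i) else 0))"
      by (intro sum.cong) (auto simp: axis_def algebra_simps)
    thus ?thesis by (simp add: sum.distrib)
  qed
  hence eq: "mode H n (x + t *\<^sub>R axis i 1) = mode H n x * exp (wavenumber H (n i) * of_real t)" for t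
    by (simp add: mode_def wavenumber_def cis_conv_exp exp_add[symmetric] algebra_simps)
  have "((\<lambda>t. mode H n x * exp (wavenumber H (n i) * of_real t)) has_vector_derivative
      mode H n x * (wavenumber H (n i))) (at 0)"
    by (rule derivative_eq_intros has_vector_derivative_real_field | simp)+
  thus ?thesis unfolding eq by (simp add: mult_ac)
qed

lemma partial_trig_sum:
  "partial i (\<lambda>x. \<Sum>n\<in>F. c n * mode H n x)
     = (\<lambda>x. \<Sum>n\<in>F. wavenumber H (n i) * c n * mode H n x)"
proof
  fix x :: "real^'a"
  have "((\<lambda>t. \<Sum>n\<in>F. c n * mode H n (x + t *\<^sub>R axis i 1)) has_vector_derivative
      (\<Sum>n\<in>F. c n * (wavenumber H (n i) * mode H n x))) (at 0)"
    by (intro has_vector_derivative_sum has_vector_derivative_mult_right mode_line_derivative)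
  thus "partial i (\<lambda>x. \<Sum>n\<in>F. c n * mode H n x) x
     = (\<Sum>n\<in>F. wavenumber H (n i) * c n * mode H n x)"
    unfolding partial_def by (simp add: vector_derivative_at mult_ac)
qed

lemma foldr_partial_trig_sum:
  "foldr partial is (\<lambda>x. \<Sum>n\<in>F. c n * mode H n x)
     = (\<lambda>x. \<Sum>n\<in>F. symbol H is n * c n * mode H n x)"
proof (induction "is")
  case (Cons i "is")
  thus ?case
    using partial_trig_sum[where c = "\<lambda>n. symbol H is n * c n"] by (simp add: symbol_Cons mult.assoc)
qed simp

text \<open>In particular a mode may serve as the kernel of a potential, which is how Fourier
  coefficients of derivatives are computed.\<close>

lemma locally_integrable_continuous:
  fixes g :: "real^'d \<Rightarrow> complex"
  assumes "continuous_on UNIV g" shows "locally_integrable g"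
  unfolding locally_integrable_def set_integrable_def
proof (intro allI impI)
  fix K :: "(real^'d) set" assume K: "compact K"
  have "integrable lborel (\<lambda>x. indicat_real K x *\<^sub>R g x)"
    by (rule borel_integrable_compact[OF K]) (rule continuous_on_subset[OF assms], simp)
  thus "integrable lebesgue (\<lambda>x. indicat_real K x *\<^sub>R g x)"
    using integrable_completion[of _ lborel] borel_measurable_integrable by blast
qed

text \<open>The integral runs over the whole space so that it is a convolution with a mode. For
  functions supported in \<open>cube H\<close> it is the usual coefficient of the periodic
  extension; see \<open>fourier_coeff_cube\<close>.\<close>

definition fourier_coeff :: "real \<Rightarrow> (real^'d \<Rightarrow> complex) \<Rightarrow> ('d \<Rightarrow> int) \<Rightarrow> complex" where
  "fourier_coeff H f n = (LINT y|lebesgue. f y * cnj (mode H n y)) / of_real (2 * H) ^ CARD('d)"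

lemma potential_mode:
  fixes f :: "real^'d \<Rightarrow> complex"
  assumes "0 < H"
  shows "potential (mode H n) f x = mode H n x * of_real (2 * H) ^ CARD('d) * fourier_coeff H f n"
proof -
  have "potential (mode H n) f x = (LINT y|lebesgue. mode H n x * (f y * cnj (mode H n y)))"
    unfolding potential_def mode_diff by (simp add: mult_ac)
  also have "\<dots> = mode H n x * (LINT y|lebesgue. f y * cnj (mode H n y))" by simp
  finally show ?thesis using assms by (simp add: fourier_coeff_def)
qed

text \<open>Convolution with a mode is a multiple of that mode, so differentiating the convolution replaces
  an integration by parts.\<close>

lemma fourier_coeff_partial:
  fixes f :: "real^'d \<Rightarrow> complex"
  assumes "0 < H" "test_fun L f"
  shows "fourier_coeff H (partial i f) n = wavenumber H (n i) * fourier_coeff H f n"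
proof -
  let ?C = "of_real (2 * H) ^ CARD('d) :: complex"
  have "potential (mode H n) (partial i f) = partial i (potential (mode H n) f)"
    using partial_potential[OF locally_integrable_continuous[OF continuous_on_mode] assms(2)] by metis
  also have "potential (mode H n) f = (\<lambda>x. \<Sum>k\<in>{n}. ?C * fourier_coeff H f n * mode H k x)"
    using assms(1) by (auto simp: potential_mode mult_ac)
  finally have "potential (mode H n) (partial i f) 0
      = wavenumber H (n i) * (?C * fourier_coeff H f n) * mode H n 0"
    unfolding partial_trig_sum by simp
  moreover have "mode H n 0 = 1" by (simp add: mode_def)
  ultimately show ?thesis using assms(1) by (simp add: potential_mode)
qed

lemma fourier_coeff_foldr_partial:
  assumes "0 < H" "test_fun L f"
  shows "fourier_coeff H (foldr partial is f) n = symbol H is n * fourier_coeff H f n"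
proof (induction "is")
  case (Cons i "is")
  thus ?case
    by (simp add: fourier_coeff_partial[OF assms(1) test_fun_foldr_partial[OF assms(2)]] symbol_Cons mult.assoc)
qed simp

section \<open>Orthogonality of the modes on a period cube\<close>

lemma Basis_cart: "(Basis :: (real^'d) set) = range (\<lambda>i. axis i 1)"
  by (auto simp: Basis_vec_def)

lemma integral_cis_period:
  assumes "0 < H"
  shows "integrable lborel (\<lambda>t. indicator {-H..H} t * cis (pi / H * of_int a * t))"
    and "(LINT t|lborel. indicator {-H..H} t * cis (pi / H * of_int a * t)) = (if a = 0 then of_real (2 * H) else 0)"
proof -
  let ?f = "\<lambda>t. cis (pi / H * of_int a * t)"
  have c: "continuous_on {-H..H} ?f" by (intro continuous_intros)
  have eq: "indicator {-H..H} t * ?f t = indicat_real {-H..H} t *\<^sub>R ?f t" for t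
    by (auto simp: indicator_def)
  show "integrable lborel (\<lambda>t. indicator {-H..H} t * ?f t)"
    unfolding eq by (rule borel_integrable_compact[OF compact_Icc c])
  show "(LINT t|lborel. indicator {-H..H} t * ?f t) = (if a = 0 then of_real (2 * H) else 0)"
  proof (cases "a = 0")
    case True
    thus ?thesis using assms unfolding eq by (simp add: scaleR_conv_of_real)
  next
    case False
    define w where "w = wavenumber H a"
    have w: "w \<noteq> 0" using False assms by (simp add: w_def wavenumber_def)
    have f: "?f t = exp (w * of_real t)" for t by (simp add: w_def wavenumber_def cis_conv_exp mult.assoc)
    have "((\<lambda>t. exp (w * of_real t) / w) has_vector_derivative exp (w * of_real t)) (at t within {-H..H})" for t
      using w by (intro has_vector_derivative_real_field[of "\<lambda>z. exp (w * z) / w"]) (auto intro!: derivative_eq_intros)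
    hence "(LINT t|lborel. indicat_real {-H..H} t *\<^sub>R ?f t) = exp (w * of_real H) / w - exp (w * of_real (-H)) / w"
      using assms unfolding f by (intro integral_FTC_atLeastAtMost) (auto intro!: continuous_intros)
    also have "exp (w * of_real H) = cis (pi * of_int a)"
      using assms by (simp add: w_def wavenumber_def cis_conv_exp)
    also have "exp (w * of_real (-H)) = cis (- (pi * of_int a))"
      using assms by (simp add: w_def wavenumber_def cis_conv_exp)
    \<comment> \<open>The antiderivative takes the same value at both ends because the sine vanishes
      at integer multiples of \<open>pi\<close>.\<close>
    also have "cis (- (pi * of_int a)) = cis (pi * of_int a)"
      using sin_times_pi_eq_0[of "real_of_int a"] by (simp add: complex_eq_iff mult.commute)
    finally show ?thesis unfolding eq using False by simp
  qed
qed

lemma integrable_indicator_cube: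
  "integrable lebesgue (\<lambda>x::real^'d. indicator (cube H) x :: complex)"
  using locally_integrable_indicator[OF locally_integrable_continuous[OF continuous_on_const[of UNIV 1]] compact_cube]
  by simp

text \<open>The indicator of the cube and the mode both factor over the coordinates, so the integral
  is a product of one-dimensional period integrals, each zero unless its index is zero.\<close>

lemma integral_mode:
  fixes n :: "'d::finite \<Rightarrow> int"
  assumes "0 < H"
  shows "(LINT x|lebesgue. indicator (cube H) x * mode H n x)
     = (if n = (\<lambda>_. 0) then of_real (2 * H) ^ CARD('d) else 0)"
proof -
  \<comment> \<open>Lebesgue measure is a product over \<open>Basis\<close>, so the frequency has to
    be read off from a basis vector; the choice is unique because the axes are distinct.\<close>
  define nb where "nb b = n (SOME i. b = axis i (1::real))" for b
  have nb: "nb (axis i 1) = n i" for i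
  proof -
    have "axis i 1 = axis j (1::real) \<longleftrightarrow> i = j" for j by (auto simp: axis_eq_axis)
    thus ?thesis unfolding nb_def by simp
  qed
  define h where "h b t = indicator {-H..H} t * cis (pi / H * of_int (nb b) * t)" for b and t :: real
  have inj: "inj (\<lambda>i::'d. axis i (1::real))" by (auto simp: inj_def axis_eq_axis)
  have split: "indicator (cube H) x * mode H n x = (\<Prod>b\<in>Basis. h b (x \<bullet> b))" for x
  proof -
    have "(\<Prod>b\<in>Basis. h b (x \<bullet> b)) = (\<Prod>i\<in>UNIV. h (axis i 1) (x $ i))"
      unfolding Basis_cart by (simp add: prod.reindex[OF inj] cart_eq_inner_axis)
    also have "\<dots> = (\<Prod>i\<in>UNIV. indicator {-H..H} (x $ i)) * (\<Prod>i\<in>UNIV. cis (pi / H * (of_int (n i) * x $ i)))"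
      by (simp add: h_def nb prod.distrib mult.assoc)
    also have "(\<Prod>i\<in>UNIV. indicator {-H..H} (x $ i)) = (indicator (cube H) x :: complex)"
      by (auto simp: indicator_def mem_cube abs_le_iff minus_le_iff)
    also have "(\<Prod>i\<in>UNIV. cis (pi / H * (of_int (n i) * x $ i))) = mode H n x"
      unfolding mode_def cis_conv_exp
      by (simp add: exp_sum[symmetric] sum_distrib_left)
    finally show ?thesis by simp
  qed
  interpret product_sigma_finite "\<lambda>_::real^'d. lborel :: real measure" ..
  have m: "(\<lambda>x. indicator (cube H) x * mode H n x) \<in> borel_measurable lborel"
    by (intro borel_measurable_times borel_measurable_indicator)
       (auto intro: borel_measurable_continuous_onI continuous_on_mode simp: cube_def)
  have "(LINT x|lebesgue. indicator (cube H) x * mode H n x) = (LINT x|lborel. indicator (cube H) x * mode H n x)"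
    by (rule integral_completion[OF m])
  also have "\<dots> = (LINT f|(\<Pi>\<^sub>M b\<in>Basis. lborel). (\<Prod>b\<in>Basis. h b (f b)))"
    using m by (subst lborel_eq, subst integral_distr) (auto simp: split)
  also have "\<dots> = (\<Prod>b\<in>Basis. LINT t|lborel. h b t)"
    unfolding h_def by (rule product_integral_prod) (simp, rule integral_cis_period(1)[OF assms])
  also have "\<dots> = (\<Prod>i\<in>UNIV. if n i = 0 then of_real (2 * H) else 0)"
    unfolding Basis_cart h_def integral_cis_period(2)[OF assms] by (simp add: prod.reindex[OF inj] nb)
  also have "\<dots> = (if n = (\<lambda>_. 0) then of_real (2 * H) ^ CARD('d) else 0)"
    by (auto simp: fun_eq_iff)
  finally show ?thesis .
qed

section \<open>Absolutely convergent trigonometric series\<close>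

text \<open>By the Weierstrass test the finite partial sums converge uniformly, and uniform
  convergence passes through the integral against an integrable \<open>W\<close>. The functions
  \<open>\<phi> n\<close> are left general because the reflected modes
  \<open>mode H n (x - y)\<close> are needed as well.\<close>

lemma has_sum_integral_mult_series:
  fixes W :: "real^'d \<Rightarrow> complex" and \<phi> :: "'n \<Rightarrow> real^'d \<Rightarrow> complex"
  assumes W: "integrable lebesgue W"
    and \<phi>: "\<And>n. continuous_on UNIV (\<phi> n)" "\<And>n y. cmod (\<phi> n y) \<le> 1"
    and c: "(\<lambda>n. cmod (c n)) summable_on UNIV"
  shows "continuous_on UNIV (\<lambda>y. \<Sum>\<^sub>\<infinity>n. c n * \<phi> n y)"
    and "cmod (\<Sum>\<^sub>\<infinity>n. c n * \<phi> n y) \<le> (\<Sum>\<^sub>\<infinity>n. cmod (c n))"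
    and "((\<lambda>n. c n * \<phi> n y) has_sum (\<Sum>\<^sub>\<infinity>n. c n * \<phi> n y)) UNIV"
    and "((\<lambda>n. c n * (LINT y|lebesgue. W y * \<phi> n y)) has_sum
            (LINT y|lebesgue. W y * (\<Sum>\<^sub>\<infinity>n. c n * \<phi> n y))) UNIV"
proof -
  let ?S = "\<lambda>y. \<Sum>\<^sub>\<infinity>n. c n * \<phi> n y"
  let ?P = "\<lambda>F y. \<Sum>n\<in>F. c n * \<phi> n y"
  have le: "norm (c n * \<phi> n y) \<le> cmod (c n)" for n y
    using mult_left_mono[OF \<phi>(2)[of n y], of "cmod (c n)"] by (simp add: norm_mult)
  have ul: "uniform_limit UNIV ?P ?S (finite_subsets_at_top UNIV)"
    by (rule Weierstrass_m_test_general[OF le c])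
  show S: "continuous_on UNIV ?S"
    by (rule uniform_limit_theorem[OF _ ul])
       (auto intro!: always_eventually continuous_intros \<phi>(1))
  have abs: "(\<lambda>n. norm (c n * \<phi> n y)) summable_on UNIV" for y
    by (rule summable_on_comparison_test[OF c]) (use le in auto)
  show "((\<lambda>n. c n * \<phi> n y) has_sum ?S y) UNIV" for y
    using abs_summable_summable[OF abs] by simp
  have Sb: "cmod (?S y) \<le> (\<Sum>\<^sub>\<infinity>n. cmod (c n))" for y
    using norm_infsum_bound[OF abs, of y] infsum_mono[OF abs c le, of y] by linarith
  show "cmod (?S y) \<le> (\<Sum>\<^sub>\<infinity>n. cmod (c n))" by (rule Sb)
  have Wp: "integrable lebesgue (\<lambda>y. W y * \<phi> n y)" for n
    by (rule integrable_mult_bounded[OF W continuous_measurable_lebesgue[OF \<phi>(1)] \<phi>(2)])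
  have WS: "integrable lebesgue (\<lambda>y. W y * ?S y)"
    by (rule integrable_mult_bounded[OF W continuous_measurable_lebesgue[OF S] Sb])
  define I where "I = (LINT y|lebesgue. cmod (W y))"
  have I0: "0 \<le> I" unfolding I_def by simp
  show "((\<lambda>n. c n * (LINT y|lebesgue. W y * \<phi> n y)) has_sum (LINT y|lebesgue. W y * ?S y)) UNIV"
    unfolding has_sum_def tendsto_iff
  proof (intro allI impI)
    fix e :: real assume "0 < e"
    \<comment> \<open>The summand 1 covers the case \<open>I = 0\<close>.\<close>
    hence "0 < e / (I + 1)" using I0 by simp
    hence "\<forall>\<^sub>F F in finite_subsets_at_top UNIV. \<forall>y\<in>UNIV. dist (?P F y) (?S y) < e / (I + 1)"
      using ul unfolding uniform_limit_iff by blast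
    thus "\<forall>\<^sub>F F in finite_subsets_at_top UNIV.
        dist (\<Sum>n\<in>F. c n * (LINT y|lebesgue. W y * \<phi> n y)) (LINT y|lebesgue. W y * ?S y) < e"
    proof eventually_elim
      case (elim F)
      have WP: "integrable lebesgue (\<lambda>y. W y * ?P F y)"
        unfolding sum_distrib_left mult.left_commute[of "W _"] using Wp by auto
      have "(\<Sum>n\<in>F. c n * (LINT y|lebesgue. W y * \<phi> n y)) = (\<Sum>n\<in>F. LINT y|lebesgue. c n * (W y * \<phi> n y))"
        by simp
      also have "\<dots> = (LINT y|lebesgue. (\<Sum>n\<in>F. c n * (W y * \<phi> n y)))"
        using Wp by (intro Bochner_Integration.integral_sum[symmetric]) auto
      also have "\<dots> = (LINT y|lebesgue. W y * ?P F y)"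
        by (simp add: sum_distrib_left mult.left_commute)
      finally have "(\<Sum>n\<in>F. c n * (LINT y|lebesgue. W y * \<phi> n y)) - (LINT y|lebesgue. W y * ?S y)
          = (LINT y|lebesgue. W y * ?P F y - W y * ?S y)"
        using WP WS by (simp add: Bochner_Integration.integral_diff)
      also have "cmod \<dots> \<le> (LINT y|lebesgue. cmod (W y) * (e / (I + 1)))"
      proof (rule order_trans[OF integral_norm_bound integral_mono])
        show "integrable lebesgue (\<lambda>y. cmod (W y * ?P F y - W y * ?S y))" using WP WS by simp
        show "integrable lebesgue (\<lambda>y. cmod (W y) * (e / (I + 1)))" using W by auto
        fix y
        have "cmod (W y) * cmod (?P F y - ?S y) \<le> cmod (W y) * (e / (I + 1))"
          using elim by (intro mult_left_mono) (auto simp: dist_norm less_imp_le)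
        thus "norm (W y * ?P F y - W y * ?S y) \<le> cmod (W y) * (e / (I + 1))"
          by (simp add: norm_mult flip: right_diff_distrib)
      qed
      also have "\<dots> = I * (e / (I + 1))" by (simp add: I_def)
      also have "\<dots> < e" using \<open>0 < e\<close> I0 by (simp add: field_simps)
      finally show ?case by (simp add: dist_norm)
    qed
  qed
qed

definition trig_series :: "real \<Rightarrow> (('d::finite \<Rightarrow> int) \<Rightarrow> complex) \<Rightarrow> real^'d \<Rightarrow> complex" where
  "trig_series H c x = (\<Sum>\<^sub>\<infinity>n. c n * mode H n x)"

context
  fixes H :: real and c :: "('d::finite \<Rightarrow> int) \<Rightarrow> complex"
  assumes H: "0 < H" and c: "(\<lambda>n. cmod (c n)) summable_on UNIV"
begin

lemma trig_series_continuous: "continuous_on UNIV (trig_series H c)"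
  and trig_series_bounded: "cmod (trig_series H c y) \<le> (\<Sum>\<^sub>\<infinity>n. cmod (c n))"
  and trig_series_has_sum: "((\<lambda>n. c n * mode H n y) has_sum trig_series H c y) UNIV"
  unfolding trig_series_def
  using has_sum_integral_mult_series(1-3)[where \<phi> = "mode H", OF integrable_zero continuous_on_mode _ c] by auto

lemma has_sum_integral_trig_series:
  assumes "integrable lebesgue W"
  shows "((\<lambda>n. c n * (LINT y|lebesgue. W y * mode H n y)) has_sum
            (LINT y|lebesgue. W y * trig_series H c y)) UNIV"
  unfolding trig_series_def
  using has_sum_integral_mult_series(4)[where \<phi> = "mode H", OF assms continuous_on_mode _ c] by auto

lemma trig_series_coeff:
  "(LINT y|lebesgue. indicator (cube H) y * cnj (mode H k y) * trig_series H c y) = c k * of_real (2 * H) ^ CARD('d)"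
proof -
  have W: "integrable lebesgue (\<lambda>y::real^'d. indicator (cube H) y * cnj (mode H k y))"
    unfolding mode_cnj
    by (rule integrable_mult_bounded[OF integrable_indicator_cube continuous_measurable_lebesgue[OF continuous_on_mode]]) auto
  have eq: "(LINT y|lebesgue. indicator (cube H) y * cnj (mode H k y) * mode H n y)
      = (if n = k then of_real (2 * H) ^ CARD('d) else 0)" for n
  proof -
    have "(\<lambda>j. n j - k j) = (\<lambda>_. 0) \<longleftrightarrow> n = k" by (auto simp: fun_eq_iff)
    thus ?thesis
      using integral_mode[OF H, of "\<lambda>j. n j - k j"] by (simp add: mult.assoc mode_mult_cnj mult.commute[of "cnj _"])
  qed
  have "((\<lambda>n. c n * (if n = k then of_real (2 * H) ^ CARD('d) else 0)) has_sum
      (c k * of_real (2 * H) ^ CARD('d))) UNIV"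
    by (rule has_sum_finite_neutralI[of "{k}"]) auto
  with has_sum_integral_trig_series[OF W] show ?thesis
    unfolding eq using has_sum_unique by blast
qed

text \<open>Parseval: the series is integrated term by term against its own conjugate, a bounded
  function on the cube, and \<open>trig_series_coeff\<close> evaluates every term.\<close>

lemma trig_series_L2:
  "((\<lambda>n. (cmod (c n))\<^sup>2 * (2 * H) ^ CARD('d)) has_sum
      (LINT y|lebesgue. indicator (cube H) y * (cmod (trig_series H c y))\<^sup>2)) UNIV"
proof -
  let ?f = "trig_series H c"
  have W: "integrable lebesgue (\<lambda>y::real^'d. indicator (cube H) y * cnj (?f y))"
    by (rule integrable_mult_bounded[OF integrable_indicator_cube continuous_measurable_lebesgue])
       (auto intro!: continuous_intros trig_series_continuous trig_series_bounded)
  have eq: "(LINT y|lebesgue. indicator (cube H) y * cnj (?f y) * mode H n y)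
      = cnj (c n * of_real (2 * H) ^ CARD('d))" for n
  proof -
    have "(LINT y|lebesgue. indicator (cube H) y * cnj (?f y) * mode H n y)
       = (LINT y|lebesgue. cnj (indicator (cube H) y * cnj (mode H n y) * ?f y))"
      by (intro Bochner_Integration.integral_cong refl) (simp add: indicator_def)
    thus ?thesis unfolding Bochner_Integration.integral_cnj by (simp only: trig_series_coeff)
  qed
  have "((\<lambda>n. c n * cnj (c n * of_real (2 * H) ^ CARD('d))) has_sum
     (LINT y|lebesgue. indicator (cube H) y * cnj (?f y) * ?f y)) UNIV"
    using has_sum_integral_trig_series[OF W] unfolding eq .
  also have "(\<lambda>n. c n * cnj (c n * of_real (2 * H) ^ CARD('d)))
      = (\<lambda>n. of_real ((cmod (c n))\<^sup>2 * (2 * H) ^ CARD('d)))"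
    unfolding of_real_mult complex_norm_square by (simp add: mult_ac)
  also have "(LINT y|lebesgue. indicator (cube H) y * cnj (?f y) * ?f y)
     = (LINT y|lebesgue. of_real (indicator (cube H) y * (cmod (?f y))\<^sup>2))"
    by (intro Bochner_Integration.integral_cong refl)
       (unfold of_real_mult complex_norm_square, simp add: indicator_def mult_ac)
  finally show ?thesis unfolding integral_complex_of_real has_sum_of_real_iff .
qed

end

section \<open>Completeness of the modes\<close>

lemma integrable_cube_continuous:
  fixes g :: "real^'d \<Rightarrow> complex"
  assumes "continuous_on UNIV g" shows "integrable lebesgue (\<lambda>y. indicator (cube H) y * g y)"
  by (rule locally_integrable_indicator[OF locally_integrable_continuous[OF assms] compact_cube])

lemma integrable_cube_continuous_real:
  fixes g :: "real^'d \<Rightarrow> real"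
  assumes "continuous_on UNIV g" shows "integrable lebesgue (\<lambda>y. indicator (cube H) y * g y)"
proof -
  have "integrable lebesgue (\<lambda>y. indicator (cube H) y * of_real (g y) :: complex)"
    by (rule integrable_cube_continuous) (intro continuous_intros assms)
  hence "integrable lebesgue (\<lambda>y. Re (indicator (cube H) y * of_real (g y) :: complex))"
    by (rule integrable_Re)
  moreover have "(\<lambda>y. Re (indicator (cube H) y * of_real (g y) :: complex)) = (\<lambda>y. indicator (cube H) y * g y)"
    by (auto simp: indicator_def)
  ultimately show ?thesis by simp
qed

text \<open>A nonnegative trigonometric polynomial of degree one in each coordinate. Its maximum
  \<open>2 d\<close> is attained precisely at the translates of \<open>x0\<close> by
  periods.\<close>

definition peak :: "real \<Rightarrow> real^'d \<Rightarrow> real^'d \<Rightarrow> real" where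
  "peak H x0 y = (\<Sum>j\<in>UNIV. 1 + cos (pi / H * (y $ j - x0 $ j)))"

lemma peak_continuous [continuous_intros]: "continuous_on S (peak H x0)"
  unfolding peak_def by (intro continuous_intros)

lemma peak_nonneg: "0 \<le> peak H x0 y"
proof -
  have "0 \<le> 1 + cos t" for t :: real using cos_ge_minus_one[of t] by linarith
  thus ?thesis unfolding peak_def by (intro sum_nonneg) auto
qed

text \<open>With \<open>x0\<close> in the open cube, every point of the closed cube differs from it
  by less than one period \<open>2 * H\<close> in each coordinate, so no other translate of
  \<open>x0\<close> interferes.\<close>

lemma peak_less:
  fixes x0 y :: "real^'d"
  assumes H: "0 < H" and x0: "\<And>j. \<bar>x0 $ j\<bar> < H" and y: "y \<in> cube H" and ne: "y \<noteq> x0"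
  shows "peak H x0 y < 2 * real CARD('d)"
proof -
  obtain j where j: "y $ j \<noteq> x0 $ j" using ne by (auto simp: vec_eq_iff)
  have "cos (pi / H * (y $ j - x0 $ j)) \<noteq> 1"
  proof
    assume "cos (pi / H * (y $ j - x0 $ j)) = 1"
    then obtain k :: int where k: "pi / H * (y $ j - x0 $ j) = real_of_int k * 2 * pi"
      unfolding cos_one_2pi_int by blast
    hence "pi * ((y $ j - x0 $ j) / H) = pi * (2 * real_of_int k)" by simp
    hence "(y $ j - x0 $ j) / H = 2 * real_of_int k" by (simp only: mult_cancel_left) simp
    hence k': "y $ j - x0 $ j = 2 * H * real_of_int k" using H by (simp add: field_simps)
    have "\<bar>y $ j - x0 $ j\<bar> < 2 * H" using y x0[of j] unfolding mem_cube by (smt (verit))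
    hence "\<bar>real_of_int k\<bar> < 1" using H unfolding k' by (simp add: abs_mult)
    hence "k = 0" by linarith
    with k' j show False by simp
  qed
  hence lt: "1 + cos (pi / H * (y $ j - x0 $ j)) < 2"
    using cos_le_one[of "pi / H * (y $ j - x0 $ j)"] by linarith
  have "peak H x0 y < (\<Sum>j\<in>(UNIV::'d set). 2)"
    unfolding peak_def by (rule sum_strict_mono_ex1) (use lt in auto)
  thus ?thesis by simp
qed

text \<open>Multiplication by \<open>peak\<close> sends a mode to a combination of itself and its
  nearest neighbours. By induction, a function orthogonal to all modes is orthogonal to all powers
  of \<open>peak\<close>.\<close>

lemma peak_mult_mode:
  fixes x0 y :: "real^'d"
  shows "of_real (peak H x0 y) * mode H k y =
    (\<Sum>j\<in>UNIV. mode H k y + cis (- (pi / H * x0 $ j)) / 2 * mode H (\<lambda>i. k i + (if i = j then 1 else 0)) y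
                 + cis (pi / H * x0 $ j) / 2 * mode H (\<lambda>i. k i + (if i = j then - 1 else 0)) y)"
proof -
  have m: "mode H (\<lambda>i. k i + (if i = j then a else 0)) y = mode H k y * cis (pi / H * (of_int a * y $ j))" for j a
  proof -
    have "(\<Sum>i\<in>UNIV. of_int (if i = j then a else 0) * y $ i) = of_int a * y $ j"
      by (subst sum.cong[OF refl, of _ _ "\<lambda>i. if i = j then of_int a * y $ i else 0"]) auto
    thus ?thesis by (simp add: mode_mult[symmetric]) (simp add: mode_def)
  qed
  have c: "of_real (cos (pi / H * (y $ j - x0 $ j))) =
     cis (- (pi / H * x0 $ j)) / 2 * cis (pi / H * y $ j) + cis (pi / H * x0 $ j) / 2 * cis (- (pi / H * y $ j))" for j
    by (simp add: complex_eq_iff cis_mult right_diff_distrib cos_diff flip: add_divide_distrib)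
       (simp add: cos_diff cos_add sin_diff sin_add field_simps)
  show ?thesis
    unfolding peak_def m of_real_sum sum_distrib_right
    by (intro sum.cong refl, simp only: of_real_add of_real_1 c) (simp add: algebra_simps)
qed

text \<open>The powers of \<open>peak\<close> are nonnegative trigonometric polynomials that concentrate at \<open>x0\<close>.\<close>

lemma fourier_uniqueness:
  fixes F :: "real^'d \<Rightarrow> complex"
  assumes H: "0 < H" and F: "continuous_on UNIV F"
    and zero: "\<And>k. (LINT y|lebesgue. indicator (cube H) y * (mode H k y * F y)) = 0"
    and x0: "\<And>j. \<bar>x0 $ j\<bar> < H"
  shows "F x0 = 0"
proof (rule ccontr)
  assume ne: "F x0 \<noteq> 0"
  let ?q = "peak H x0"
  let ?D = "2 * real CARD('d)"
  note ii = integrable_cube_continuous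
  have "(LINT y|lebesgue. indicator (cube H) y * (of_real (?q y) ^ p * mode H k y * F y)) = 0" for p k
  proof (induction p arbitrary: k)
    case 0
    then show ?case using zero by simp
  next
    case (Suc p)
    let ?g = "\<lambda>k y. indicator (cube H) y * (of_real (?q y) ^ p * mode H k y * F y)"
    have int: "integrable lebesgue (?g k)" for k
      by (intro ii continuous_intros F)
    have "(LINT y|lebesgue. indicator (cube H) y * (of_real (?q y) ^ Suc p * mode H k y * F y))
       = (LINT y|lebesgue. (\<Sum>j\<in>UNIV. ?g k y
           + cis (- (pi / H * x0 $ j)) / 2 * ?g (\<lambda>i. k i + (if i = j then 1 else 0)) y
           + cis (pi / H * x0 $ j) / 2 * ?g (\<lambda>i. k i + (if i = j then - 1 else 0)) y))"
    proof (intro Bochner_Integration.integral_cong refl)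
      fix y
      have "indicator (cube H) y * (of_real (?q y) ^ Suc p * mode H k y * F y)
          = indicator (cube H) y * of_real (?q y) ^ p * F y * (of_real (?q y) * mode H k y)"
        by (simp add: mult_ac)
      also have "\<dots> = (\<Sum>j\<in>UNIV. ?g k y
           + cis (- (pi / H * x0 $ j)) / 2 * ?g (\<lambda>i. k i + (if i = j then 1 else 0)) y
           + cis (pi / H * x0 $ j) / 2 * ?g (\<lambda>i. k i + (if i = j then - 1 else 0)) y)"
        unfolding peak_mult_mode sum_distrib_left
        by (intro sum.cong refl) (simp only: distrib_left mult_ac)
      finally show "indicator (cube H) y * (of_real (?q y) ^ Suc p * mode H k y * F y) = \<dots>" .
    qed
    also have "\<dots> = 0"
      using int Suc.IH by (subst Bochner_Integration.integral_sum) (auto simp: Bochner_Integration.integral_add)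
    finally show ?case .
  qed
  from this[of _ "\<lambda>_. 0"]
  have qz: "(LINT y|lebesgue. indicator (cube H) y * (of_real (?q y) ^ p * F y)) = 0" for p by simp
  \<comment> \<open>The rotation by \<open>cnj (F x0)\<close> gives a real function that is positive
    at \<open>x0\<close> and still orthogonal to the real powers of \<open>peak\<close>.\<close>
  define G where "G y = Re (cnj (F x0) * F y)" for y
  have G: "continuous_on UNIV G" unfolding G_def by (intro continuous_intros F)
  have Gz: "(LINT y|lebesgue. indicator (cube H) y * (?q y ^ p * G y)) = 0" for p
  proof -
    have re: "Re (cnj a * (of_real r * z)) = r * Re (cnj a * z)" for r a z by (simp add: algebra_simps)
    have "(LINT y|lebesgue. indicator (cube H) y * (?q y ^ p * G y))
       = (LINT y|lebesgue. Re (cnj (F x0) * (indicator (cube H) y * (of_real (?q y) ^ p * F y))))"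
      by (intro Bochner_Integration.integral_cong refl)
         (simp add: G_def indicator_def re del: times_complex.simps flip: of_real_power)
    also have "\<dots> = Re (LINT y|lebesgue. cnj (F x0) * (indicator (cube H) y * (of_real (?q y) ^ p * F y)))"
      by (intro integral_Re integrable_mult_right ii continuous_intros F)
    also have "\<dots> = 0" using qz by simp
    finally show ?thesis .
  qed
  define g0 where "g0 = (cmod (F x0))\<^sup>2 / 2"
  have g0: "g0 > 0" "G x0 = 2 * g0"
    using ne unfolding g0_def G_def cmod_power2 by (simp_all add: power2_eq_square complex_eq_iff sum_squares_gt_zero_iff)
  obtain d1 where d1: "d1 > 0" "\<And>y. dist y x0 < d1 \<Longrightarrow> G y > g0"
  proof -
    have "isCont G x0" using G by (simp add: continuous_on_eq_continuous_at)
    hence "\<forall>\<^sub>F y in at x0. G y > g0" using g0 by (intro order_tendstoD(1)[of G "G x0"]) (auto simp: isCont_def)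
    then obtain d where "d > 0" "\<And>y. y \<noteq> x0 \<Longrightarrow> dist y x0 < d \<Longrightarrow> G y > g0"
      unfolding eventually_at by blast
    thus ?thesis using that[of d] g0 by (metis less_add_same_cancel1 mult_2)
  qed
  obtain B where B: "B > 0" "\<And>y. y \<in> cube H \<Longrightarrow> \<bar>G y\<bar> \<le> B"
  proof -
    have "bounded (G ` cube H)"
      by (intro compact_imp_bounded compact_continuous_image compact_cube continuous_on_subset[OF G]) auto
    thus ?thesis using that unfolding bounded_pos by auto
  qed
  obtain q1 where q1: "0 \<le> q1" "q1 < ?D" "\<And>y. y \<in> cube H \<Longrightarrow> dist y x0 \<ge> d1 \<Longrightarrow> ?q y \<le> q1"
  proof (cases "cube H - ball x0 d1 = {}")
    case True
    show ?thesis by (rule that[of 0]) (use True in \<open>auto simp: dist_commute\<close>)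
  next
    case False
    have "compact (cube H - ball x0 d1)" by (intro compact_diff compact_cube open_ball)
    then obtain y where y: "y \<in> cube H - ball x0 d1" "\<And>z. z \<in> cube H - ball x0 d1 \<Longrightarrow> ?q z \<le> ?q y"
      using continuous_attains_sup[OF _ False peak_continuous[of _ H x0]] by blast
    show ?thesis
    proof (rule that[of "?q y"])
      show "?q y < ?D" using y(1) d1(1) by (intro peak_less[OF H x0]) auto
      show "\<And>z. z \<in> cube H \<Longrightarrow> dist z x0 \<ge> d1 \<Longrightarrow> ?q z \<le> ?q y" using y(2) by (auto simp: dist_commute)
    qed (rule peak_nonneg)
  qed
  \<comment> \<open>A level strictly between the bound \<open>q1\<close> away from \<open>x0\<close>
    and the maximum at \<open>x0\<close>: near \<open>x0\<close> the powers of \<open>peak\<close>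
    grow at least like \<open>q2 ^ p\<close>, far away at most like \<open>q1 ^ p\<close>.\<close>
  define q2 where "q2 = (q1 + ?D) / 2"
  have q2: "q1 < q2" "0 < q2" "q2 < ?D" using q1 by (auto simp: q2_def)
  have qx0: "?q x0 = ?D" by (simp add: peak_def)
  have "\<forall>\<^sub>F y in nhds x0. ?q y > q2"
  proof -
    have "isCont ?q x0" using peak_continuous[of UNIV H x0] by (simp add: continuous_on_eq_continuous_at)
    hence "(?q \<longlongrightarrow> ?q x0) (nhds x0)" unfolding isCont_def tendsto_at_iff_tendsto_nhds .
    thus ?thesis by (rule order_tendstoD(1)) (simp add: qx0 q2)
  qed
  moreover have "\<forall>\<^sub>F y in nhds x0. y \<in> cube H"
  proof -
    have "x0 \<in> interior (cube H)" using x0 by (simp add: interior_cube)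
    thus ?thesis unfolding eventually_nhds using open_interior interior_subset by blast
  qed
  moreover have "\<forall>\<^sub>F y in nhds x0. dist y x0 < d1"
    unfolding eventually_nhds_metric using d1(1) by blast
  ultimately have "\<forall>\<^sub>F y in nhds x0. ?q y > q2 \<and> y \<in> cube H \<and> dist y x0 < d1"
    by eventually_elim auto
  then obtain d2 where d2: "d2 > 0" "\<And>y. dist y x0 < d2 \<Longrightarrow> ?q y > q2 \<and> y \<in> cube H \<and> dist y x0 < d1"
    unfolding eventually_nhds_metric by blast
  define V where "V = measure lebesgue (ball x0 d2)"
  define V' where "V' = measure lebesgue (cube H :: (real^'d) set)"
  have V: "0 < V" using d2(1) content_ball_pos[of d2 x0] by (simp add: V_def)
  \<comment> \<open>The vanishing integral is bounded below over three regions: near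
    \<open>x0\<close> the integrand is at least \<open>q2 ^ p * g0\<close>, far from
    \<open>x0\<close> at least \<open>- (q1 ^ p * B)\<close>, and in between nonnegative. Dividing
    by \<open>q2 ^ p\<close> and letting \<open>p\<close> grow forces
    \<open>g0 * V \<le> 0\<close>.\<close>
  have main: "q2 ^ p * g0 * V \<le> q1 ^ p * B * V'" for p
  proof -
    have "(LINT y|lebesgue. indicat_real (ball x0 d2) y * (q2 ^ p * g0) - indicat_real (cube H) y * (q1 ^ p * B))
       \<le> (LINT y|lebesgue. indicator (cube H) y * (?q y ^ p * G y))"
    proof (rule integral_mono)
      show "integrable lebesgue (\<lambda>y. indicator (cube H) y * (?q y ^ p * G y))"
        by (intro integrable_cube_continuous_real continuous_intros G)
      have "integrable lebesgue (indicat_real (ball x0 d2))"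
        using lmeasurable_ball[of x0 d2] unfolding lmeasurable_iff_integrable .
      moreover have "integrable lebesgue (indicat_real (cube H :: (real^'d) set))"
        using lmeasurable_compact[OF compact_cube] unfolding lmeasurable_iff_integrable .
      ultimately show "integrable lebesgue (\<lambda>y. indicat_real (ball x0 d2) y * (q2 ^ p * g0) - indicat_real (cube H) y * (q1 ^ p * B))"
        by auto
      fix y
      have qB: "0 \<le> q1 ^ p * B" using q1 B by simp
      show "indicat_real (ball x0 d2) y * (q2 ^ p * g0) - indicat_real (cube H) y * (q1 ^ p * B)
          \<le> indicator (cube H) y * (?q y ^ p * G y)"
      proof (cases "y \<in> cube H \<and> dist y x0 \<ge> d1")
        case True
        hence "y \<notin> ball x0 d2" using d2(2)[of y] by (auto simp: dist_commute)
        moreover have "- (?q y ^ p * G y) \<le> q1 ^ p * B"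
        proof -
          have "?q y ^ p * \<bar>G y\<bar> \<le> q1 ^ p * B"
            using True by (intro mult_mono power_mono q1 B peak_nonneg) (auto simp: q1)
          moreover have "- (?q y ^ p * G y) \<le> ?q y ^ p * \<bar>G y\<bar>"
            using peak_nonneg[of H x0 y] by (metis abs_ge_minus_self abs_mult abs_of_nonneg zero_le_power)
          ultimately show ?thesis by linarith
        qed
        ultimately show ?thesis using True by simp
      next
        case False
        show ?thesis
        proof (cases "y \<in> ball x0 d2")
          case True
          hence yb: "?q y > q2" "y \<in> cube H" "dist y x0 < d1" using d2(2)[of y] by (auto simp: dist_commute)
          have "q2 ^ p * g0 \<le> ?q y ^ p * G y"
            using yb d1(2)[of y] q2 g0 by (intro mult_mono power_mono) auto
          thus ?thesis using True yb qB by simp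
        next
          case n: False
          show ?thesis
          proof (cases "y \<in> cube H")
            case True
            hence "0 \<le> G y" using False d1(2)[of y] g0 by auto
            hence "0 \<le> ?q y ^ p * G y" using peak_nonneg[of H x0 y] by simp
            thus ?thesis using True n qB by simp
          qed (use n in simp)
        qed
      qed
    qed
    also have "\<dots> = 0" by (rule Gz)
    finally have "(LINT y|lebesgue. indicat_real (ball x0 d2) y * (q2 ^ p * g0) - indicat_real (cube H) y * (q1 ^ p * B)) \<le> 0" .
    moreover have "integrable lebesgue (indicat_real (ball x0 d2))"
      using lmeasurable_ball[of x0 d2] unfolding lmeasurable_iff_integrable .
    moreover have "integrable lebesgue (indicat_real (cube H :: (real^'d) set))"
      using lmeasurable_compact[OF compact_cube] unfolding lmeasurable_iff_integrable .
    ultimately show ?thesis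
      by (subst (asm) Bochner_Integration.integral_diff) (auto simp: V_def V'_def mult_ac)
  qed
  have "(\<lambda>p. (q1 / q2) ^ p * (B * V')) \<longlonglongrightarrow> 0 * (B * V')"
    by (intro tendsto_mult_right LIMSEQ_realpow_zero) (use q1 q2 in auto)
  moreover have "\<forall>p. g0 * V \<le> (q1 / q2) ^ p * (B * V')"
    using main q2 by (simp add: power_divide field_simps)
  ultimately have "g0 * V \<le> 0 * (B * V')" by (intro LIMSEQ_le_const) auto
  with g0 V show False by (simp add: mult_le_0_iff)
qed

section \<open>Fourier coefficients of compactly supported functions\<close>

lemma test_fun_mem_cube:
  assumes "test_fun L f" "L \<le> H" "f y \<noteq> 0" shows "y \<in> cube H"
  using test_funD(2)[OF assms(1,3)] assms(2) unfolding mem_cube by (meson less_imp_le order_trans)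

lemma fourier_coeff_cube:
  fixes f :: "real^'d \<Rightarrow> complex"
  assumes "test_fun L f" "L \<le> H" "0 < H"
  shows "(LINT y|lebesgue. indicator (cube H) y * (cnj (mode H n y) * f y)) = fourier_coeff H f n * of_real (2 * H) ^ CARD('d)"
proof -
  have "(LINT y|lebesgue. indicator (cube H) y * (cnj (mode H n y) * f y)) = (LINT y|lebesgue. f y * cnj (mode H n y))"
    using test_fun_mem_cube[OF assms(1,2)]
    by (intro Bochner_Integration.integral_cong refl) (auto simp: indicator_def)
  thus ?thesis using assms(3) by (simp add: fourier_coeff_def)
qed

text \<open>Expand the nonnegative integral of \<open>(cmod (f - s))\<^sup>2\<close>, where
  \<open>s\<close> is the partial sum over \<open>F\<close>: the mixed integral and the square
  integral of \<open>s\<close> both equal \<open>Q\<close>, which leaves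
  \<open>I - Q\<close>.\<close>

lemma bessel_inequality:
  fixes f :: "real^'d \<Rightarrow> complex"
  assumes f: "test_fun L f" and L: "L \<le> H" and H: "0 < H" and F: "finite F"
  shows "(\<Sum>n\<in>F. (cmod (fourier_coeff H f n))\<^sup>2) * (2 * H) ^ CARD('d)
     \<le> (LINT y|lebesgue. indicator (cube H) y * (cmod (f y))\<^sup>2)"
proof -
  let ?P = "(2 * H) ^ CARD('d)"
  define c where "c n = (if n \<in> F then fourier_coeff H f n else 0)" for n
  define s where "s = trig_series H c"
  define I where "I = (LINT y|lebesgue. indicator (cube H) y * (cmod (f y))\<^sup>2)"
  have c: "(\<lambda>n. cmod (c n)) summable_on UNIV"
    by (rule finite_nonzero_values_imp_summable_on) (rule finite_subset[OF _ F], auto simp: c_def split: if_splits)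
  note fc = test_fun_continuous[OF f, of UNIV] and sc = trig_series_continuous[OF H c, folded s_def]
  define Q where "Q = (\<Sum>n\<in>F. (cmod (fourier_coeff H f n))\<^sup>2) * ?P"
  have S: "(LINT y|lebesgue. indicator (cube H) y * (cmod (s y))\<^sup>2) = Q"
  proof -
    have "((\<lambda>n. (cmod (c n))\<^sup>2 * ?P) has_sum Q) UNIV"
      by (rule has_sum_finite_neutralI[OF F]) (auto simp: c_def Q_def sum_distrib_right)
    thus ?thesis using trig_series_L2[OF H c] has_sum_unique unfolding s_def by blast
  qed
  have X: "(LINT y|lebesgue. indicator (cube H) y * cnj (f y) * s y) = of_real Q"
  proof -
    have "integrable lebesgue (\<lambda>y. indicator (cube H) y * cnj (f y))"
      by (intro integrable_cube_continuous continuous_intros fc)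
    from has_sum_integral_trig_series[OF H c this]
    have 1: "((\<lambda>n. c n * (LINT y|lebesgue. indicator (cube H) y * cnj (f y) * mode H n y)) has_sum
         (LINT y|lebesgue. indicator (cube H) y * cnj (f y) * s y)) UNIV" unfolding s_def .
    have "(LINT y|lebesgue. indicator (cube H) y * cnj (f y) * mode H n y) = cnj (fourier_coeff H f n * of_real (2 * H) ^ CARD('d))" for n
    proof -
      have "(LINT y|lebesgue. indicator (cube H) y * cnj (f y) * mode H n y)
        = (LINT y|lebesgue. cnj (indicator (cube H) y * (cnj (mode H n y) * f y)))"
        by (intro Bochner_Integration.integral_cong refl) (simp add: indicator_def)
      thus ?thesis unfolding Bochner_Integration.integral_cnj by (simp only: fourier_coeff_cube[OF f L H])
    qed
    hence 2: "((\<lambda>n. c n * cnj (fourier_coeff H f n * of_real (2 * H) ^ CARD('d))) has_sum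
         (LINT y|lebesgue. indicator (cube H) y * cnj (f y) * s y)) UNIV" using 1 by simp
    have "((\<lambda>n. c n * cnj (fourier_coeff H f n * of_real (2 * H) ^ CARD('d))) has_sum of_real Q) UNIV"
    proof (rule has_sum_finite_neutralI[OF F])
      have *: "c n * cnj (fourier_coeff H f n * of_real (2 * H) ^ CARD('d)) = of_real ((cmod (fourier_coeff H f n))\<^sup>2 * ?P)"
        if "n \<in> F" for n
        using that unfolding of_real_mult complex_norm_square by (simp add: c_def)
      show "of_real Q = (\<Sum>n\<in>F. c n * cnj (fourier_coeff H f n * of_real (2 * H) ^ CARD('d)))"
        unfolding Q_def sum_distrib_right of_real_sum by (intro sum.cong refl) (rule *[symmetric])
    qed (auto simp: c_def)
    with 2 show ?thesis using has_sum_unique by blast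
  qed
  have "0 \<le> (LINT y|lebesgue. indicator (cube H) y * (cmod (f y - s y))\<^sup>2)"
    by (intro Bochner_Integration.integral_nonneg) (auto simp: indicator_def)
  also have "\<dots> = (LINT y|lebesgue. indicator (cube H) y * (cmod (f y))\<^sup>2
      + indicator (cube H) y * (cmod (s y))\<^sup>2 - 2 * Re (indicator (cube H) y * cnj (f y) * s y))"
  proof (intro Bochner_Integration.integral_cong refl)
    fix y
    show "indicator (cube H) y * (cmod (f y - s y))\<^sup>2 = indicator (cube H) y * (cmod (f y))\<^sup>2
      + indicator (cube H) y * (cmod (s y))\<^sup>2 - 2 * Re (indicator (cube H) y * cnj (f y) * s y)"
      by (cases "y \<in> cube H"; simp add: cmod_power2; simp add: power2_eq_square algebra_simps)
  qed
  also have "\<dots> = I + Q - 2 * Re (of_real Q)"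
  proof -
    have i1: "integrable lebesgue (\<lambda>y. indicator (cube H) y * (cmod (f y))\<^sup>2)"
      by (intro integrable_cube_continuous_real continuous_intros fc)
    have i2: "integrable lebesgue (\<lambda>y. indicator (cube H) y * (cmod (s y))\<^sup>2)"
      by (intro integrable_cube_continuous_real continuous_intros sc)
    have i3: "integrable lebesgue (\<lambda>y. indicator (cube H) y * cnj (f y) * s y)"
      unfolding mult.assoc by (intro integrable_cube_continuous continuous_intros sc fc)
    have lin: "(LINT y|lebesgue. a y + b y - 2 * r y) = (LINT y|lebesgue. a y) + (LINT y|lebesgue. b y) - 2 * (LINT y|lebesgue. r y)"
      if "integrable lebesgue a" "integrable lebesgue b" "integrable lebesgue r" for a b r :: "real^'d \<Rightarrow> real"
      using that by simp
    show ?thesis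
      unfolding lin[OF i1 i2 integrable_Re[OF i3]] integral_Re[OF i3] X S I_def ..
  qed
  finally have "Q \<le> I" by simp
  thus ?thesis unfolding Q_def I_def .
qed

section \<open>The maximum norm on integer vectors and sums over the lattice\<close>

definition sup_abs :: "('d::finite \<Rightarrow> int) \<Rightarrow> real" where
  "sup_abs n = Max (range (\<lambda>j. real_of_int \<bar>n j\<bar>))"

lemma sup_abs_ge: "real_of_int \<bar>n j\<bar> \<le> sup_abs n"
  unfolding sup_abs_def by (intro Max_ge) auto

lemma sup_abs_le: "(\<And>j. real_of_int \<bar>n j\<bar> \<le> C) \<Longrightarrow> sup_abs n \<le> C"
  unfolding sup_abs_def by (intro Max.boundedI) auto

lemma sup_abs_attained: obtains j where "sup_abs n = real_of_int \<bar>n j\<bar>"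
proof -
  have "sup_abs n \<in> range (\<lambda>j. real_of_int \<bar>n j\<bar>)"
    unfolding sup_abs_def by (intro Max_in) auto
  thus ?thesis using that by blast
qed

lemma sup_abs_nonneg: "0 \<le> sup_abs n"
  using sup_abs_ge[of n] by (meson abs_ge_zero of_int_0_le_iff order_trans)

lemma sup_abs_ge_1: "n \<noteq> (\<lambda>_. 0) \<Longrightarrow> 1 \<le> sup_abs n"
proof -
  assume "n \<noteq> (\<lambda>_. 0)"
  then obtain j where "n j \<noteq> 0" by auto
  hence "1 \<le> \<bar>n j\<bar>" by simp
  hence "1 \<le> real_of_int \<bar>n j\<bar>" by linarith
  thus ?thesis using sup_abs_ge[of n j] by linarith
qed

lemma sup_abs_triangle: "sup_abs (\<lambda>j. n j + k j) \<le> sup_abs n + sup_abs k"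
proof (rule sup_abs_le)
  fix j
  have "real_of_int \<bar>n j + k j\<bar> \<le> real_of_int \<bar>n j\<bar> + real_of_int \<bar>k j\<bar>" by simp
  thus "real_of_int \<bar>n j + k j\<bar> \<le> sup_abs n + sup_abs k" using sup_abs_ge[of n j] sup_abs_ge[of k j] by linarith
qed

lemma sup_abs_scale: "0 \<le> M \<Longrightarrow> sup_abs (\<lambda>j. M * l j) = of_int M * sup_abs l"
proof (rule antisym)
  assume M: "0 \<le> M"
  show "sup_abs (\<lambda>j. M * l j) \<le> of_int M * sup_abs l"
    using M by (intro sup_abs_le) (auto simp: abs_mult intro!: mult_left_mono sup_abs_ge[unfolded of_int_abs])
  obtain j where "sup_abs l = real_of_int \<bar>l j\<bar>" by (rule sup_abs_attained)
  thus "of_int M * sup_abs l \<le> sup_abs (\<lambda>j. M * l j)"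
    using sup_abs_ge[of "\<lambda>j. M * l j" j] M by (simp add: abs_mult)
qed

text \<open>The maximum norm dominates each coordinate, so the summand is at most the product over
  \<open>j\<close> of \<open>(1 + |n j|)^(-s/d)\<close>. Summed over a box this is a product of
  one-dimensional sums, convergent because \<open>s/d > 1\<close>.\<close>

lemma lattice_sum_bounded:
  assumes s: "real CARD('d::finite) < real s"
  obtains Z where "0 < Z" "\<And>X :: ('d \<Rightarrow> int) set. finite X \<Longrightarrow> (\<Sum>n\<in>X. (1 / (1 + sup_abs n)) ^ s) \<le> Z"
proof -
  define p where "p = real s / real CARD('d)"
  have p: "p > 1" using s by (simp add: p_def)
  define a where "a k = (1 + real_of_int \<bar>k\<bar>) powr - p" for k
  define A where "A = (\<Sum>k. (1 + real k) powr - p)"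
  have sm: "summable (\<lambda>k. (1 + real k) powr - p)"
    using p summable_real_powr_iff[of "- p"] by (subst (asm) summable_Suc_iff[symmetric]) (simp add: add.commute)
  have one: "(\<Sum>k\<in>{- int R..int R}. a k) \<le> 2 * A" for R
  proof -
    have "(\<Sum>k\<in>{- int R..int R}. a k) \<le> (\<Sum>k\<in>int ` {..R} \<union> (\<lambda>k. - int k) ` {..R}. a k)"
    proof (rule sum_mono2)
      show "{- int R..int R} \<subseteq> int ` {..R} \<union> (\<lambda>k. - int k) ` {..R}"
      proof
        fix k assume k: "k \<in> {- int R..int R}"
        show "k \<in> int ` {..R} \<union> (\<lambda>k. - int k) ` {..R}"
        proof (cases "k \<ge> 0")
          case True
          thus ?thesis using k by (intro UnI1 image_eqI[of _ _ "nat k"]) auto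
        next
          case False
          thus ?thesis using k by (intro UnI2 image_eqI[of _ _ "nat (- k)"]) auto
        qed
      qed
    qed (auto simp: a_def)
    also have "\<dots> \<le> (\<Sum>k\<in>int ` {..R}. a k) + (\<Sum>k\<in>(\<lambda>k. - int k) ` {..R}. a k)"
      by (subst sum_Un) (auto intro!: sum_nonneg simp: a_def)
    also have "\<dots> = 2 * (\<Sum>k\<le>R. (1 + real k) powr - p)"
      by (subst (1 2) sum.reindex) (auto simp: inj_on_def a_def)
    also have "\<dots> \<le> 2 * A"
      unfolding A_def using sm by (intro mult_left_mono sum_le_suminf) auto
    finally show ?thesis .
  qed
  have A0: "0 \<le> A" using one[of 0] by (simp add: a_def)
  show ?thesis
  \<comment> \<open>The product already bounds the sum; 1 is added for strict positivity.\<close>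
  proof (rule that[of "(2 * A) ^ CARD('d) + 1"])
    show "0 < (2 * A) ^ CARD('d) + 1" using A0 by (simp add: add_nonneg_pos)
    fix X :: "('d \<Rightarrow> int) set" assume X: "finite X"
    obtain R :: nat where R: "\<And>n j. n \<in> X \<Longrightarrow> \<bar>n j\<bar> \<le> int R"
    proof -
      have "finite ((\<lambda>(n, j). nat \<bar>n j\<bar>) ` (X \<times> UNIV))" using X by simp
      then obtain R where R: "\<forall>x \<in> (\<lambda>(n, j). nat \<bar>n j\<bar>) ` (X \<times> UNIV). x \<le> R"
        unfolding finite_nat_set_iff_bounded_le by blast
      have "nat \<bar>n j\<bar> \<le> R" if "n \<in> X" for n j
        using that by (intro bspec[OF R] image_eqI[of _ _ "(n, j)"]) auto
      thus ?thesis using that[of R] by (simp add: nat_le_iff)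
    qed
    have le: "(1 / (1 + sup_abs n)) ^ s \<le> (\<Prod>j\<in>UNIV. a (n j))" for n :: "'d \<Rightarrow> int"
    proof -
      have pos: "1 + sup_abs n > 0" using sup_abs_nonneg[of n] by linarith
      have "(1 / (1 + sup_abs n)) ^ s = (1 + sup_abs n) powr - real s"
        using pos by (simp add: powr_minus powr_realpow power_divide divide_inverse power_inverse)
      also have "- real s = - p * real CARD('d)" by (simp add: p_def)
      also have "(1 + sup_abs n) powr (- p * real CARD('d)) = (\<Prod>j\<in>(UNIV::'d set). (1 + sup_abs n) powr - p)"
        using pos powr_realpow[of "(1 + sup_abs n) powr - p" "CARD('d)"] by (simp add: powr_powr)
      also have "\<dots> \<le> (\<Prod>j\<in>UNIV. a (n j))"
        unfolding a_def using p sup_abs_ge[of n] pos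
        by (intro prod_mono conjI powr_mono2') (auto simp del: of_int_abs)
      finally show ?thesis .
    qed
    have "(\<Sum>n\<in>X. (1 / (1 + sup_abs n)) ^ s) \<le> (\<Sum>n\<in>X. \<Prod>j\<in>UNIV. a (n j))"
      by (intro sum_mono le)
    also have "\<dots> \<le> (\<Sum>n\<in>PiE (UNIV :: 'd set) (\<lambda>_. {- int R..int R}). \<Prod>j\<in>UNIV. a (n j))"
    proof (rule sum_mono2)
      show "X \<subseteq> PiE UNIV (\<lambda>_. {- int R..int R})"
        using R by (auto simp: PiE_def abs_le_iff) (metis minus_le_iff)
    qed (auto intro!: prod_nonneg finite_PiE simp: a_def)
    also have "\<dots> = (\<Prod>j\<in>(UNIV::'d set). \<Sum>k\<in>{- int R..int R}. a k)"
      by (subst prod_sum_PiE) auto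
    also have "\<dots> \<le> (\<Prod>j\<in>(UNIV::'d set). 2 * A)"
      by (intro prod_mono conjI one sum_nonneg) (auto simp: a_def)
    finally show "(\<Sum>n\<in>X. (1 / (1 + sup_abs n)) ^ s) \<le> (2 * A) ^ CARD('d) + 1" by simp
  qed
qed

lemma norm_symbol_le:
  assumes "0 < H"
  shows "cmod (symbol H is n) \<le> (pi / H * sup_abs n) ^ length is"
proof (induction "is")
  case (Cons i "is")
  have "cmod (wavenumber H (n i)) = pi / H * real_of_int \<bar>n i\<bar>"
    using assms by (simp add: wavenumber_def norm_mult norm_divide)
  hence "cmod (wavenumber H (n i)) \<le> pi / H * sup_abs n"
    using mult_left_mono[OF sup_abs_ge[of n i], of "pi / H"] assms by simp
  thus ?case unfolding symbol_Cons norm_mult length_Cons power_Suc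
    using assms sup_abs_nonneg[of n] by (intro mult_mono Cons) auto
qed simp

lemma norm_symbol_replicate:
  assumes "0 < H"
  shows "cmod (symbol H (replicate m i) n) = (pi / H * real_of_int \<bar>n i\<bar>) ^ m"
  using assms by (induction m) (simp_all add: symbol_Cons norm_mult wavenumber_def norm_divide)

section \<open>Decay of the coefficients and pointwise representation by the Fourier series\<close>

lemma fourier_coeff_decay:
  fixes f :: "real^'d \<Rightarrow> complex"
  assumes f: "test_fun L f" and L: "L \<le> H" and H: "0 < H"
  obtains C where "0 \<le> C" "\<And>n. cmod (fourier_coeff H f n) \<le> C * (1 / (1 + sup_abs n)) ^ s"
proof -
  have bnd: "\<exists>C\<ge>0. \<forall>n. cmod (fourier_coeff H g n) \<le> C" if g: "test_fun L g" for g :: "real^'d \<Rightarrow> complex"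
  proof -
    define I where "I = (LINT y|lebesgue. indicator (cube H) y * (cmod (g y))\<^sup>2) / (2 * H) ^ CARD('d)"
    have "(cmod (fourier_coeff H g n))\<^sup>2 \<le> I" for n
      using bessel_inequality[OF g L H, of "{n}"] H by (simp add: I_def pos_le_divide_eq)
    hence "cmod (fourier_coeff H g n) \<le> sqrt I" for n by (rule real_le_rsqrt)
    thus ?thesis by (intro exI[of _ "sqrt I"]) (meson norm_ge_zero order_trans)
  qed
  define g where "g j = foldr partial (replicate s j) f" for j
  have "\<exists>C\<ge>0. \<forall>n. cmod (fourier_coeff H (g j) n) \<le> C" for j
    unfolding g_def by (intro bnd test_fun_foldr_partial f)
  then obtain C where C: "\<And>j. 0 \<le> C j" "\<And>j n. cmod (fourier_coeff H (g j) n) \<le> C j" by metis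
  obtain C0 where C0: "0 \<le> C0" "\<And>n. cmod (fourier_coeff H f n) \<le> C0" using bnd[OF f] by blast
  \<comment> \<open>For each \<open>n\<close> one differentiates \<open>s\<close> times in the
    coordinate where \<open>n\<close> is largest. Summing over \<open>j\<close> removes the
    dependence on that coordinate, and \<open>C0\<close> handles
    \<open>sup_abs n \<le> 1\<close>.\<close>
  define D where "D = C0 + (\<Sum>j\<in>UNIV. C j) * (H / pi) ^ s"
  have D: "C0 \<le> D" "0 \<le> D" using C0 C(1) H by (auto simp: D_def intro!: sum_nonneg mult_nonneg_nonneg add_nonneg_nonneg)
  show ?thesis
  proof (rule that[of "D * 2 ^ s"])
    show "0 \<le> D * 2 ^ s" using D by simp
    fix n :: "'d \<Rightarrow> int"
    let ?a = "cmod (fourier_coeff H f n)" and ?x = "sup_abs n"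
    have "(1 + ?x) ^ s * ?a \<le> 2 ^ s * D"
    proof (cases "?x \<le> 1")
      case True
      have "(1 + ?x) ^ s \<le> 2 ^ s" using True sup_abs_nonneg[of n] by (intro power_mono) auto
      thus ?thesis using C0(2)[of n] D by (intro mult_mono) auto
    next
      case False
      obtain j where j: "?x = real_of_int \<bar>n j\<bar>" by (rule sup_abs_attained)
      have "(pi / H * ?x) ^ s * ?a = cmod (fourier_coeff H (g j) n)"
        unfolding g_def fourier_coeff_foldr_partial[OF H f] norm_mult norm_symbol_replicate[OF H] j ..
      also have "\<dots> \<le> C j" by (rule C)
      also have "\<dots> \<le> (\<Sum>j\<in>UNIV. C j)" using C(1) by (intro member_le_sum) auto
      finally have "?x ^ s * ?a \<le> (\<Sum>j\<in>UNIV. C j) * (H / pi) ^ s"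
        using H by (simp add: power_mult_distrib power_divide field_simps)
      hence xs: "?x ^ s * ?a \<le> D" using C0 by (simp add: D_def)
      have "(1 + ?x) ^ s * ?a \<le> (2 * ?x) ^ s * ?a"
        using False by (intro mult_right_mono power_mono) auto
      also have "\<dots> = 2 ^ s * (?x ^ s * ?a)" by (simp add: power_mult_distrib)
      also have "\<dots> \<le> 2 ^ s * D" using xs by simp
      finally show ?thesis .
    qed
    moreover have "0 < (1 + ?x) ^ s" using sup_abs_nonneg[of n] by simp
    ultimately show "?a \<le> D * 2 ^ s * (1 / (1 + ?x)) ^ s"
      by (simp add: power_divide field_simps)
  qed
qed

text \<open>Decay of order \<open>d + 1\<close> exceeds the dimension and is therefore
  summable.\<close>

lemma fourier_coeff_summable:
  fixes f :: "real^'d \<Rightarrow> complex"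
  assumes f: "test_fun L f" and L: "L \<le> H" and H: "0 < H"
  shows "(\<lambda>n. cmod (fourier_coeff H f n)) summable_on UNIV"
proof -
  obtain C where C: "0 \<le> C" "\<And>n. cmod (fourier_coeff H f n) \<le> C * (1 / (1 + sup_abs n)) ^ Suc CARD('d)"
    by (rule fourier_coeff_decay[OF assms, where s = "Suc CARD('d)"]) (rule that)
  have "real CARD('d) < real (Suc CARD('d))" by simp
  then obtain Z where Z: "0 < Z" "\<And>X :: ('d \<Rightarrow> int) set. finite X \<Longrightarrow> (\<Sum>n\<in>X. (1 / (1 + sup_abs n)) ^ Suc CARD('d)) \<le> Z"
    by (rule lattice_sum_bounded) (rule that)
  show ?thesis
  proof (rule nonneg_bdd_above_summable_on)
    show "bdd_above (sum (\<lambda>n. cmod (fourier_coeff H f n)) ` {F. F \<subseteq> UNIV \<and> finite F})"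
    proof (intro bdd_aboveI2)
      fix X :: "('d \<Rightarrow> int) set" assume "X \<in> {F. F \<subseteq> UNIV \<and> finite F}"
      hence X: "finite X" by simp
      have "(\<Sum>n\<in>X. cmod (fourier_coeff H f n)) \<le> (\<Sum>n\<in>X. C * (1 / (1 + sup_abs n)) ^ Suc CARD('d))"
        by (intro sum_mono C)
      also have "\<dots> \<le> C * Z" unfolding sum_distrib_left[symmetric] by (intro mult_left_mono Z X C)
      finally show "(\<Sum>n\<in>X. cmod (fourier_coeff H f n)) \<le> C * Z" .
    qed
  qed auto
qed

lemma trig_series_fourier_coeff_interior:
  fixes f :: "real^'d \<Rightarrow> complex"
  assumes f: "test_fun L f" and L: "L \<le> H" and H: "0 < H" and z: "\<And>j. \<bar>z $ j\<bar> < H"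
  shows "trig_series H (fourier_coeff H f) z = f z"
proof -
  note c = fourier_coeff_summable[OF f L H]
  have tc: "continuous_on UNIV (trig_series H (fourier_coeff H f))" by (rule trig_series_continuous[OF H c])
  note fc = test_fun_continuous[OF f, of UNIV]
  have "f z - trig_series H (fourier_coeff H f) z = 0"
  proof (rule fourier_uniqueness[OF H _ _ z])
    show "continuous_on UNIV (\<lambda>x. f x - trig_series H (fourier_coeff H f) x)"
      by (intro continuous_intros tc fc)
    fix k :: "'d \<Rightarrow> int"
    \<comment> \<open>Coefficients are taken against conjugate modes, uniqueness is tested with
      modes; negating the frequency matches the two.\<close>
    have k: "mode H k y = cnj (mode H (\<lambda>j. - k j) y)" for y by (simp add: mode_cnj)
    have "(LINT y|lebesgue. indicator (cube H) y * (mode H k y * (f y - trig_series H (fourier_coeff H f) y)))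
      = (LINT y|lebesgue. indicator (cube H) y * (mode H k y * f y))
        - (LINT y|lebesgue. indicator (cube H) y * (mode H k y * trig_series H (fourier_coeff H f) y))"
      unfolding right_diff_distrib
      by (intro Bochner_Integration.integral_diff integrable_cube_continuous continuous_intros tc fc)
    also have "\<dots> = 0"
      unfolding k fourier_coeff_cube[OF f L H] using trig_series_coeff[OF H c, of "\<lambda>j. - k j"] by (simp add: mult.assoc)
    finally show "(LINT y|lebesgue. indicator (cube H) y * (mode H k y * (f y - trig_series H (fourier_coeff H f) y))) = 0" .
  qed
  thus ?thesis by simp
qed

lemma mode_periodic:
  assumes "0 < H"
  shows "mode H n (\<chi> j. z $ j - 2 * H * of_int (m j)) = mode H n z"
proof -
  define T where "T = real_of_int (\<Sum>j\<in>UNIV. n j * m j)"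
  have "(\<Sum>j\<in>UNIV. of_int (n j) * (\<chi> j. z $ j - 2 * H * of_int (m j)) $ j)
      = (\<Sum>j\<in>UNIV. of_int (n j) * z $ j) - 2 * H * T"
    by (simp add: T_def right_diff_distrib sum_subtractf sum_distrib_left mult_ac)
  moreover have "pi / H * (a - 2 * H * T) = pi / H * a - 2 * pi * T" for a
    using assms by (simp add: field_simps)
  ultimately have "mode H n (\<chi> j. z $ j - 2 * H * of_int (m j))
    = cis (pi / H * (\<Sum>j\<in>UNIV. of_int (n j) * z $ j) - 2 * pi * T)"
    unfolding mode_def by simp
  also have "\<dots> = mode H n z * cis (- (2 * pi * T))"
    by (simp add: mode_def cis_mult)
  also have "cis (- (2 * pi * T)) = 1"
    using cis_multiple_2pi[of "- T"] by (simp add: T_def del: of_int_sum)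
  finally show ?thesis by simp
qed

text \<open>A point outside the cube is moved into it by periods. If
  \<open>H < \<bar>z $ i\<bar> < 2 * H - L\<close>, the translated coordinate has modulus
  \<open>2 * H - \<bar>z $ i\<bar> > L\<close>, so \<open>f\<close> vanishes both there and at
  \<open>z\<close>.\<close>

lemma trig_series_fourier_coeff:
  fixes f :: "real^'d \<Rightarrow> complex"
  assumes f: "test_fun L f" and L: "0 < L" "L < H" and z: "\<And>j. \<bar>z $ j\<bar> < 2 * H - L"
  shows "trig_series H (fourier_coeff H f) z = f z"
proof -
  have H: "0 < H" and LH: "L \<le> H" using L by auto
  note c = fourier_coeff_summable[OF f LH H]
  \<comment> \<open>Uniqueness covers only the open cube; continuity adds the faces, which contain
    grid points.\<close>
  have cube: "trig_series H (fourier_coeff H f) y = f y" if y: "y \<in> cube H" for y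
  proof -
    have "(0 :: real^'d) \<in> box (\<chi> j. - H) (\<chi> j. H)" using H by (simp add: mem_box_cart)
    hence "closure (box (\<chi> j. - H) (\<chi> j. H) :: (real^'d) set) = cube H"
      unfolding cube_def by (intro closure_box) blast
    hence "y \<in> closure (box (\<chi> j. - H) (\<chi> j. H))" using y by simp
    hence "trig_series H (fourier_coeff H f) y - f y = 0"
    proof (rule continuous_constant_on_closure[rotated 2])
      show "continuous_on (closure (box (\<chi> j. - H) (\<chi> j. H))) (\<lambda>y. trig_series H (fourier_coeff H f) y - f y)"
        by (intro continuous_intros test_fun_continuous[OF f] continuous_on_subset[OF trig_series_continuous[OF H c]]) auto
      show "trig_series H (fourier_coeff H f) y - f y = 0" if "y \<in> box (\<chi> j. - H) (\<chi> j. H)" for y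
        using that trig_series_fourier_coeff_interior[OF f LH H, of y] by (auto simp: mem_box_cart abs_less_iff minus_less_iff)
    qed
    thus ?thesis by simp
  qed
  show ?thesis
  proof (cases "z \<in> cube H")
    case False
    then obtain i where i: "\<bar>z $ i\<bar> > H" by (auto simp: mem_cube not_le)
    define m :: "'d \<Rightarrow> int" where "m j = (if z $ j > H then 1 else if z $ j < - H then - 1 else 0)" for j
    define y where "y = (\<chi> j. z $ j - 2 * H * of_int (m j))"
    have yj: "\<bar>y $ j\<bar> \<le> H" for j using z[of j] L by (auto simp: y_def m_def abs_le_iff abs_less_iff)
    have "L \<le> \<bar>y $ i\<bar>" using i z[of i] L by (auto simp: y_def m_def abs_if split: if_splits)
    hence "f y = 0" by (rule test_funD(3)[OF f])
    moreover have "f z = 0" using i L by (intro test_funD(3)[OF f, of _ i]) auto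
    moreover have "trig_series H (fourier_coeff H f) y = trig_series H (fourier_coeff H f) z"
      unfolding trig_series_def y_def mode_periodic[OF H] ..
    moreover have "trig_series H (fourier_coeff H f) y = f y" using yj by (intro cube) (simp add: mem_cube)
    ultimately show ?thesis by simp
  qed (rule cube)
qed

section \<open>Interpolation and aliasing\<close>

definition index_box :: "nat \<Rightarrow> ('d::finite \<Rightarrow> int) set" where
  "index_box M = {p. \<forall>j. p j \<in> {- (int M div 2) .. int M div 2 - 1}}"

lemma index_box_PiE: "index_box M = PiE UNIV (\<lambda>_. {- (int M div 2) .. int M div 2 - 1})"
  by (auto simp: index_box_def PiE_def)

lemma finite_index_box [simp]: "finite (index_box M)"
  unfolding index_box_PiE by (intro finite_PiE) auto

lemma card_index_box:
  assumes "even M" shows "card (index_box M :: ('d::finite \<Rightarrow> int) set) = M ^ CARD('d)"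
proof -
  have "card {- (int M div 2) .. int M div 2 - 1} = M" using assms by auto
  thus ?thesis unfolding index_box_PiE by (simp add: card_PiE)
qed

definition grid_point :: "real \<Rightarrow> ('d::finite \<Rightarrow> int) \<Rightarrow> real^'d" where
  "grid_point h p = (\<chi> j. h * of_int (p j))"

lemma centered_grid_eq: "centered_grid h M = grid_point h ` index_box M"
  by (auto simp: centered_grid_def grid_point_def index_box_def)

lemma inj_grid_point: "h \<noteq> 0 \<Longrightarrow> inj_on (grid_point h) A"
  by (auto simp: inj_on_def grid_point_def vec_eq_iff)

lemma grid_point_inner: "grid_point (pi / H) n \<bullet> x = pi / H * (\<Sum>j\<in>UNIV. of_int (n j) * x $ j)"
  by (simp add: inner_vec_def grid_point_def sum_distrib_left mult.assoc)

lemma exp_grid_point: "exp (\<i> * of_real (grid_point (pi / H) n \<bullet> x)) = mode H n x"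
  unfolding grid_point_inner mode_def cis_conv_exp ..

lemma exp_minus_grid_point: "exp (- \<i> * of_real (grid_point (pi / H) n \<bullet> x)) = cnj (mode H n x)"
  unfolding exp_grid_point[symmetric] exp_cnj by simp

text \<open>A geometric sum of an \<open>M\<close>-th root of unity \<open>w\<close>. The factor
  \<open>v\<close> accounts for the range starting at \<open>- M / 2\<close> instead of 0.\<close>

lemma sum_cis_index:
  assumes "0 < M" "even M"
  shows "(\<Sum>p\<in>{- (int M div 2) .. int M div 2 - 1}. cis (2 * pi / M * of_int a * of_int p))
     = (if int M dvd a then of_nat M else 0)"
proof -
  define w where "w = cis (2 * pi / M * of_int a)"
  define v where "v = cis (2 * pi / M * of_int a * of_int (- (int M div 2)))"
  have img: "{- (int M div 2) .. int M div 2 - 1} = (\<lambda>k. int k - int M div 2) ` {..<M}"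
  proof (intro equalityI subsetI)
    fix p assume "p \<in> {- (int M div 2) .. int M div 2 - 1}"
    thus "p \<in> (\<lambda>k. int k - int M div 2) ` {..<M}"
      using assms by (intro image_eqI[of _ _ "nat (p + int M div 2)"]) auto
  qed (use assms in auto)
  have "(\<Sum>p\<in>{- (int M div 2) .. int M div 2 - 1}. cis (2 * pi / M * of_int a * of_int p))
     = (\<Sum>k<M. cis (2 * pi / M * of_int a * of_int (int k - int M div 2)))"
    unfolding img by (subst sum.reindex) (auto simp: inj_on_def)
  also have "\<dots> = (\<Sum>k<M. v * w ^ k)"
  proof (intro sum.cong refl)
    fix k
    have "2 * pi / M * of_int a * of_int (int k - int M div 2)
      = 2 * pi / M * of_int a * of_int (- (int M div 2)) + real k * (2 * pi / M * of_int a)"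
      by (simp add: right_diff_distrib)
    thus "cis (2 * pi / M * of_int a * of_int (int k - int M div 2)) = v * w ^ k"
      by (simp only: v_def w_def Complex.DeMoivre cis_mult)
  qed
  also have "\<dots> = v * (\<Sum>k<M. w ^ k)" by (simp add: sum_distrib_left)
  finally have S: "(\<Sum>p\<in>{- (int M div 2) .. int M div 2 - 1}. cis (2 * pi / M * of_int a * of_int p)) = v * (\<Sum>k<M. w ^ k)" .
  have one: "cis (2 * (pi * real_of_int b)) = 1" for b
    using cis_multiple_2pi[of "of_int b"] by (simp add: mult.assoc)
  show ?thesis
  proof (cases "int M dvd a")
    case True
    then obtain b where b: "a = int M * b" by blast
    have "w = 1" using assms(1) one[of b] by (simp add: w_def b mult.assoc)
    moreover have "v = 1"
      using assms(1) one[of "b * (- (int M div 2))"] by (simp add: v_def b mult.assoc)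
    ultimately show ?thesis unfolding S using True by simp
  next
    case False
    have "w \<noteq> 1"
    proof
      assume "w = 1"
      hence "cos (2 * pi / M * of_int a) = 1" by (simp add: w_def complex_eq_iff)
      then obtain k :: int where "2 * pi / M * of_int a = of_int k * 2 * pi" unfolding cos_one_2pi_int by blast
      hence "(2 * pi) * (of_int a / M) = (2 * pi) * of_int k" by simp
      hence "of_int a / real M = of_int k" by (simp only: mult_cancel_left) simp
      hence "real_of_int a = of_int (k * int M)" using assms(1) by (simp add: field_simps)
      hence "a = k * int M" by linarith
      thus False using False by simp
    qed
    moreover have "w ^ M = 1"
      using assms(1) one[of a] by (simp add: w_def Complex.DeMoivre mult.assoc)
    ultimately show ?thesis unfolding S using False by (simp add: geometric_sum)
  qed
qed

lemma sum_mode_grid: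
  fixes n :: "'d::finite \<Rightarrow> int"
  assumes "0 < M" "even M" "0 < H"
  shows "(\<Sum>p\<in>index_box M. mode H n (grid_point (2 * H / M) p))
     = (if \<forall>j. int M dvd n j then of_nat M ^ CARD('d) else 0)"
proof -
  have "mode H n (grid_point (2 * H / M) p) = (\<Prod>j\<in>UNIV. cis (2 * pi / M * of_int (n j) * of_int (p j)))" for p :: "'d \<Rightarrow> int"
    unfolding mode_def cis_conv_exp exp_sum[OF finite, symmetric]
    using assms(3) by (simp add: grid_point_def sum_distrib_left mult_ac)
  hence "(\<Sum>p\<in>index_box M. mode H n (grid_point (2 * H / M) p))
     = (\<Sum>p\<in>index_box M. \<Prod>j\<in>UNIV. cis (2 * pi / M * of_int (n j) * of_int (p j)))" by simp
  also have "\<dots> = (\<Prod>j\<in>UNIV. \<Sum>k\<in>{- (int M div 2) .. int M div 2 - 1}. cis (2 * pi / M * of_int (n j) * of_int k))"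
    unfolding index_box_PiE by (rule prod_sum_PiE[symmetric]) auto
  also have "\<dots> = (\<Prod>j\<in>UNIV. if int M dvd n j then of_nat M else 0)"
    unfolding sum_cis_index[OF assms(1,2)] ..
  also have "\<dots> = (if \<forall>j. int M dvd n j then of_nat M ^ CARD('d) else 0)" by auto
  finally show ?thesis .
qed

text \<open>As \<open>l\<close> varies, these are the frequencies that the grid cannot distinguish
  from \<open>r\<close>.\<close>

definition shift :: "nat \<Rightarrow> ('d \<Rightarrow> int) \<Rightarrow> ('d \<Rightarrow> int) \<Rightarrow> 'd \<Rightarrow> int" where
  "shift M r l = (\<lambda>j. r j + int M * l j)"

lemma inj_shift: "0 < M \<Longrightarrow> inj (shift M r)"
  by (auto simp: inj_def shift_def fun_eq_iff)

lemma index_box_decomp: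
  fixes n :: "'d::finite \<Rightarrow> int"
  assumes "0 < M" "even M"
  obtains r l where "r \<in> index_box M" "n = shift M r l"
proof
  \<comment> \<open>Adding \<open>h\<close> before the division and subtracting it afterwards
    centres the residues in the half-open box.\<close>
  define h where "h = int M div 2"
  have h: "int M = 2 * h" using assms(2) by (auto simp: h_def)
  have "(n j + h) mod int M - h \<in> {- h..h - 1}" for j
  proof -
    have "0 \<le> (n j + h) mod int M" "(n j + h) mod int M < int M" using assms(1) by auto
    thus ?thesis unfolding atLeastAtMost_iff using h by linarith
  qed
  thus "(\<lambda>j. (n j + h) mod int M - h) \<in> index_box M"
    unfolding index_box_def h_def[symmetric] by blast
  show "n = shift M (\<lambda>j. (n j + h) mod int M - h) (\<lambda>j. (n j + h) div int M)"
    by (auto simp: shift_def fun_eq_iff algebra_simps)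
qed

lemma index_box_unique:
  assumes M: "0 < M" "even M" and "r \<in> index_box M" "r' \<in> index_box M" "shift M r l = shift M r' l'"
  shows "r = r'" "l = l'"
proof -
  have "l j = l' j" for j
  proof -
    have "int M * (l j - l' j) = r' j - r j"
      using assms(5) by (auto simp: shift_def fun_eq_iff algebra_simps)
    moreover have "\<bar>r' j - r j\<bar> < int M"
      using assms(3,4) M unfolding index_box_def by (auto dest!: spec[of _ j] elim!: evenE)
    ultimately have "int M * \<bar>l j - l' j\<bar> < int M * 1" using M by (metis abs_mult abs_of_nat mult.right_neutral)
    hence "\<bar>l j - l' j\<bar> < 1" using M by (simp only: mult_less_cancel_left)
    thus ?thesis by simp
  qed
  thus "l = l'" by blast
  thus "r = r'" using assms(5) by (auto simp: shift_def fun_eq_iff)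
qed

lemma has_sum_finite_sum:
  fixes f :: "'p \<Rightarrow> 'n \<Rightarrow> complex"
  assumes "finite P" "\<And>p. p \<in> P \<Longrightarrow> (f p has_sum s p) A"
  shows "((\<lambda>n. \<Sum>p\<in>P. f p n) has_sum (\<Sum>p\<in>P. s p)) A"
  using assms by (induction P rule: finite_induct) (auto intro: has_sum_add)

text \<open>Putting 0 at \<open>l = 0\<close>, instead of removing that index, lets the sums run
  over all of the lattice.\<close>

definition alias_coeff :: "nat \<Rightarrow> (('d \<Rightarrow> int) \<Rightarrow> complex) \<Rightarrow> ('d \<Rightarrow> int) \<Rightarrow> ('d \<Rightarrow> int) \<Rightarrow> complex" where
  "alias_coeff M c r l = (if l = (\<lambda>_. 0) then 0 else c (shift M r l))"

context
  fixes L H :: real and N M :: nat and \<rho> :: "real^'d \<Rightarrow> complex"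
  assumes L: "0 < L" and N: "0 < N" "even N"
    and H_def: "H = real (pad_factor CARD('d)) * L" and M_def: "M = pad_factor CARD('d) * N"
    and \<rho>: "test_fun L \<rho>"
begin

lemma pad_factor_ge: "sqrt (real CARD('d)) + 1 \<le> real (pad_factor CARD('d))"
  unfolding pad_factor_def by linarith

lemma pad_factor_ge_2: "2 \<le> pad_factor CARD('d)"
proof -
  have "sqrt (real CARD('d)) \<ge> 1" by simp
  hence "real (pad_factor CARD('d)) \<ge> 2" using pad_factor_ge by linarith
  thus ?thesis by linarith
qed

lemma L_less_H: "L < H"
proof -
  have "L * 2 \<le> L * real (pad_factor CARD('d))" using L pad_factor_ge_2 by (intro mult_left_mono) auto
  thus ?thesis using L by (simp add: H_def mult.commute)
qed

lemma H_pos: "0 < H"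
  using L L_less_H by linarith

lemma M_pos: "0 < M" and M_even: "even M"
  using N pad_factor_ge_2 by (auto simp: M_def)

lemma grid_width: "2 * L / real N = 2 * H / real M"
  using N pad_factor_ge_2 by (simp add: H_def M_def)

definition dft where "dft r = dft_coeff L N \<rho> (grid_point (pi / H) r)"

lemma fourier_interpolant_eq:
  "fourier_interpolant L N \<rho> = (\<lambda>x. \<Sum>r\<in>index_box M. dft r * mode H r x)"
proof
  fix x
  have "(freq_grid L N :: (real^'d) set) = grid_point (pi / H) ` index_box M"
    unfolding freq_grid_def centered_grid_eq H_def M_def ..
  moreover have "inj_on (grid_point (pi / H)) (index_box M :: ('d \<Rightarrow> int) set)"
    using H_pos by (intro inj_grid_point) auto
  ultimately show "fourier_interpolant L N \<rho> x = (\<Sum>r\<in>index_box M. dft r * mode H r x)"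
    unfolding fourier_interpolant_def dft_def by (simp add: sum.reindex exp_grid_point)
qed

lemma dft_eq:
  "dft r = (\<Sum>p\<in>index_box M. \<rho> (grid_point (2 * H / M) p) * cnj (mode H r (grid_point (2 * H / M) p))) / of_nat M ^ CARD('d)"
proof -
  have "(space_grid L N :: (real^'d) set) = grid_point (2 * H / M) ` index_box M"
    unfolding space_grid_def centered_grid_eq grid_width M_def ..
  moreover have "inj_on (grid_point (2 * H / M)) (index_box M :: ('d \<Rightarrow> int) set)"
    using H_pos M_pos by (intro inj_grid_point) auto
  ultimately show ?thesis
    unfolding dft_def dft_coeff_def exp_minus_grid_point M_def[symmetric] by (simp add: sum.reindex)
qed

text \<open>Insert the pointwise Fourier series at the grid points. Discrete orthogonality then
  annihilates every frequency not congruent to \<open>r\<close> modulo \<open>M\<close>.\<close>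

lemma dft_has_sum:
  "((\<lambda>l. fourier_coeff H \<rho> (shift M r l)) has_sum dft r) UNIV"
proof -
  let ?c = "fourier_coeff H \<rho>"
  let ?z = "grid_point (2 * H / M) :: ('d \<Rightarrow> int) \<Rightarrow> real^'d"
  note c = fourier_coeff_summable[OF \<rho> less_imp_le[OF L_less_H] H_pos]
  have "((\<lambda>n. ?c n * mode H n (?z p)) has_sum \<rho> (?z p)) UNIV" if p: "p \<in> index_box M" for p
  proof -
    \<comment> \<open>The index \<open>- M / 2\<close> gives a point with a coordinate equal to
      \<open>- H\<close>, still inside the region of representation because
      \<open>L < H\<close>.\<close>
    have "\<bar>?z p $ j\<bar> < 2 * H - L" for j
    proof -
      have "- (int M div 2) \<le> p j" "p j \<le> int M div 2 - 1" using p by (auto simp: index_box_def)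
      hence "\<bar>2 * p j\<bar> \<le> int M" using M_even by auto
      hence "\<bar>2 * real_of_int (p j)\<bar> \<le> real M" by linarith
      hence "\<bar>real_of_int (p j)\<bar> * (2 * H / M) \<le> (M / 2) * (2 * H / M)"
        using H_pos by (intro mult_right_mono) auto
      hence "\<bar>?z p $ j\<bar> \<le> H" using M_pos H_pos by (simp add: grid_point_def abs_mult mult.commute)
      thus ?thesis using L_less_H by linarith
    qed
    hence "trig_series H ?c (?z p) = \<rho> (?z p)" by (intro trig_series_fourier_coeff[OF \<rho> L L_less_H])
    thus ?thesis using trig_series_has_sum[OF H_pos c, of "?z p"] by simp
  qed
  hence "((\<lambda>n. \<Sum>p\<in>index_box M. ?c n * mode H n (?z p) * (cnj (mode H r (?z p)) / of_nat M ^ CARD('d))) has_sum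
      (\<Sum>p\<in>index_box M. \<rho> (?z p) * (cnj (mode H r (?z p)) / of_nat M ^ CARD('d)))) UNIV"
    by (intro has_sum_finite_sum has_sum_cmult_left finite_index_box)
  also have "(\<Sum>p\<in>index_box M. \<rho> (?z p) * (cnj (mode H r (?z p)) / of_nat M ^ CARD('d))) = dft r"
    by (simp add: dft_eq sum_divide_distrib)
  also have "(\<lambda>n. \<Sum>p\<in>index_box M. ?c n * mode H n (?z p) * (cnj (mode H r (?z p)) / of_nat M ^ CARD('d)))
      = (\<lambda>n. if \<forall>j. int M dvd n j - r j then ?c n else 0)"
  proof
    fix n
    have "(\<Sum>p\<in>index_box M. ?c n * mode H n (?z p) * (cnj (mode H r (?z p)) / of_nat M ^ CARD('d)))
        = ?c n / of_nat M ^ CARD('d) * (\<Sum>p\<in>index_box M. mode H (\<lambda>j. n j - r j) (?z p))"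
      by (simp add: sum_distrib_left mode_mult_cnj[symmetric] mult.assoc)
    thus "(\<Sum>p\<in>index_box M. ?c n * mode H n (?z p) * (cnj (mode H r (?z p)) / of_nat M ^ CARD('d)))
      = (if \<forall>j. int M dvd n j - r j then ?c n else 0)"
      unfolding sum_mode_grid[OF M_pos M_even H_pos] using M_pos by simp
  qed
  also have "((\<lambda>n. if \<forall>j. int M dvd n j - r j then ?c n else 0) has_sum dft r) UNIV
     \<longleftrightarrow> (?c has_sum dft r) (range (shift M r))"
  proof (rule has_sum_cong_neutral)
    have iff: "(\<forall>j. int M dvd n j - r j) \<longleftrightarrow> n \<in> range (shift M r)" for n
    proof
      assume "\<forall>j. int M dvd n j - r j"
      then obtain l where "\<And>j. n j - r j = int M * l j" unfolding dvd_def by metis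
      hence "n = shift M r l" by (auto simp: shift_def fun_eq_iff algebra_simps)
      thus "n \<in> range (shift M r)" by blast
    qed (auto simp: shift_def)
    show "\<And>x. x \<in> range (shift M r) - UNIV \<Longrightarrow> ?c x = 0" by auto
    show "\<And>x. x \<in> UNIV - range (shift M r) \<Longrightarrow> (if \<forall>j. int M dvd x j - r j then ?c x else 0) = 0"
      unfolding iff by auto
    show "\<And>x. x \<in> UNIV \<inter> range (shift M r) \<Longrightarrow> (if \<forall>j. int M dvd x j - r j then ?c x else 0) = ?c x"
      unfolding iff by auto
  qed
  also have "\<dots> \<longleftrightarrow> ((?c \<circ> shift M r) has_sum dft r) UNIV"
    by (rule has_sum_reindex[OF inj_shift[OF M_pos]])
  finally show ?thesis by (simp add: o_def)
qed

lemma alias_has_sum: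
  "(alias_coeff M (fourier_coeff H \<rho>) r has_sum (dft r - fourier_coeff H \<rho> r)) UNIV"
proof -
  have "((\<lambda>l. if l = (\<lambda>_. 0) then - fourier_coeff H \<rho> r else 0) has_sum (- fourier_coeff H \<rho> r)) UNIV"
    by (rule has_sum_finite_neutralI[of "{\<lambda>_. 0}"]) auto
  from has_sum_add[OF dft_has_sum[of r] this]
  have "((\<lambda>l. fourier_coeff H \<rho> (shift M r l) + (if l = (\<lambda>_. 0) then - fourier_coeff H \<rho> r else 0))
      has_sum (dft r - fourier_coeff H \<rho> r)) UNIV" by simp
  moreover have "fourier_coeff H \<rho> (shift M r l) + (if l = (\<lambda>_. 0) then - fourier_coeff H \<rho> r else 0)
      = alias_coeff M (fourier_coeff H \<rho>) r l" for l
    by (simp add: alias_coeff_def shift_def)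
  ultimately show ?thesis by simp
qed

definition err_coeff where
  "err_coeff is n = symbol H is n * (if n \<in> index_box M then fourier_coeff H \<rho> n - dft n else fourier_coeff H \<rho> n)"

lemma err_coeff_summable: "(\<lambda>n. cmod (err_coeff is n)) summable_on UNIV"
  and err_coeff_series:
    "(\<And>j. \<bar>z $ j\<bar> < 2 * H - L) \<Longrightarrow> trig_series H (err_coeff is) z
       = foldr partial is \<rho> z - foldr partial is (fourier_interpolant L N \<rho>) z"
proof -
  let ?g = "foldr partial is \<rho>"
  have g: "test_fun L ?g" by (rule test_fun_foldr_partial[OF \<rho>])
  note cg = fourier_coeff_summable[OF g less_imp_le[OF L_less_H] H_pos]
  define b where "b n = (if n \<in> index_box M then symbol H is n * dft n else 0)" for n
  have e: "err_coeff is n = fourier_coeff H ?g n - b n" for n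
    unfolding fourier_coeff_foldr_partial[OF H_pos \<rho>] err_coeff_def b_def by (simp add: right_diff_distrib)
  have b: "(\<lambda>n. cmod (b n)) summable_on UNIV"
    by (rule finite_nonzero_values_imp_summable_on)
       (rule finite_subset[OF _ finite_index_box[of M]], auto simp: b_def split: if_splits)
  show s: "(\<lambda>n. cmod (err_coeff is n)) summable_on UNIV"
    by (rule summable_on_comparison_test[OF summable_on_add[OF cg b]]) (auto simp: e norm_triangle_ineq4)
  assume z: "\<And>j. \<bar>z $ j\<bar> < 2 * H - L"
  have "((\<lambda>n. fourier_coeff H ?g n * mode H n z) has_sum ?g z) UNIV"
    using trig_series_has_sum[OF H_pos cg, of z] trig_series_fourier_coeff[OF g L L_less_H z] by simp
  moreover have "((\<lambda>n. - (b n * mode H n z)) has_sum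
      - (\<Sum>n\<in>index_box M. symbol H is n * dft n * mode H n z)) UNIV"
    by (rule has_sum_uminusI, rule has_sum_finite_neutralI[of "index_box M"]) (auto simp: b_def)
  ultimately have "((\<lambda>n. fourier_coeff H ?g n * mode H n z + - (b n * mode H n z)) has_sum
      (?g z + - (\<Sum>n\<in>index_box M. symbol H is n * dft n * mode H n z))) UNIV"
    by (rule has_sum_add)
  hence "((\<lambda>n. err_coeff is n * mode H n z) has_sum
      (?g z - (\<Sum>n\<in>index_box M. symbol H is n * dft n * mode H n z))) UNIV"
    by (simp add: e left_diff_distrib)
  with trig_series_has_sum[OF H_pos s, of z]
  have "trig_series H (err_coeff is) z = ?g z - (\<Sum>n\<in>index_box M. symbol H is n * dft n * mode H n z)"
    using has_sum_unique by blast
  thus "trig_series H (err_coeff is) z = ?g z - foldr partial is (fourier_interpolant L N \<rho>) z"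
    unfolding fourier_interpolant_eq foldr_partial_trig_sum .
qed

end

section \<open>Lattice estimates\<close>

lemma index_box_sup_abs:
  assumes "n \<in> index_box M" "even M" shows "sup_abs n \<le> real M / 2"
proof (rule sup_abs_le)
  fix j
  have "- (int M div 2) \<le> n j" "n j \<le> int M div 2 - 1" using assms(1) by (auto simp: index_box_def)
  hence "2 * \<bar>n j\<bar> \<le> int M" using assms(2) by auto
  thus "real_of_int \<bar>n j\<bar> \<le> real M / 2" by linarith
qed

lemma not_index_box_sup_abs:
  assumes "n \<notin> index_box M" "even M" shows "real M / 2 \<le> sup_abs n"
proof -
  obtain j where "\<not> (- (int M div 2) \<le> n j \<and> n j \<le> int M div 2 - 1)"
    using assms(1) unfolding index_box_def atLeastAtMost_iff by blast
  hence "int M \<le> 2 * \<bar>n j\<bar>" using assms(2) by (auto elim!: evenE)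
  hence "real M / 2 \<le> real_of_int \<bar>n j\<bar>" by linarith
  thus ?thesis using sup_abs_ge[of n j] by linarith
qed

text \<open>As \<open>r\<close> has size at most \<open>M / 2\<close> and \<open>l\<close> at least
  1, \<open>M |l| \<le> 2 |r + M l|\<close>; together with \<open>1 + |l| \<le> 2 |l|\<close> this
  gives the constant 4.\<close>

lemma shift_sup_abs:
  assumes "r \<in> index_box M" "even M" "l \<noteq> (\<lambda>_. 0)"
  shows "real M * (1 + sup_abs l) \<le> 4 * sup_abs (shift M r l)"
proof -
  have "real M * sup_abs l = sup_abs (\<lambda>j. int M * l j)" using sup_abs_scale[of "int M" l] by simp
  also have "\<dots> = sup_abs (\<lambda>j. shift M r l j + - r j)" by (simp add: shift_def)
  also have "\<dots> \<le> sup_abs (shift M r l) + sup_abs (\<lambda>j. - r j)" by (rule sup_abs_triangle)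
  also have "sup_abs (\<lambda>j. - r j) = sup_abs r" by (simp add: sup_abs_def)
  finally have "real M * sup_abs l \<le> sup_abs (shift M r l) + real M / 2"
    using index_box_sup_abs[OF assms(1,2)] by linarith
  moreover have "real M * 1 \<le> real M * sup_abs l"
    using sup_abs_ge_1[OF assms(3)] by (intro mult_left_mono) auto
  ultimately show ?thesis by (simp add: distrib_left)
qed

lemma sum_mult_le_sqrt:
  fixes a b :: "'a \<Rightarrow> real"
  assumes "(\<Sum>i\<in>I. (a i)\<^sup>2) \<le> A" "(\<Sum>i\<in>I. (b i)\<^sup>2) \<le> B"
  shows "(\<Sum>i\<in>I. a i * b i) \<le> sqrt A * sqrt B" "(\<Sum>i\<in>I. a i * b i)\<^sup>2 \<le> A * B"
proof -
  have "(\<Sum>i\<in>I. a i * b i)\<^sup>2 \<le> (\<Sum>i\<in>I. (a i)\<^sup>2) * (\<Sum>i\<in>I. (b i)\<^sup>2)" by (rule Cauchy_Schwarz_ineq_sum)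
  also have "\<dots> \<le> A * B"
  proof (rule mult_mono[OF assms])
    have "0 \<le> (\<Sum>i\<in>I. (a i)\<^sup>2)" by (rule sum_nonneg) simp
    thus "0 \<le> A" using assms(1) by linarith
    show "0 \<le> (\<Sum>i\<in>I. (b i)\<^sup>2)" by (rule sum_nonneg) simp
  qed
  finally show *: "(\<Sum>i\<in>I. a i * b i)\<^sup>2 \<le> A * B" .
  thus "(\<Sum>i\<in>I. a i * b i) \<le> sqrt A * sqrt B"
    unfolding real_sqrt_mult[symmetric] by (rule real_le_rsqrt)
qed

text \<open>Phrased with finite sums, which is the form Bessel's inequality delivers and
  Cauchy-Schwarz consumes. For positive \<open>m\<close> the zero frequency has weight zero, just as
  constants do in the seminorm.\<close>

definition energy_bound :: "nat \<Rightarrow> (('d::finite \<Rightarrow> int) \<Rightarrow> complex) \<Rightarrow> real \<Rightarrow> bool" where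
  "energy_bound m c W \<longleftrightarrow> (\<forall>X. finite X \<longrightarrow> (\<Sum>n\<in>X. (sup_abs n ^ m * cmod (c n))\<^sup>2) \<le> W)"

lemma energy_bound_nonneg: "energy_bound m c W \<Longrightarrow> 0 \<le> W"
  unfolding energy_bound_def by (metis finite.emptyI sum.empty)

section \<open>The square sum of the aliased coefficients\<close>

context
  fixes c T :: "('d::finite \<Rightarrow> int) \<Rightarrow> complex" and M m :: nat and W Z :: real
  assumes M: "0 < M" "even M" and T: "\<And>r. (alias_coeff M c r has_sum T r) UNIV"
    and W: "energy_bound m c W"
    and Z: "\<And>X :: ('d \<Rightarrow> int) set. finite X \<Longrightarrow> (\<Sum>n\<in>X. (1 / (1 + sup_abs n)) ^ (2 * m)) \<le> Z"
begin

lemma Z_nonneg: "0 \<le> Z"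
  using Z[of "{}"] by simp

text \<open>For each \<open>r\<close>, Cauchy-Schwarz pairs \<open>|n|^m |c n|\<close> with the
  weights \<open>(4 / (M (1 + |l|)))^m\<close>, where \<open>n = r + M l\<close>. Uniqueness of
  residues makes the double sum over \<open>r\<close> and \<open>l\<close> visit every frequency at
  most once, so \<open>W\<close> bounds it for all \<open>r\<close> together.\<close>

lemma alias_finite_bound:
  assumes X: "finite X"
  shows "(\<Sum>r\<in>index_box M. (cmod (\<Sum>l\<in>X. alias_coeff M c r l))\<^sup>2) \<le> (4 / M) ^ (2 * m) * Z * W"
proof -
  define X' where "X' = X - {\<lambda>_. 0}"
  have X': "finite X'" using X by (simp add: X'_def)
  define a where "a r l = sup_abs (shift M r l) ^ m * cmod (c (shift M r l))" for r l
  define b where "b l = (4 / M * (1 / (1 + sup_abs l))) ^ m" for l :: "'d \<Rightarrow> int"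
  have b: "(\<Sum>l\<in>X'. (b l)\<^sup>2) \<le> (4 / M) ^ (2 * m) * Z"
  proof -
    have "(b l)\<^sup>2 = (4 / M) ^ (2 * m) * (1 / (1 + sup_abs l)) ^ (2 * m)" for l
      by (simp only: b_def power_mult_distrib power_even_eq)
    hence "(\<Sum>l\<in>X'. (b l)\<^sup>2) = (4 / M) ^ (2 * m) * (\<Sum>l\<in>X'. (1 / (1 + sup_abs l)) ^ (2 * m))"
      by (simp add: sum_distrib_left)
    also have "\<dots> \<le> (4 / M) ^ (2 * m) * Z" by (intro mult_left_mono Z X') simp
    finally show ?thesis .
  qed
  have le: "(cmod (\<Sum>l\<in>X. alias_coeff M c r l))\<^sup>2 \<le> (\<Sum>l\<in>X'. (a r l)\<^sup>2) * ((4 / M) ^ (2 * m) * Z)"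
    if r: "r \<in> index_box M" for r
  proof -
    have "cmod (\<Sum>l\<in>X. alias_coeff M c r l) \<le> (\<Sum>l\<in>X. cmod (alias_coeff M c r l))" by (rule norm_sum)
    also have "\<dots> = (\<Sum>l\<in>X'. cmod (alias_coeff M c r l))"
      unfolding X'_def using X by (intro sum.mono_neutral_right) (auto simp: alias_coeff_def)
    also have "\<dots> \<le> (\<Sum>l\<in>X'. a r l * b l)"
    proof (rule sum_mono)
      fix l assume "l \<in> X'"
      hence l: "l \<noteq> (\<lambda>_. 0)" by (simp add: X'_def)
      have pos: "0 < 1 + sup_abs l" using sup_abs_nonneg[of l] by linarith
      have "1 \<le> sup_abs (shift M r l) * (4 / M * (1 / (1 + sup_abs l)))"
      proof -
        have "0 < real M * (1 + sup_abs l)" using pos M by simp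
        hence "1 \<le> 4 * sup_abs (shift M r l) / (real M * (1 + sup_abs l))"
          using shift_sup_abs[OF r M(2) l] by (simp only: le_divide_eq_1_pos)
        thus ?thesis by (simp add: mult.commute)
      qed
      hence "1 * cmod (c (shift M r l)) \<le> (sup_abs (shift M r l) * (4 / M * (1 / (1 + sup_abs l)))) ^ m * cmod (c (shift M r l))"
        by (intro mult_right_mono one_le_power) auto
      also have "\<dots> = a r l * b l"
        by (simp only: a_def b_def power_mult_distrib mult_ac)
      finally show "cmod (alias_coeff M c r l) \<le> a r l * b l"
        using l by (simp add: alias_coeff_def)
    qed
    finally have "(cmod (\<Sum>l\<in>X. alias_coeff M c r l))\<^sup>2 \<le> (\<Sum>l\<in>X'. a r l * b l)\<^sup>2" by (intro power_mono) auto
    also have "\<dots> \<le> (\<Sum>l\<in>X'. (a r l)\<^sup>2) * ((4 / M) ^ (2 * m) * Z)" by (rule sum_mult_le_sqrt(2)[OF order_refl b])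
    finally show ?thesis .
  qed
  have "(\<Sum>r\<in>index_box M. (cmod (\<Sum>l\<in>X. alias_coeff M c r l))\<^sup>2)
     \<le> (\<Sum>r\<in>index_box M. (\<Sum>l\<in>X'. (a r l)\<^sup>2) * ((4 / M) ^ (2 * m) * Z))"
    by (rule sum_mono) (rule le)
  also have "\<dots> = (\<Sum>(r, l)\<in>index_box M \<times> X'. (a r l)\<^sup>2) * ((4 / M) ^ (2 * m) * Z)"
    by (simp add: sum.cartesian_product sum_distrib_right[symmetric])
  also have "(\<Sum>(r, l)\<in>index_box M \<times> X'. (a r l)\<^sup>2)
      = (\<Sum>n\<in>(\<lambda>(r, l). shift M r l) ` (index_box M \<times> X'). (sup_abs n ^ m * cmod (c n))\<^sup>2)"
  proof -
    have "inj_on (\<lambda>(r, l). shift M r l) (index_box M \<times> X')"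
      by (auto intro!: inj_onI dest: index_box_unique[OF M])
    thus ?thesis by (simp add: sum.reindex a_def case_prod_unfold)
  qed
  also have "\<dots> * ((4 / M) ^ (2 * m) * Z) \<le> W * ((4 / M) ^ (2 * m) * Z)"
    using W X' Z_nonneg unfolding energy_bound_def by (intro mult_right_mono) auto
  finally show ?thesis by (simp add: mult_ac)
qed

lemma alias_bound: "(\<Sum>r\<in>index_box M. (cmod (T r))\<^sup>2) \<le> (4 / M) ^ (2 * m) * Z * W"
proof (rule tendsto_upperbound)
  show "((\<lambda>X. \<Sum>r\<in>index_box M. (cmod (\<Sum>l\<in>X. alias_coeff M c r l))\<^sup>2) \<longlongrightarrow> (\<Sum>r\<in>index_box M. (cmod (T r))\<^sup>2))
      (finite_subsets_at_top UNIV)"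
    using T unfolding has_sum_def by (intro tendsto_intros) auto
  show "\<forall>\<^sub>F X in finite_subsets_at_top UNIV.
      (\<Sum>r\<in>index_box M. (cmod (\<Sum>l\<in>X. alias_coeff M c r l))\<^sup>2) \<le> (4 / M) ^ (2 * m) * Z * W"
    by (rule eventually_finite_subsets_at_top_weakI) (rule alias_finite_bound)
qed simp

section \<open>The error coefficients in square sum and in absolute sum\<close>

context
  fixes D :: "('d \<Rightarrow> int) \<Rightarrow> complex" and \<kappa> :: real and a :: nat
  assumes \<kappa>: "0 \<le> \<kappa>" and a: "a \<le> m"
    and D_in: "\<And>n. n \<in> index_box M \<Longrightarrow> cmod (D n) \<le> (\<kappa> * sup_abs n) ^ a * cmod (T n)"
    and D_out: "\<And>n. n \<notin> index_box M \<Longrightarrow> cmod (D n) \<le> (\<kappa> * sup_abs n) ^ a * cmod (c n)"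
begin

lemma D_in': "n \<in> index_box M \<Longrightarrow> cmod (D n) \<le> (\<kappa> * M) ^ a * cmod (T n)"
proof -
  assume n: "n \<in> index_box M"
  have "sup_abs n \<le> M" using index_box_sup_abs[OF n M(2)] by linarith
  hence "(\<kappa> * sup_abs n) ^ a \<le> (\<kappa> * M) ^ a"
    using \<kappa> sup_abs_nonneg[of n] by (intro power_mono mult_left_mono) auto
  hence "(\<kappa> * sup_abs n) ^ a * cmod (T n) \<le> (\<kappa> * M) ^ a * cmod (T n)" by (rule mult_right_mono) simp
  thus ?thesis using D_in[OF n] by linarith
qed

text \<open>Inside the box the derivative costs at most \<open>(\<kappa> M)^a\<close> against the
  gain \<open>(4 / M)^m\<close> from aliasing. Outside, \<open>|n| \<ge> M / 2\<close> turns the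
  \<open>m - a\<close> spare powers of \<open>|n|\<close> into \<open>(2 / M)^(m - a)\<close>. The
  factor \<open>16 ^ m\<close> covers both.\<close>

lemma error_square_bound:
  assumes X: "finite X"
  shows "(\<Sum>n\<in>X. (cmod (D n))\<^sup>2) \<le> \<kappa> ^ (2 * a) * 16 ^ m * (1 + Z) * (1 / M) ^ (2 * (m - a)) * W"
proof -
  have W0: "0 \<le> W" by (rule energy_bound_nonneg[OF W])
  have M0: "real M > 0" using M by simp
  define e where "e = (1 / real M) ^ (2 * (m - a))"
  have e0: "0 \<le> e" by (simp add: e_def)
  have "(\<Sum>n\<in>X. (cmod (D n))\<^sup>2) = (\<Sum>n\<in>X \<inter> index_box M. (cmod (D n))\<^sup>2) + (\<Sum>n\<in>X - index_box M. (cmod (D n))\<^sup>2)"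
    using X by (simp add: sum.Int_Diff)
  also have "(\<Sum>n\<in>X \<inter> index_box M. (cmod (D n))\<^sup>2) \<le> \<kappa> ^ (2 * a) * 16 ^ m * Z * e * W"
  proof -
    have "(\<Sum>n\<in>X \<inter> index_box M. (cmod (D n))\<^sup>2) \<le> (\<Sum>n\<in>index_box M. (cmod (D n))\<^sup>2)"
      by (intro sum_mono2) auto
    also have "\<dots> \<le> (\<Sum>n\<in>index_box M. ((\<kappa> * M) ^ a * cmod (T n))\<^sup>2)"
      by (intro sum_mono power_mono D_in') auto
    also have "\<dots> = (\<kappa> * M) ^ (2 * a) * (\<Sum>n\<in>index_box M. (cmod (T n))\<^sup>2)"
      by (simp add: power_mult_distrib sum_distrib_left power_even_eq)
    also have "\<dots> \<le> (\<kappa> * M) ^ (2 * a) * ((4 / M) ^ (2 * m) * Z * W)"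
      by (intro mult_left_mono alias_bound) (simp add: \<kappa>)
    also have "\<dots> = \<kappa> ^ (2 * a) * 16 ^ m * Z * (M ^ (2 * a) * (1 / M) ^ (2 * m)) * W"
      by (simp add: power_mult_distrib power_divide power_mult)
    also have "M ^ (2 * a) * (1 / M) ^ (2 * m) = e"
    proof -
      have "2 * m = 2 * a + 2 * (m - a)" using a by simp
      hence "(1 / real M) ^ (2 * m) = (1 / M) ^ (2 * a) * e" unfolding e_def by (metis power_add)
      thus ?thesis using M0 by (simp add: power_divide)
    qed
    finally show ?thesis .
  qed
  also have "(\<Sum>n\<in>X - index_box M. (cmod (D n))\<^sup>2) \<le> \<kappa> ^ (2 * a) * 16 ^ m * e * W"
  proof -
    have "(\<Sum>n\<in>X - index_box M. (cmod (D n))\<^sup>2) \<le> (\<Sum>n\<in>X - index_box M. \<kappa> ^ (2 * a) * (2 / M) ^ (2 * (m - a)) * (sup_abs n ^ m * cmod (c n))\<^sup>2)"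
    proof (rule sum_mono)
      fix n assume "n \<in> X - index_box M"
      hence n: "n \<notin> index_box M" by simp
      have "1 \<le> 2 / M * sup_abs n" using not_index_box_sup_abs[OF n M(2)] M0 by (simp add: field_simps)
      hence "1 \<le> (2 / M * sup_abs n) ^ (m - a)" by (rule one_le_power)
      hence "sup_abs n ^ a * 1 \<le> sup_abs n ^ a * (2 / M * sup_abs n) ^ (m - a)"
        using sup_abs_nonneg[of n] by (intro mult_left_mono) auto
      also have "\<dots> = (2 / M) ^ (m - a) * (sup_abs n ^ a * sup_abs n ^ (m - a))"
          by (simp only: power_mult_distrib mult.left_commute)
      also have "sup_abs n ^ a * sup_abs n ^ (m - a) = sup_abs n ^ m" using a by (simp flip: power_add)
      finally have "\<kappa> ^ a * sup_abs n ^ a * cmod (c n) \<le> \<kappa> ^ a * ((2 / M) ^ (m - a) * sup_abs n ^ m) * cmod (c n)"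
        using \<kappa> by (intro mult_right_mono mult_left_mono) auto
      hence "cmod (D n) \<le> \<kappa> ^ a * (2 / M) ^ (m - a) * (sup_abs n ^ m * cmod (c n))"
        using D_out[OF n] by (simp add: power_mult_distrib mult_ac)
      hence "(cmod (D n))\<^sup>2 \<le> (\<kappa> ^ a * (2 / M) ^ (m - a) * (sup_abs n ^ m * cmod (c n)))\<^sup>2"
        by (intro power_mono) auto
      thus "(cmod (D n))\<^sup>2 \<le> \<kappa> ^ (2 * a) * (2 / M) ^ (2 * (m - a)) * (sup_abs n ^ m * cmod (c n))\<^sup>2"
        by (simp only: power_mult_distrib power_even_eq)
    qed
    also have "\<dots> = \<kappa> ^ (2 * a) * (2 / M) ^ (2 * (m - a)) * (\<Sum>n\<in>X - index_box M. (sup_abs n ^ m * cmod (c n))\<^sup>2)"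
      by (simp add: sum_distrib_left)
    also have "\<dots> \<le> \<kappa> ^ (2 * a) * (2 / M) ^ (2 * (m - a)) * W"
      using W X \<kappa> unfolding energy_bound_def by (intro mult_left_mono) auto
    also have "(2 / real M) ^ (2 * (m - a)) = 4 ^ (m - a) * e"
      by (simp add: e_def power_divide power_mult)
    also have "\<kappa> ^ (2 * a) * (4 ^ (m - a) * e) * W \<le> \<kappa> ^ (2 * a) * (16 ^ m * e) * W"
    proof -
      have "(4::real) ^ (m - a) \<le> 4 ^ m" by (intro power_increasing) auto
      also have "\<dots> \<le> 16 ^ m" by (intro power_mono) auto
      finally show ?thesis using \<kappa> e0 W0 by (intro mult_right_mono mult_left_mono) auto
    qed
    finally show ?thesis by (simp add: mult_ac)
  qed
  finally show ?thesis by (simp add: e_def algebra_simps)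
qed

text \<open>Writing \<open>n = r + M l\<close> with \<open>l\<close> nonzero gives
  \<open>1 / |n| \<le> 4 / (M (1 + |l|))\<close>, independently of \<open>r\<close>. Each of the
  \<open>M^d\<close> residues thus contributes at most the same lattice sum.\<close>

lemma lattice_tail_bound:
  fixes X :: "('d \<Rightarrow> int) set"
  assumes X: "finite X"
    and Z': "\<And>X :: ('d \<Rightarrow> int) set. finite X \<Longrightarrow> (\<Sum>n\<in>X. (1 / (1 + sup_abs n)) ^ (2 * s)) \<le> Z'"
  shows "(\<Sum>n\<in>X - index_box M. ((1 / sup_abs n) ^ s)\<^sup>2) \<le> real M ^ CARD('d) * (4 / M) ^ (2 * s) * Z'"
proof -
  have M0: "real M > 0" using M by simp
  \<comment> \<open>\<open>R\<close> and \<open>Q\<close> become residue and quotient of a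
    frequency; the pair determines the frequency, so reindexing by it is injective.\<close>
  have "\<forall>n :: 'd \<Rightarrow> int. \<exists>r l. r \<in> index_box M \<and> shift M r l = n"
    using index_box_decomp[OF M] by metis
  from choice[OF this] obtain R
    where "\<forall>n :: 'd \<Rightarrow> int. \<exists>l. R n \<in> index_box M \<and> shift M (R n) l = n" ..
  from choice[OF this] obtain Q
    where "\<forall>n :: 'd \<Rightarrow> int. R n \<in> index_box M \<and> shift M (R n) (Q n) = n" ..
  hence RQ: "R n \<in> index_box M" "shift M (R n) (Q n) = n" for n by blast+
  define X' where "X' = X - index_box M"
  define Y where "Y = Q ` X'"
  have Y: "finite Y" using X by (simp add: Y_def X'_def)
  define g where "g l = (4 / M) ^ (2 * s) * (1 / (1 + sup_abs l)) ^ (2 * s)" for l :: "'d \<Rightarrow> int"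
  have g0: "0 \<le> g l" for l using sup_abs_nonneg[of l] by (simp add: g_def)
  have "(\<Sum>n\<in>X'. ((1 / sup_abs n) ^ s)\<^sup>2) \<le> (\<Sum>n\<in>X'. g (snd (R n, Q n)))"
  proof (rule sum_mono)
    fix n assume n: "n \<in> X'"
    have "Q n \<noteq> (\<lambda>_. 0)"
    proof
      assume "Q n = (\<lambda>_. 0)"
      hence "shift M (R n) (Q n) = R n" by (simp add: shift_def)
      hence "n \<in> index_box M" using RQ[of n] by simp
      thus False using n by (simp add: X'_def)
    qed
    hence le: "real M * (1 + sup_abs (Q n)) \<le> 4 * sup_abs n"
      using shift_sup_abs[OF RQ(1)[of n] M(2), of "Q n"] by (simp add: RQ(2))
    have pos: "0 < real M * (1 + sup_abs (Q n))" using sup_abs_nonneg[of "Q n"] M0 by (simp add: add_pos_nonneg)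
    have "4 / (4 * sup_abs n) \<le> 4 / (real M * (1 + sup_abs (Q n)))"
      using le pos by (intro divide_left_mono mult_pos_pos[OF _ pos]) auto
    hence "1 / sup_abs n \<le> 4 / M * (1 / (1 + sup_abs (Q n)))" "0 \<le> 1 / sup_abs n"
      using sup_abs_nonneg[of n] by simp_all
    hence "(1 / sup_abs n) ^ (2 * s) \<le> (4 / M * (1 / (1 + sup_abs (Q n)))) ^ (2 * s)"
      by (intro power_mono)
    thus "((1 / sup_abs n) ^ s)\<^sup>2 \<le> g (snd (R n, Q n))"
      by (simp only: g_def snd_conv power_mult_distrib power_even_eq)
  qed
  also have "\<dots> = (\<Sum>x\<in>(\<lambda>n. (R n, Q n)) ` X'. g (snd x))"
  proof -
    have "inj_on (\<lambda>n. (R n, Q n)) X'"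
      using RQ(2) by (intro inj_on_inverseI[of _ "\<lambda>(r, l). shift M r l"]) simp
    thus ?thesis by (simp add: sum.reindex)
  qed
  also have "\<dots> \<le> (\<Sum>x\<in>(index_box M :: ('d \<Rightarrow> int) set) \<times> Y. g (snd x))"
    using Y RQ(1) g0 by (intro sum_mono2) (auto simp: Y_def)
  also have "\<dots> = (\<Sum>r\<in>(index_box M :: ('d \<Rightarrow> int) set). \<Sum>l\<in>Y. g l)"
    by (simp only: sum.cartesian_product case_prod_unfold)
  also have "\<dots> = real M ^ CARD('d) * ((4 / M) ^ (2 * s) * (\<Sum>l\<in>Y. (1 / (1 + sup_abs l)) ^ (2 * s)))"
    by (simp add: card_index_box[OF M(2)] g_def sum_distrib_left)
  also have "\<dots> \<le> real M ^ CARD('d) * ((4 / M) ^ (2 * s) * Z')"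
    by (intro mult_left_mono Z' Y) auto
  finally show ?thesis by (simp add: X'_def mult.assoc)
qed

text \<open>Cauchy-Schwarz against the constant 1 on the \<open>M^d\<close> indices of the box, and
  against \<open>|n|^(-(m - a))\<close> outside. Both parts come out of order
  \<open>M^(d/2 - (m - a))\<close>.\<close>

lemma error_sum_bound:
  assumes X: "finite X"
    and Z': "\<And>X :: ('d \<Rightarrow> int) set. finite X \<Longrightarrow> (\<Sum>n\<in>X. (1 / (1 + sup_abs n)) ^ (2 * (m - a))) \<le> Z'"
  shows "(\<Sum>n\<in>X. cmod (D n)) \<le> \<kappa> ^ a * (4 ^ m * (sqrt Z + sqrt Z')) * (sqrt (real M ^ CARD('d)) * (1 / M) ^ (m - a)) * sqrt W"
proof -
  have W0: "0 \<le> W" by (rule energy_bound_nonneg[OF W])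
  have Z'0: "0 \<le> Z'" using Z'[of "{}"] by simp
  have M0: "real M > 0" using M by simp
  let ?s = "m - a"
  define q where "q = sqrt (real M ^ CARD('d)) * (1 / M) ^ ?s"
  have q0: "0 \<le> q" by (simp add: q_def)
  have "(\<Sum>n\<in>X. cmod (D n)) = (\<Sum>n\<in>X \<inter> index_box M. cmod (D n)) + (\<Sum>n\<in>X - index_box M. cmod (D n))"
    using X by (simp add: sum.Int_Diff)
  also have "(\<Sum>n\<in>X \<inter> index_box M. cmod (D n)) \<le> \<kappa> ^ a * (4 ^ m * sqrt Z) * q * sqrt W"
  proof -
    have "(\<Sum>n\<in>X \<inter> index_box M. cmod (D n)) \<le> (\<Sum>n\<in>index_box M. cmod (D n))"
      by (intro sum_mono2) auto
    also have "\<dots> \<le> (\<Sum>n\<in>index_box M. (\<kappa> * M) ^ a * (1 * cmod (T n)))"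
      using D_in' by (intro sum_mono) auto
    also have "\<dots> = (\<kappa> * M) ^ a * (\<Sum>n\<in>index_box M. 1 * cmod (T n))"
      by (simp only: sum_distrib_left)
    also have "\<dots> \<le> (\<kappa> * M) ^ a * (sqrt (real M ^ CARD('d)) * sqrt ((4 / M) ^ (2 * m) * Z * W))"
      by (intro mult_left_mono sum_mult_le_sqrt alias_bound) (auto simp: card_index_box[OF M(2)] \<kappa>)
    also have "sqrt ((4 / M) ^ (2 * m) * Z * W) = (4 / M) ^ m * sqrt Z * sqrt W"
      by (simp add: real_sqrt_mult power_even_eq)
    also have "(\<kappa> * M) ^ a * (sqrt (real M ^ CARD('d)) * ((4 / M) ^ m * sqrt Z * sqrt W))
       = \<kappa> ^ a * (4 ^ m * sqrt Z) * (sqrt (real M ^ CARD('d)) * (M ^ a * (1 / M) ^ m)) * sqrt W"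
      by (simp add: power_mult_distrib power_divide)
    also have "M ^ a * (1 / M) ^ m = (1 / real M) ^ ?s"
    proof -
      have "m = a + ?s" using a by simp
      hence "(1 / real M) ^ m = (1 / M) ^ a * (1 / M) ^ ?s" by (metis power_add)
      thus ?thesis using M0 by (simp add: power_divide)
    qed
    finally show ?thesis by (simp add: q_def)
  qed
  also have "(\<Sum>n\<in>X - index_box M. cmod (D n)) \<le> \<kappa> ^ a * (4 ^ m * sqrt Z') * q * sqrt W"
  proof -
    have "(\<Sum>n\<in>X - index_box M. cmod (D n))
        \<le> (\<Sum>n\<in>X - index_box M. \<kappa> ^ a * ((1 / sup_abs n) ^ ?s * (sup_abs n ^ m * cmod (c n))))"
    proof (rule sum_mono)
      fix n assume "n \<in> X - index_box M"
      hence n: "n \<notin> index_box M" by simp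
      have "0 < sup_abs n" using not_index_box_sup_abs[OF n M(2)] M0 by linarith
      hence "sup_abs n ^ a = (1 / sup_abs n) ^ ?s * (sup_abs n ^ ?s * sup_abs n ^ a)"
        by (simp add: power_divide)
      also have "sup_abs n ^ ?s * sup_abs n ^ a = sup_abs n ^ m" using a by (simp flip: power_add)
      finally show "cmod (D n) \<le> \<kappa> ^ a * ((1 / sup_abs n) ^ ?s * (sup_abs n ^ m * cmod (c n)))"
        using D_out[OF n] by (simp add: power_mult_distrib mult.assoc)
    qed
    also have "\<dots> = \<kappa> ^ a * (\<Sum>n\<in>X - index_box M. (1 / sup_abs n) ^ ?s * (sup_abs n ^ m * cmod (c n)))"
      by (simp only: sum_distrib_left)
    also have "\<dots> \<le> \<kappa> ^ a * (sqrt (real M ^ CARD('d) * (4 / M) ^ (2 * ?s) * Z') * sqrt W)"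
      using W X \<kappa> unfolding energy_bound_def
      by (intro mult_left_mono sum_mult_le_sqrt(1) lattice_tail_bound Z') auto
    also have "sqrt (real M ^ CARD('d) * (4 / M) ^ (2 * ?s) * Z') = 4 ^ ?s * sqrt Z' * q"
    proof -
      have "sqrt ((4 / real M) ^ (2 * ?s)) = (4 / M) ^ ?s" by (simp only: power_even_eq real_sqrt_abs) simp
      thus ?thesis unfolding real_sqrt_mult q_def by (simp add: power_divide)
    qed
    also have "\<kappa> ^ a * (4 ^ ?s * sqrt Z' * q * sqrt W) \<le> \<kappa> ^ a * (4 ^ m * sqrt Z' * q * sqrt W)"
    proof -
      have "(4::real) ^ ?s \<le> 4 ^ m" by (intro power_increasing) auto
      thus ?thesis using \<kappa> q0 W0 Z'0 by (intro mult_right_mono mult_left_mono) auto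
    qed
    finally show ?thesis by (simp add: mult_ac)
  qed
  finally show ?thesis by (simp add: q_def algebra_simps)
qed

end

end

section \<open>The error of the kernel truncation method\<close>

definition mi_list :: "('d::{finite,linorder} \<Rightarrow> nat) \<Rightarrow> 'd list" where
  "mi_list \<alpha> = concat (map (\<lambda>i. replicate (\<alpha> i) i) (sorted_list_of_set UNIV))"

lemma foldr_partial_replicate: "foldr partial (replicate k i) f = (partial i ^^ k) f"
  by (induction k) auto

lemma multi_partial_eq: "multi_partial \<alpha> f = foldr partial (mi_list \<alpha>) f"
proof -
  have "foldr (\<lambda>i g. (partial i ^^ \<alpha> i) g) xs f = foldr partial (concat (map (\<lambda>i. replicate (\<alpha> i) i) xs)) f" for xs
    by (induction xs) (auto simp: foldr_partial_replicate)
  thus ?thesis by (simp add: multi_partial_def mi_list_def)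
qed

lemma length_mi_list: "length (mi_list \<alpha>) = mi_size \<alpha>"
proof -
  have "distinct xs \<Longrightarrow> length (concat (map (\<lambda>i. replicate (\<alpha> i) i) xs)) = (\<Sum>i\<in>set xs. \<alpha> i)" for xs
    by (induction xs) auto
  from this[of "sorted_list_of_set UNIV"] show ?thesis by (simp add: mi_list_def mi_size_def)
qed

lemma mi_list_single: "mi_list (\<lambda>i. if i = j then m else 0) = replicate m j"
proof -
  have "distinct xs \<Longrightarrow> concat (map (\<lambda>i. replicate (if i = j then m else 0) i) xs) = (if j \<in> set xs then replicate m j else [])" for xs
    by (induction xs) auto
  from this[of "sorted_list_of_set UNIV"] show ?thesis by (simp add: mi_list_def)
qed

lemma finite_mi_size: "finite {\<alpha> :: 'd::finite \<Rightarrow> nat. mi_size \<alpha> = m}"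
proof (rule finite_subset)
  show "{\<alpha> :: 'd \<Rightarrow> nat. mi_size \<alpha> = m} \<subseteq> PiE UNIV (\<lambda>_. {..m})"
    unfolding mi_size_def by (auto simp: PiE_def intro!: member_le_sum)
qed (intro finite_PiE, auto)

text \<open>The error is known to equal a continuous series only on the cube, so \<open>f\<close>
  has to agree with \<open>g\<close> just there; measurability and integrability come from
  \<open>g\<close>.\<close>

lemma L2_norm_continuous:
  fixes f g :: "real^'d \<Rightarrow> complex"
  assumes g: "continuous_on UNIV g" and eq: "\<And>x. x \<in> cube a \<Longrightarrow> f x = g x"
  shows "L2_norm (cube a) f = ereal (sqrt (LINT x|lebesgue. indicator (cube a) x * (cmod (g x))\<^sup>2))"
proof -
  have e1: "(\<lambda>x. indicat_real (cube a) x *\<^sub>R f x) = (\<lambda>x. indicator (cube a) x * g x)"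
    and e2: "(\<lambda>x. indicat_real (cube a) x *\<^sub>R (cmod (f x))\<^sup>2) = (\<lambda>x. indicator (cube a) x * (cmod (g x))\<^sup>2)"
    using eq by (auto simp: indicator_def)
  have "set_borel_measurable lebesgue (cube a) f"
    unfolding set_borel_measurable_def e1 by (rule borel_measurable_integrable[OF integrable_cube_continuous[OF g]])
  moreover have "set_integrable lebesgue (cube a) (\<lambda>x. (cmod (f x))\<^sup>2)"
    unfolding set_integrable_def e2 by (intro integrable_cube_continuous_real continuous_intros g)
  ultimately show ?thesis
    unfolding L2_norm_def set_lebesgue_integral_def e2 by simp
qed

lemma Linf_norm_le:
  fixes f g :: "real^'d \<Rightarrow> complex"
  assumes g: "continuous_on UNIV g" and eq: "\<And>x. x \<in> cube a \<Longrightarrow> f x = g x"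
    and B: "\<And>x. x \<in> cube a \<Longrightarrow> cmod (g x) \<le> B"
  shows "Linf_norm (cube a) f \<le> ereal B"
  unfolding Linf_norm_def
proof (rule esssup_I)
  have "(\<lambda>x. ereal (cmod (g x))) \<in> borel_measurable lebesgue"
    using continuous_measurable_lebesgue[OF g] by measurable
  hence "(\<lambda>x. ereal (cmod (g x))) \<in> borel_measurable (restrict_space lebesgue (cube a))"
    by (rule measurable_restrict_space1)
  thus "(\<lambda>x. ereal (cmod (f x))) \<in> borel_measurable (restrict_space lebesgue (cube a))"
    by (rule measurable_cong[THEN iffD1, rotated]) (simp add: space_restrict_space eq)
  show "AE x in restrict_space lebesgue (cube a). ereal (cmod (f x)) \<le> ereal B"
    by (rule AE_I2) (simp add: space_restrict_space eq B)
qed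

lemma sobolev_seminorm_nonneg: "0 \<le> sobolev_seminorm m A \<rho>"
  unfolding sobolev_seminorm_def by (intro real_sqrt_ge_zero sum_nonneg) simp

text \<open>The largest coordinate of \<open>n\<close> is dominated by the sum over all coordinates,
  so the pure derivatives of order \<open>m\<close> suffice; their multi-indices are some of those
  in the seminorm.\<close>

lemma energy_bound_sobolev:
  fixes \<rho> :: "real^'d::{finite,linorder} \<Rightarrow> complex"
  assumes \<rho>: "test_fun L \<rho>" and LH: "L \<le> H" and H: "0 < H" and m: "0 < m"
  shows "energy_bound m (fourier_coeff H \<rho>)
     (1 / ((pi / H) ^ (2 * m) * (2 * H) ^ CARD('d)) * (sobolev_seminorm m (cube L) \<rho>)\<^sup>2)"
  unfolding energy_bound_def
proof (intro allI impI)
  fix X :: "('d \<Rightarrow> int) set" assume X: "finite X"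
  let ?c = "fourier_coeff H \<rho>"
  define K where "K = (pi / H) ^ (2 * m) * (2 * H) ^ CARD('d)"
  have K: "0 < K" using H by (simp add: K_def)
  define \<beta> where "\<beta> j = (\<lambda>i. if i = j then m else 0)" for j :: 'd
  define Q where "Q \<alpha> = (real_of_ereal (L2_norm (cube L) (multi_partial \<alpha> \<rho>)))\<^sup>2" for \<alpha>
  have dir: "K * (\<Sum>n\<in>X. (real_of_int \<bar>n j\<bar> ^ m * cmod (?c n))\<^sup>2) \<le> Q (\<beta> j)" for j
  proof -
    let ?g = "foldr partial (replicate m j) \<rho>"
    have g: "test_fun L ?g" by (rule test_fun_foldr_partial[OF \<rho>])
    have mp: "multi_partial (\<beta> j) \<rho> = ?g" unfolding multi_partial_eq \<beta>_def mi_list_single ..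
    have "(cmod (fourier_coeff H ?g n))\<^sup>2 = (pi / H) ^ (2 * m) * (real_of_int \<bar>n j\<bar> ^ m * cmod (?c n))\<^sup>2" for n
      unfolding fourier_coeff_foldr_partial[OF H \<rho>] norm_mult norm_symbol_replicate[OF H]
      by (simp only: power_mult_distrib power_even_eq mult.assoc)
    hence "K * (\<Sum>n\<in>X. (real_of_int \<bar>n j\<bar> ^ m * cmod (?c n))\<^sup>2)
        = (\<Sum>n\<in>X. (cmod (fourier_coeff H ?g n))\<^sup>2) * (2 * H) ^ CARD('d)"
      by (simp add: K_def sum_distrib_left sum_distrib_right mult_ac)
    also have "\<dots> \<le> (LINT y|lebesgue. indicator (cube H) y * (cmod (?g y))\<^sup>2)"
      by (rule bessel_inequality[OF g LH H X])
    also have "\<dots> = (LINT y|lebesgue. indicator (cube L) y * (cmod (?g y))\<^sup>2)"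
      using test_fun_mem_cube[OF g LH] test_fun_mem_cube[OF g order_refl]
      by (intro Bochner_Integration.integral_cong refl) (auto simp: indicator_def)
    also have "\<dots> = Q (\<beta> j)"
      unfolding Q_def mp L2_norm_continuous[OF test_fun_continuous[OF g] refl] by (simp add: indicator_def)
    finally show ?thesis .
  qed
  have "(sup_abs n ^ m * cmod (?c n))\<^sup>2 \<le> (\<Sum>j\<in>UNIV. (real_of_int \<bar>n j\<bar> ^ m * cmod (?c n))\<^sup>2)" for n
  proof -
    obtain j where "sup_abs n = real_of_int \<bar>n j\<bar>" by (rule sup_abs_attained)
    thus ?thesis using member_le_sum[of j UNIV "\<lambda>j. (real_of_int \<bar>n j\<bar> ^ m * cmod (?c n))\<^sup>2"] by simp
  qed
  hence "(\<Sum>n\<in>X. (sup_abs n ^ m * cmod (?c n))\<^sup>2) \<le> (\<Sum>n\<in>X. \<Sum>j\<in>UNIV. (real_of_int \<bar>n j\<bar> ^ m * cmod (?c n))\<^sup>2)"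
    by (rule sum_mono)
  also have "\<dots> = (\<Sum>j\<in>UNIV. \<Sum>n\<in>X. (real_of_int \<bar>n j\<bar> ^ m * cmod (?c n))\<^sup>2)" by (rule sum.swap)
  finally have "K * (\<Sum>n\<in>X. (sup_abs n ^ m * cmod (?c n))\<^sup>2)
      \<le> K * (\<Sum>j\<in>UNIV. \<Sum>n\<in>X. (real_of_int \<bar>n j\<bar> ^ m * cmod (?c n))\<^sup>2)"
    using K by (intro mult_left_mono) auto
  also have "\<dots> \<le> (\<Sum>j\<in>UNIV. Q (\<beta> j))" by (subst sum_distrib_left) (intro sum_mono dir)
  also have "\<dots> = (\<Sum>\<alpha>\<in>range \<beta>. Q \<alpha>)"
  proof -
    \<comment> \<open>For \<open>m = 0\<close> all pure multi-indices would coincide and one term of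
      the seminorm would be counted \<open>d\<close> times.\<close>
    have "inj \<beta>"
    proof (rule injI)
      fix i j assume "\<beta> i = \<beta> j"
      hence "\<beta> i i = \<beta> j i" by simp
      thus "i = j" using m by (simp add: \<beta>_def split: if_splits)
    qed
    thus ?thesis by (simp add: sum.reindex)
  qed
  also have "\<dots> \<le> (\<Sum>\<alpha> | mi_size \<alpha> = m. Q \<alpha>)"
    by (intro sum_mono2 finite_mi_size) (auto simp: \<beta>_def mi_size_def Q_def)
  also have "\<dots> = (sobolev_seminorm m (cube L) \<rho>)\<^sup>2"
    unfolding sobolev_seminorm_def Q_def by (subst real_sqrt_pow2) (auto intro: sum_nonneg)
  finally show "(\<Sum>n\<in>X. (sup_abs n ^ m * cmod (?c n))\<^sup>2)
      \<le> 1 / ((pi / H) ^ (2 * m) * (2 * H) ^ CARD('d)) * (sobolev_seminorm m (cube L) \<rho>)\<^sup>2"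
    unfolding K_def[symmetric] using K by (simp add: field_simps)
qed

lemma energy_bound_zero_imp:
  assumes e: "energy_bound m c 0" and k: "0 < k"
  shows "energy_bound k c 0"
  unfolding energy_bound_def
proof (intro allI impI)
  fix X :: "('a \<Rightarrow> int) set" assume "finite X"
  have zero: "sup_abs n ^ k * cmod (c n) = 0" for n
  proof (cases "n = (\<lambda>_. 0)")
    case True
    have "sup_abs n \<le> 0" by (rule sup_abs_le) (simp add: True)
    hence "sup_abs n = 0" using sup_abs_nonneg[of n] by linarith
    thus ?thesis using k by simp
  next
    case False
    have "(\<Sum>n\<in>{n}. (sup_abs n ^ m * cmod (c n))\<^sup>2) \<le> 0" using e unfolding energy_bound_def by blast
    hence "sup_abs n ^ m * cmod (c n) = 0" by simp
    thus ?thesis using sup_abs_ge_1[OF False] by simp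
  qed
  show "(\<Sum>n\<in>X. (sup_abs n ^ k * cmod (c n))\<^sup>2) \<le> 0" unfolding zero by simp
qed

section \<open>The error as a convolution with the truncated kernel\<close>

definition kernel_ball :: "real \<Rightarrow> (real^'d \<Rightarrow> complex) \<Rightarrow> real^'d \<Rightarrow> complex" where
  "kernel_ball L U y = indicator (ball 0 (2 * sqrt (real CARD('d)) * L)) y * U y"

lemma integrable_kernel_ball:
  fixes U :: "real^'d \<Rightarrow> complex"
  assumes "locally_integrable U" shows "integrable lebesgue (kernel_ball L U)"
proof -
  let ?r = "2 * sqrt (real CARD('d)) * L"
  have "integrable lebesgue (\<lambda>y. indicat_real (ball 0 ?r) y *\<^sub>R (indicator (cball 0 ?r) y * U y))"
    by (intro integrable_mult_indicator locally_integrable_indicator assms compact_cball) auto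
  moreover have "indicat_real (ball 0 ?r) y *\<^sub>R (indicator (cball 0 ?r) y * U y) = kernel_ball L U y" for y
    by (auto simp: kernel_ball_def indicator_def)
  ultimately show ?thesis by simp
qed

context
  fixes L H :: real and N M :: nat and \<rho> U :: "real^'d::{finite,linorder} \<Rightarrow> complex"
  assumes L: "0 < L" and N: "0 < N" "even N"
    and H_def: "H = real (pad_factor CARD('d)) * L" and M_def: "M = pad_factor CARD('d) * N"
    and \<rho>: "test_fun L \<rho>" and U: "locally_integrable U"
begin

lemma ktm_error_series:
  assumes x: "x \<in> cube L"
  shows "ktm_error U L N \<alpha> \<rho> x = trig_series H (\<lambda>n. err_coeff L H N M \<rho> (mi_list \<alpha>) n *
     (LINT y|lebesgue. kernel_ball L U y * cnj (mode H n y))) x"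
proof -
  note cx = L N H_def M_def \<rho>
  have H: "0 < H" by (rule H_pos[OF cx])
  let ?W = "kernel_ball L U" and ?D = "err_coeff L H N M \<rho> (mi_list \<alpha>)"
  let ?r = "2 * sqrt (real CARD('d)) * L"
  let ?g = "foldr partial (mi_list \<alpha>) \<rho>" and ?h = "foldr partial (mi_list \<alpha>) (fourier_interpolant L N \<rho>)"
  have g: "test_fun L ?g" by (rule test_fun_foldr_partial[OF \<rho>])
  note W = integrable_kernel_ball[OF U, of L]
  note D = err_coeff_summable[OF cx, of "mi_list \<alpha>"]
  have diffc: "continuous_on UNIV (\<lambda>y. f (x - y))" if "continuous_on UNIV f" for f :: "(real, 'd) vec \<Rightarrow> complex"
    by (rule continuous_on_compose2[OF that]) (auto intro!: continuous_intros)
  have "multi_partial \<alpha> (potential U \<rho>) x = potential U ?g x"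
    unfolding multi_partial_eq foldr_partial_potential[OF U \<rho>] ..
  also have "\<dots> = (LINT y|lebesgue. U y * ?g (x - y))" by (rule potential_eq[OF U g])
  \<comment> \<open>Truncation does not change the exact potential: where the density is nonzero,
    all coordinates of \<open>y\<close> are below \<open>2 * L\<close>, so \<open>y\<close> lies in
    the ball.\<close>
  also have "\<dots> = (LINT y|lebesgue. ?W y * ?g (x - y))"
  proof (intro Bochner_Integration.integral_cong refl)
    fix y
    show "U y * ?g (x - y) = ?W y * ?g (x - y)"
    proof (cases "?g (x - y) = 0")
      case False
      have yj: "\<bar>y $ j\<bar> < 2 * L" for j
        using test_funD(2)[OF g False, of j] x[unfolded mem_cube, rule_format, of j] by simp
      have sq: "(y $ j)\<^sup>2 < (2 * L)\<^sup>2" for j using power_strict_mono[OF yj[of j], of 2] by simp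
      have "(norm y)\<^sup>2 = (\<Sum>j\<in>UNIV. (y $ j)\<^sup>2)" by (simp add: norm_vec_def L2_set_def sum_nonneg)
      also have "\<dots> < (\<Sum>j\<in>(UNIV :: 'd set). (2 * L)\<^sup>2)"
        using sq by (intro sum_strict_mono) auto
      also have "\<dots> = ?r\<^sup>2" by (simp add: power_mult_distrib)
      finally have "norm y < ?r" using L by (intro power2_less_imp_less[of "norm y"]) auto
      thus ?thesis by (simp add: kernel_ball_def)
    qed simp
  qed
  finally have pot: "multi_partial \<alpha> (potential U \<rho>) x = (LINT y|lebesgue. ?W y * ?g (x - y))" .
  \<comment> \<open>For \<open>y\<close> in the ball the derivative of the interpolant is that of
    the density minus the error series; elsewhere both integrands are zero.\<close>
  have "ktm_approx U L N \<alpha> \<rho> x = (LINT y|lebesgue. ?W y * ?g (x - y) - ?W y * trig_series H ?D (x - y))"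
    unfolding ktm_approx_def set_lebesgue_integral_def multi_partial_eq
  proof (intro Bochner_Integration.integral_cong refl)
    fix y
    show "indicat_real (ball 0 ?r) y *\<^sub>R (U y * ?h (x - y)) = ?W y * ?g (x - y) - ?W y * trig_series H ?D (x - y)"
    proof (cases "y \<in> ball 0 ?r")
      case True
      have "\<bar>(x - y) $ j\<bar> < 2 * H - L" for j
      proof -
        have "\<bar>y $ j\<bar> < ?r" using component_le_norm_cart[of y j] True by simp
        moreover have "\<bar>x $ j\<bar> \<le> L" using x by (simp add: mem_cube)
        \<comment> \<open>With \<open>H = S L\<close> this is equivalent to
          \<open>S \<ge> sqrt d + 1\<close>: the padding factor is exactly what the ball
          requires.\<close>
        moreover have "?r + L \<le> 2 * H - L"
        proof -
          have "2 * L * (sqrt (real CARD('d)) + 1) \<le> 2 * L * real (pad_factor CARD('d))"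
            using L pad_factor_ge[OF cx] by (intro mult_left_mono) auto
          thus ?thesis by (simp add: H_def algebra_simps)
        qed
        ultimately show ?thesis by (simp add: abs_le_iff abs_less_iff)
      qed
      hence "trig_series H ?D (x - y) = ?g (x - y) - ?h (x - y)" by (rule err_coeff_series[OF cx])
      thus ?thesis using True by (simp add: kernel_ball_def right_diff_distrib)
    qed (simp add: kernel_ball_def)
  qed
  also have "\<dots> = (LINT y|lebesgue. ?W y * ?g (x - y)) - (LINT y|lebesgue. ?W y * trig_series H ?D (x - y))"
  proof (rule Bochner_Integration.integral_diff)
    obtain B where "\<And>z. cmod (?g z) \<le> B" using test_fun_bounded[OF g] by blast
    thus "integrable lebesgue (\<lambda>y. ?W y * ?g (x - y))"
      by (intro integrable_mult_bounded[OF W continuous_measurable_lebesgue[OF diffc[OF test_fun_continuous[OF g]]]])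
    show "integrable lebesgue (\<lambda>y. ?W y * trig_series H ?D (x - y))"
      by (rule integrable_mult_bounded[OF W continuous_measurable_lebesgue[OF diffc[OF trig_series_continuous[OF H D]]]
            trig_series_bounded[OF H D]])
  qed
  finally have "ktm_error U L N \<alpha> \<rho> x = (LINT y|lebesgue. ?W y * trig_series H ?D (x - y))"
    unfolding ktm_error_def pot by simp
  moreover have "((\<lambda>n. ?D n * (LINT y|lebesgue. ?W y * mode H n (x - y))) has_sum
      (LINT y|lebesgue. ?W y * trig_series H ?D (x - y))) UNIV"
    unfolding trig_series_def
    by (rule has_sum_integral_mult_series(4)[OF W _ _ D]) (auto intro: diffc continuous_on_mode)
  moreover have "(LINT y|lebesgue. ?W y * mode H n (x - y)) = mode H n x * (LINT y|lebesgue. ?W y * cnj (mode H n y))" for n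
  proof -
    have "(LINT y|lebesgue. ?W y * mode H n (x - y)) = (LINT y|lebesgue. mode H n x * (?W y * cnj (mode H n y)))"
      by (simp add: mode_diff mult_ac)
    thus ?thesis by simp
  qed
  ultimately have "((\<lambda>n. ?D n * (LINT y|lebesgue. ?W y * cnj (mode H n y)) * mode H n x) has_sum ktm_error U L N \<alpha> \<rho> x) UNIV"
    by (simp add: mult_ac)
  thus ?thesis unfolding trig_series_def by (simp add: infsumI)
qed

lemma norm_kernel_coeff_le:
  "cmod (LINT y|lebesgue. kernel_ball L U y * cnj (mode H n y)) \<le> (LINT y|lebesgue. cmod (kernel_ball L U y))"
proof -
  have "cmod (LINT y|lebesgue. kernel_ball L U y * cnj (mode H n y))
      \<le> (LINT y|lebesgue. cmod (kernel_ball L U y * cnj (mode H n y)))" by (rule integral_norm_bound)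
  thus ?thesis by (simp add: norm_mult)
qed

text \<open>Each convolution multiplier has modulus at most \<open>V\<close>. For the mean square
  the integral is enlarged from \<open>cube L\<close> to the period cube \<open>cube H\<close>,
  where Parseval applies.\<close>

lemma ktm_error_norm_bounds:
  fixes \<alpha> :: "'d \<Rightarrow> nat"
  defines "D \<equiv> err_coeff L H N M \<rho> (mi_list \<alpha>)" and "V \<equiv> (LINT y|lebesgue. cmod (kernel_ball L U y))"
  shows "(\<And>X. finite X \<Longrightarrow> (\<Sum>n\<in>X. cmod (D n)) \<le> B) \<Longrightarrow> Linf_norm (cube L) (ktm_error U L N \<alpha> \<rho>) \<le> ereal (V * B)"
    and "(\<And>X. finite X \<Longrightarrow> (\<Sum>n\<in>X. (cmod (D n))\<^sup>2) \<le> B) \<Longrightarrow>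
       L2_norm (cube L) (ktm_error U L N \<alpha> \<rho>) \<le> ereal (V * sqrt ((2 * H) ^ CARD('d)) * sqrt B)"
proof -
  note cx = L N H_def M_def \<rho>
  have H: "0 < H" by (rule H_pos[OF cx])
  have LH: "L < H" by (rule L_less_H[OF cx])
  define E where "E n = D n * (LINT y|lebesgue. kernel_ball L U y * cnj (mode H n y))" for n
  have V0: "0 \<le> V" unfolding V_def by simp
  have E: "cmod (E n) \<le> V * cmod (D n)" for n
    unfolding E_def norm_mult V_def using mult_left_mono[OF norm_kernel_coeff_le, of "cmod (D n)" n]
    by (simp add: mult.commute)
  have Es: "(\<lambda>n. cmod (E n)) summable_on UNIV"
    by (rule summable_on_comparison_test[OF summable_on_cmult_right[OF err_coeff_summable[OF cx, of "mi_list \<alpha>"], of V]])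
       (use E in \<open>auto simp: D_def\<close>)
  have err: "ktm_error U L N \<alpha> \<rho> x = trig_series H E x" if "x \<in> cube L" for x
    using ktm_error_series[OF that, of \<alpha>] unfolding E_def D_def .
  note Ec = trig_series_continuous[OF H Es]
  {
    assume B: "\<And>X. finite X \<Longrightarrow> (\<Sum>n\<in>X. cmod (D n)) \<le> B"
    have "(\<Sum>\<^sub>\<infinity>n. cmod (E n)) \<le> V * B"
    proof (rule infsum_le_finite_sums[OF Es])
      fix X :: "('d \<Rightarrow> int) set" assume X: "finite X"
      have "(\<Sum>n\<in>X. cmod (E n)) \<le> (\<Sum>n\<in>X. V * cmod (D n))" by (intro sum_mono E)
      also have "\<dots> \<le> V * B" unfolding sum_distrib_left[symmetric] by (intro mult_left_mono B X V0)
      finally show "(\<Sum>n\<in>X. cmod (E n)) \<le> V * B" .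
    qed
    hence b: "cmod (trig_series H E x) \<le> V * B" for x
      using trig_series_bounded[OF H Es, of x] by linarith
    show "Linf_norm (cube L) (ktm_error U L N \<alpha> \<rho>) \<le> ereal (V * B)"
      by (rule Linf_norm_le[OF Ec err b])
  next
    assume B: "\<And>X. finite X \<Longrightarrow> (\<Sum>n\<in>X. (cmod (D n))\<^sup>2) \<le> B"
    let ?P = "(2 * H) ^ CARD('d)"
    have "(LINT x|lebesgue. indicator (cube L) x * (cmod (trig_series H E x))\<^sup>2)
       \<le> (LINT x|lebesgue. indicator (cube H) x * (cmod (trig_series H E x))\<^sup>2)"
    proof (rule integral_mono)
      have int: "integrable lebesgue (\<lambda>x. indicator (cube a) x * (cmod (trig_series H E x))\<^sup>2)" for a
        by (intro integrable_cube_continuous_real continuous_intros Ec)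
      show "integrable lebesgue (\<lambda>x. indicator (cube L) x * (cmod (trig_series H E x))\<^sup>2)"
        and "integrable lebesgue (\<lambda>x. indicator (cube H) x * (cmod (trig_series H E x))\<^sup>2)"
        by (rule int)+
      fix x :: "(real, 'd) vec"
      have "x \<in> cube L \<Longrightarrow> x \<in> cube H" using LH unfolding mem_cube by (meson less_imp_le order_trans)
      thus "indicator (cube L) x * (cmod (trig_series H E x))\<^sup>2 \<le> indicator (cube H) x * (cmod (trig_series H E x))\<^sup>2"
        by (simp add: indicator_def)
    qed
    also have "\<dots> \<le> V\<^sup>2 * ?P * B"
    proof (rule has_sum_le_finite_sums[OF trig_series_L2[OF H Es]])
      fix X :: "('d \<Rightarrow> int) set" assume X: "finite X"
      have "(\<Sum>n\<in>X. (cmod (E n))\<^sup>2 * ?P) \<le> (\<Sum>n\<in>X. (V * cmod (D n))\<^sup>2 * ?P)"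
        using E H by (intro sum_mono mult_right_mono power_mono) auto
      also have "\<dots> = V\<^sup>2 * ?P * (\<Sum>n\<in>X. (cmod (D n))\<^sup>2)"
        by (simp add: power_mult_distrib sum_distrib_left mult_ac)
      also have "\<dots> \<le> V\<^sup>2 * ?P * B" using H by (intro mult_left_mono B X) auto
      finally show "(\<Sum>n\<in>X. (cmod (E n))\<^sup>2 * ?P) \<le> V\<^sup>2 * ?P * B" .
    qed
    finally have "sqrt (LINT x|lebesgue. indicator (cube L) x * (cmod (trig_series H E x))\<^sup>2) \<le> sqrt (V\<^sup>2 * ?P * B)"
      by (rule real_sqrt_le_mono)
    also have "\<dots> = V * sqrt ?P * sqrt B" using V0 by (simp add: real_sqrt_mult)
    finally have le: "sqrt (LINT x|lebesgue. indicator (cube L) x * (cmod (trig_series H E x))\<^sup>2) \<le> V * sqrt ?P * sqrt B" .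
    have "L2_norm (cube L) (ktm_error U L N \<alpha> \<rho>)
        = ereal (sqrt (LINT x|lebesgue. indicator (cube L) x * (cmod (trig_series H E x))\<^sup>2))"
      by (rule L2_norm_continuous[OF Ec err])
    also have "\<dots> \<le> ereal (V * sqrt ?P * sqrt B)" using le by (simp only: ereal_less_eq)
    finally show "L2_norm (cube L) (ktm_error U L N \<alpha> \<rho>) \<le> ereal (V * sqrt ?P * sqrt B)" .
  }
qed

lemma err_coeff_bounds:
  "n \<in> index_box M \<Longrightarrow> cmod (err_coeff L H N M \<rho> is n)
     \<le> (pi / H * sup_abs n) ^ length is * cmod (dft L H N \<rho> n - fourier_coeff H \<rho> n)"
  "n \<notin> index_box M \<Longrightarrow> cmod (err_coeff L H N M \<rho> is n) \<le> (pi / H * sup_abs n) ^ length is * cmod (fourier_coeff H \<rho> n)"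
proof -
  note cx = L N H_def M_def \<rho>
  note s = norm_symbol_le[OF H_pos[OF cx], of "is" n]
  show "n \<in> index_box M \<Longrightarrow> cmod (err_coeff L H N M \<rho> is n)
     \<le> (pi / H * sup_abs n) ^ length is * cmod (dft L H N \<rho> n - fourier_coeff H \<rho> n)"
    using mult_right_mono[OF s, of "cmod (dft L H N \<rho> n - fourier_coeff H \<rho> n)"]
    by (simp add: err_coeff_def[OF cx] norm_mult norm_minus_commute)
  show "n \<notin> index_box M \<Longrightarrow> cmod (err_coeff L H N M \<rho> is n) \<le> (pi / H * sup_abs n) ^ length is * cmod (fourier_coeff H \<rho> n)"
    using mult_right_mono[OF s, of "cmod (fourier_coeff H \<rho> n)"]
    by (simp add: err_coeff_def[OF cx] norm_mult)
qed

end

section \<open>Convergence rates\<close>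

lemma sqrt_power_mult_powr:
  assumes "0 < x" shows "sqrt (x ^ d) * (1 / x) ^ s = x powr - (real s - real d / 2)"
proof -
  have "sqrt (x ^ d) = x powr (real d / 2)"
    using assms by (simp add: powr_half_sqrt[symmetric] powr_realpow[symmetric] powr_powr)
  moreover have "(1 / x) ^ s = x powr - real s"
    using assms by (simp add: powr_minus powr_realpow power_one_over inverse_eq_divide)
  ultimately have "sqrt (x ^ d) * (1 / x) ^ s = x powr (real d / 2 + - real s)"
    by (simp only: powr_add)
  thus ?thesis by (simp add: algebra_simps)
qed

context
  fixes U :: "real^'d::{finite,linorder} \<Rightarrow> complex" and L :: real and m :: nat and \<alpha> :: "'d \<Rightarrow> nat"
  assumes L: "0 < L" and U: "locally_integrable U" and m: "real CARD('d) / 2 < real m"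
begin

lemma lattice_constant:
  obtains Z where "0 < Z" "\<And>X :: ('d \<Rightarrow> int) set. finite X \<Longrightarrow> (\<Sum>n\<in>X. (1 / (1 + sup_abs n)) ^ (2 * m)) \<le> Z"
proof -
  have "real CARD('d) < real (2 * m)" using m by simp
  thus ?thesis by (rule lattice_sum_bounded) (rule that)
qed

text \<open>The energy \<open>W\<close> stays a parameter, so that the same bound can be used at
  order \<open>m\<close> with the seminorm and at a higher order with a constant depending on the
  density.\<close>

lemma ktm_Linf_uniform:
  assumes a: "real (mi_size \<alpha>) + real CARD('d) / 2 < real m"
  shows "\<exists>c>0. \<forall>\<rho> N W. test_fun L \<rho> \<and> 0 < N \<and> even N \<and> energy_bound m (fourier_coeff (real (pad_factor CARD('d)) * L) \<rho>) W \<longrightarrow>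
     Linf_norm (cube L) (ktm_error U L N \<alpha> \<rho>)
       \<le> ereal (c * real N powr - (real m - real CARD('d) / 2 - real (mi_size \<alpha>)) * sqrt W)"
proof -
  let ?a = "mi_size \<alpha>"
  define H where "H = real (pad_factor CARD('d)) * L"
  define V where "V = (LINT y|lebesgue. cmod (kernel_ball L U y))"
  have am: "?a \<le> m"
  proof -
    have "real ?a \<le> real m" using a by (smt (verit) divide_nonneg_nonneg of_nat_0_le_iff)
    thus ?thesis by simp
  qed
  obtain Z where Z: "0 < Z" "\<And>X :: ('d \<Rightarrow> int) set. finite X \<Longrightarrow> (\<Sum>n\<in>X. (1 / (1 + sup_abs n)) ^ (2 * m)) \<le> Z"
    by (rule lattice_constant) (rule that)
  have "real CARD('d) < real (2 * (m - ?a))" using a am by (simp add: of_nat_diff)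
  then obtain Z' where Z': "0 < Z'" "\<And>X :: ('d \<Rightarrow> int) set. finite X \<Longrightarrow> (\<Sum>n\<in>X. (1 / (1 + sup_abs n)) ^ (2 * (m - ?a))) \<le> Z'"
    by (rule lattice_sum_bounded) (rule that)
  define C where "C = (pi / H) ^ ?a * (4 ^ m * (sqrt Z + sqrt Z'))"
  have H0: "0 \<le> H" using L by (simp add: H_def)
  have C0: "0 \<le> C" using H0 Z(1) Z'(1) by (simp add: C_def)
  have V0: "0 \<le> V" by (simp add: V_def)
  \<comment> \<open>Adding 1 to \<open>V * C\<close> keeps the constant positive when the kernel
    vanishes on the ball.\<close>
  have main: "Linf_norm (cube L) (ktm_error U L N \<alpha> \<rho>)
       \<le> ereal ((V * C + 1) * real N powr - (real m - real CARD('d) / 2 - real ?a) * sqrt W)"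
    if \<rho>: "test_fun L \<rho>" and N: "0 < N" "even N" and W: "energy_bound m (fourier_coeff (real (pad_factor CARD('d)) * L) \<rho>) W" for \<rho> N W
  proof -
    define M where "M = pad_factor CARD('d) * N"
    note cx = L N H_def M_def \<rho>
    note M = M_pos[OF cx] M_even[OF cx]
    define q where "q = sqrt (real M ^ CARD('d)) * (1 / M) ^ (m - ?a)"
    let ?p = "- (real m - real CARD('d) / 2 - real ?a)"
    have W0: "0 \<le> W" by (rule energy_bound_nonneg[OF W])
    \<comment> \<open>The exponent is negative by \<open>a\<close>, so \<open>N \<le> M\<close> is
      enough to pass from \<open>M\<close> to \<open>N\<close>.\<close>
    have q: "q \<le> real N powr ?p"
    proof -
      have "q = real M powr ?p"
        unfolding q_def using sqrt_power_mult_powr[of "real M" "CARD('d)" "m - ?a"] M(1) am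
        by (simp add: of_nat_diff algebra_simps)
      also have "\<dots> \<le> real N powr ?p"
      proof (rule powr_mono2')
        show "real N \<le> real M"
          using mult_le_mono1[of 1 "pad_factor CARD('d)" N] pad_factor_ge_2[OF cx] unfolding M_def of_nat_le_iff by simp
      qed (use N a in auto)
      finally show ?thesis .
    qed
    have "Linf_norm (cube L) (ktm_error U L N \<alpha> \<rho>) \<le> ereal (V * (C * q * sqrt W))"
      unfolding V_def
    proof (rule ktm_error_norm_bounds(1)[OF L N H_def M_def \<rho> U])
      fix X :: "('d \<Rightarrow> int) set" assume X: "finite X"
      have "0 \<le> pi / H" using H0 by simp
      show "(\<Sum>n\<in>X. cmod (err_coeff L H N M \<rho> (mi_list \<alpha>) n)) \<le> C * q * sqrt W"
        unfolding C_def q_def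
        by (rule error_sum_bound[OF M alias_has_sum[OF cx] W[folded H_def] Z(2) \<open>0 \<le> pi / H\<close> am
              err_coeff_bounds[OF L N H_def M_def \<rho> U, of _ "mi_list \<alpha>", unfolded length_mi_list] X Z'(2)])
    qed
    also have "V * (C * q * sqrt W) \<le> (V * C + 1) * real N powr ?p * sqrt W"
    proof -
      have "V * C * q \<le> (V * C + 1) * real N powr ?p"
        using q C0 V0 by (intro mult_mono) (auto simp: q_def)
      hence "V * C * q * sqrt W \<le> (V * C + 1) * real N powr ?p * sqrt W"
        using W0 by (intro mult_right_mono) auto
      thus ?thesis by (simp add: mult.assoc)
    qed
    finally show ?thesis by simp
  qed
  have "0 < V * C + 1" using V0 C0 by (simp add: add_nonneg_pos)
  with main show ?thesis by blast
qed

lemma ktm_L2_uniform: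
  assumes a: "mi_size \<alpha> \<le> m"
  shows "\<exists>c>0. \<forall>\<rho> N W. test_fun L \<rho> \<and> 0 < N \<and> even N \<and> energy_bound m (fourier_coeff (real (pad_factor CARD('d)) * L) \<rho>) W \<longrightarrow>
     L2_norm (cube L) (ktm_error U L N \<alpha> \<rho>)
       \<le> ereal (c * real N powr - (real m - real (mi_size \<alpha>)) * sqrt W)"
proof -
  let ?a = "mi_size \<alpha>"
  define H where "H = real (pad_factor CARD('d)) * L"
  define V where "V = (LINT y|lebesgue. cmod (kernel_ball L U y))"
  obtain Z where Z: "0 < Z" "\<And>X :: ('d \<Rightarrow> int) set. finite X \<Longrightarrow> (\<Sum>n\<in>X. (1 / (1 + sup_abs n)) ^ (2 * m)) \<le> Z"
    by (rule lattice_constant) (rule that)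
  define C where "C = (pi / H) ^ (2 * ?a) * 16 ^ m * (1 + Z)"
  define P where "P = (2 * H) ^ CARD('d)"
  have H0: "0 \<le> H" using L by (simp add: H_def)
  have C0: "0 \<le> C" using H0 Z(1) by (simp add: C_def)
  have P0: "0 \<le> P" using H0 by (simp add: P_def)
  have V0: "0 \<le> V" by (simp add: V_def)
  define c where "c = V * sqrt P * sqrt C + 1"
  have main: "L2_norm (cube L) (ktm_error U L N \<alpha> \<rho>)
       \<le> ereal (c * real N powr - (real m - real ?a) * sqrt W)"
    if \<rho>: "test_fun L \<rho>" and N: "0 < N" "even N" and W: "energy_bound m (fourier_coeff (real (pad_factor CARD('d)) * L) \<rho>) W" for \<rho> N W
  proof -
    define M where "M = pad_factor CARD('d) * N"
    note cx = L N H_def M_def \<rho>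
    note M = M_pos[OF cx] M_even[OF cx]
    let ?q = "(1 / real M) ^ (m - ?a)"
    let ?p = "- (real m - real ?a)"
    have W0: "0 \<le> W" by (rule energy_bound_nonneg[OF W])
    have q: "?q \<le> real N powr ?p"
    proof -
      have "1 / real M \<le> 1 / real N"
        using pad_factor_ge_2[OF cx] N by (intro divide_left_mono) (auto simp: M_def)
      hence "?q \<le> (1 / real N) ^ (m - ?a)" by (intro power_mono) auto
      also have "\<dots> = real N powr ?p"
        using N a sqrt_power_mult_powr[of "real N" 0 "m - ?a"] by (simp add: of_nat_diff)
      finally show ?thesis .
    qed
    have "L2_norm (cube L) (ktm_error U L N \<alpha> \<rho>) \<le> ereal (V * sqrt P * sqrt (C * (1 / real M) ^ (2 * (m - ?a)) * W))"
      unfolding V_def P_def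
    proof (rule ktm_error_norm_bounds(2)[OF L N H_def M_def \<rho> U])
      fix X :: "('d \<Rightarrow> int) set" assume X: "finite X"
      have "0 \<le> pi / H" using H0 by simp
      show "(\<Sum>n\<in>X. (cmod (err_coeff L H N M \<rho> (mi_list \<alpha>) n))\<^sup>2) \<le> C * (1 / real M) ^ (2 * (m - ?a)) * W"
        unfolding C_def
        by (rule error_square_bound[OF M alias_has_sum[OF cx] W[folded H_def] Z(2) \<open>0 \<le> pi / H\<close> a
              err_coeff_bounds[OF L N H_def M_def \<rho> U, of _ "mi_list \<alpha>", unfolded length_mi_list] X])
    qed
    also have "sqrt (C * (1 / real M) ^ (2 * (m - ?a)) * W) = sqrt C * ?q * sqrt W"
    proof -
      have "sqrt ((1 / real M) ^ (2 * (m - ?a))) = ?q" by (simp only: power_even_eq real_sqrt_abs) simp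
      thus ?thesis by (simp only: real_sqrt_mult)
    qed
    also have "V * sqrt P * (sqrt C * ?q * sqrt W) \<le> c * real N powr ?p * sqrt W"
    proof -
      have "V * sqrt P * sqrt C * ?q \<le> c * real N powr ?p"
        using q C0 V0 P0 unfolding c_def by (intro mult_mono) auto
      hence "V * sqrt P * sqrt C * ?q * sqrt W \<le> c * real N powr ?p * sqrt W"
        using W0 by (intro mult_right_mono) auto
      thus ?thesis by (simp only: mult.assoc)
    qed
    finally show ?thesis by simp
  qed
  have "0 < c" using V0 C0 P0 by (simp add: c_def add_nonneg_pos)
  with main show ?thesis by blast
qed

end

lemma multi_partial_zero: "multi_partial (\<lambda>_. 0) f = f"
proof -
  have "mi_list (\<lambda>_ :: 'a. 0) = []" by (simp add: mi_list_def)
  thus ?thesis by (simp add: multi_partial_eq)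
qed

text \<open>In the first conjunct the constant may depend on the density, which admits every
  multi-index, even those for which the stated power of \<open>N\<close> grows. The remaining
  conjuncts give constants that serve all densities at once.\<close>

theorem theorem1:
  fixes U :: "real^'d::{finite,linorder} \<Rightarrow> complex"
    and L :: real and m :: nat and \<alpha> :: "'d \<Rightarrow> nat"
  assumes dim: "CARD('d) \<in> {1, 2, 3}"
    and L_pos: "0 < L"
    and U_locally_integrable: "\<And>K. compact K \<Longrightarrow> set_integrable lebesgue K U"
    and m_pos: "0 < m"
    and m_gt: "real CARD('d) / 2 < real m"
  shows
    "(\<forall>\<rho>. admissible_density L \<rho> \<longrightarrow>
        (\<exists>c>0. \<forall>N. 0 < N \<and> even N \<longrightarrow>
           Linf_norm (cube L) (ktm_error U L N \<alpha> \<rho>)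
             \<le> ereal (c * real N powr - (real m - real CARD('d) / 2 - real (mi_size \<alpha>))
                        * sobolev_seminorm m (cube L) \<rho>) \<and>
           L2_norm (cube L) (ktm_error U L N \<alpha> \<rho>)
             \<le> ereal (c * real N powr - (real m - real (mi_size \<alpha>))
                        * sobolev_seminorm m (cube L) \<rho>)))
     \<and> (real (mi_size \<alpha>) + real CARD('d) / 2 < real m \<longrightarrow>
        (\<exists>c>0. \<forall>\<rho> N. admissible_density L \<rho> \<and> 0 < N \<and> even N \<longrightarrow>
           Linf_norm (cube L) (ktm_error U L N \<alpha> \<rho>)
             \<le> ereal (c * real N powr - (real m - real CARD('d) / 2 - real (mi_size \<alpha>))
                        * sobolev_seminorm m (cube L) \<rho>)))
     \<and> (mi_size \<alpha> \<le> m \<longrightarrow>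
        (\<exists>c>0. \<forall>\<rho> N. admissible_density L \<rho> \<and> 0 < N \<and> even N \<longrightarrow>
           L2_norm (cube L) (ktm_error U L N \<alpha> \<rho>)
             \<le> ereal (c * real N powr - (real m - real (mi_size \<alpha>))
                        * sobolev_seminorm m (cube L) \<rho>)))
     \<and> (\<exists>c>0. \<forall>\<rho> N. admissible_density L \<rho> \<and> 0 < N \<and> even N \<longrightarrow>
           Linf_norm (cube L) (\<lambda>x. potential U \<rho> x - ktm_approx U L N (\<lambda>_. 0) \<rho> x)
             \<le> ereal (c * real N powr - (real m - real CARD('d) / 2)
                        * sobolev_seminorm m (cube L) \<rho>) \<and>
           L2_norm (cube L) (\<lambda>x. potential U \<rho> x - ktm_approx U L N (\<lambda>_. 0) \<rho> x)
             \<le> ereal (c * real N powr - real m * sobolev_seminorm m (cube L) \<rho>))"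
proof -
  define H where "H = real (pad_factor CARD('d)) * L"
  have U: "locally_integrable U" using U_locally_integrable by (simp add: locally_integrable_def)
  have LH: "L \<le> H"
  proof -
    have "1 \<le> real (pad_factor CARD('d))" 
      using real_sqrt_ge_zero[of "real CARD('d)"] unfolding pad_factor_def by linarith
    thus ?thesis using L_pos by (simp add: H_def)
  qed
  have H: "0 < H" using LH L_pos by linarith
  let ?s = "\<lambda>k \<rho>. sobolev_seminorm k (cube L :: (real, 'd) vec set) \<rho>"
  define K where "K k = 1 / ((pi / H) ^ (2 * k) * (2 * H) ^ CARD('d))" for k
  have K0: "0 < K k" for k using H by (simp add: K_def)
  have energy: "energy_bound k (fourier_coeff H \<rho>) (K k * (?s k \<rho>)\<^sup>2)"
    if "admissible_density L \<rho>" "0 < k" for k \<rho>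
    unfolding K_def by (rule energy_bound_sobolev[OF admissible_test_fun[OF that(1)] LH H that(2)])
  have sq: "sqrt (C * (?s k \<rho>)\<^sup>2) = sqrt C * ?s k \<rho>" for C k \<rho>
    by (simp add: real_sqrt_mult sobolev_seminorm_nonneg)

  have Linf: "\<exists>c>0. \<forall>\<rho> N. admissible_density L \<rho> \<and> 0 < N \<and> even N \<longrightarrow>
           Linf_norm (cube L) (ktm_error U L N \<beta> \<rho>)
             \<le> ereal (c * real N powr - (real m - real CARD('d) / 2 - real (mi_size \<beta>)) * ?s m \<rho>)"
    if \<beta>: "real (mi_size \<beta>) + real CARD('d) / 2 < real m" for \<beta> :: "'d \<Rightarrow> nat"
  proof -
    obtain c where c: "c > 0" "\<And>\<rho> N W. test_fun L \<rho> \<Longrightarrow> 0 < N \<Longrightarrow> even N \<Longrightarrow> energy_bound m (fourier_coeff H \<rho>) W \<Longrightarrow>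
        Linf_norm (cube L) (ktm_error U L N \<beta> \<rho>)
          \<le> ereal (c * real N powr - (real m - real CARD('d) / 2 - real (mi_size \<beta>)) * sqrt W)"
      using ktm_Linf_uniform[OF L_pos U m_gt \<beta>] unfolding H_def by blast
    show ?thesis
    proof (intro exI[of _ "c * sqrt (K m)"] conjI allI impI)
      show "0 < c * sqrt (K m)" using c K0 by simp
      fix \<rho> :: "(real, 'd) vec \<Rightarrow> complex" and N :: nat
      assume A: "admissible_density L \<rho> \<and> 0 < N \<and> even N"
      show "Linf_norm (cube L) (ktm_error U L N \<beta> \<rho>)
         \<le> ereal (c * sqrt (K m) * real N powr - (real m - real CARD('d) / 2 - real (mi_size \<beta>)) * ?s m \<rho>)"
        using c(2)[of \<rho> N, OF admissible_test_fun _ _ energy] A m_pos unfolding sq by (simp add: mult_ac)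
    qed
  qed

  have L2: "\<exists>c>0. \<forall>\<rho> N. admissible_density L \<rho> \<and> 0 < N \<and> even N \<longrightarrow>
           L2_norm (cube L) (ktm_error U L N \<beta> \<rho>)
             \<le> ereal (c * real N powr - (real m - real (mi_size \<beta>)) * ?s m \<rho>)"
    if \<beta>: "mi_size \<beta> \<le> m" for \<beta> :: "'d \<Rightarrow> nat"
  proof -
    obtain c where c: "c > 0" "\<And>\<rho> N W. test_fun L \<rho> \<Longrightarrow> 0 < N \<Longrightarrow> even N \<Longrightarrow> energy_bound m (fourier_coeff H \<rho>) W \<Longrightarrow>
        L2_norm (cube L) (ktm_error U L N \<beta> \<rho>)
          \<le> ereal (c * real N powr - (real m - real (mi_size \<beta>)) * sqrt W)"
      using ktm_L2_uniform[OF L_pos U m_gt \<beta>] unfolding H_def by blast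
    show ?thesis
    proof (intro exI[of _ "c * sqrt (K m)"] conjI allI impI)
      show "0 < c * sqrt (K m)" using c K0 by simp
      fix \<rho> :: "(real, 'd) vec \<Rightarrow> complex" and N :: nat
      assume A: "admissible_density L \<rho> \<and> 0 < N \<and> even N"
      show "L2_norm (cube L) (ktm_error U L N \<beta> \<rho>)
         \<le> ereal (c * sqrt (K m) * real N powr - (real m - real (mi_size \<beta>)) * ?s m \<rho>)"
        using c(2)[of \<rho> N, OF admissible_test_fun _ _ energy] A m_pos unfolding sq by (simp add: mult_ac)
    qed
  qed

  have fixed: "\<exists>c>0. \<forall>N. 0 < N \<and> even N \<longrightarrow>
           Linf_norm (cube L) (ktm_error U L N \<alpha> \<rho>)
             \<le> ereal (c * real N powr - (real m - real CARD('d) / 2 - real (mi_size \<alpha>)) * ?s m \<rho>) \<and>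
           L2_norm (cube L) (ktm_error U L N \<alpha> \<rho>)
             \<le> ereal (c * real N powr - (real m - real (mi_size \<alpha>)) * ?s m \<rho>)"
    if \<rho>: "admissible_density L \<rho>" for \<rho> :: "(real, 'd) vec \<Rightarrow> complex"
  proof -
    \<comment> \<open>Large enough for both uniform bounds at order \<open>k\<close>, and at least
      \<open>m\<close>, so that the power of \<open>N\<close> obtained is no larger than the one
      claimed.\<close>
    define k where "k = m + mi_size \<alpha> + CARD('d)"
    have k: "real CARD('d) / 2 < real k" "real (mi_size \<alpha>) + real CARD('d) / 2 < real k" "mi_size \<alpha> \<le> k" "0 < k" "m \<le> k"
      using m_gt m_pos by (simp_all add: k_def)
    obtain C where C: "0 \<le> C" "energy_bound k (fourier_coeff H \<rho>) (C * (?s m \<rho>)\<^sup>2)"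
    proof (cases "?s m \<rho> = 0")
      case True
      hence "energy_bound m (fourier_coeff H \<rho>) 0" using energy[OF \<rho> m_pos] by simp
      hence "energy_bound k (fourier_coeff H \<rho>) (0 * (?s m \<rho>)\<^sup>2)" using energy_bound_zero_imp k(4) by simp
      thus ?thesis using that[of 0] by simp
    next
      case False
      have "K k * (?s k \<rho>)\<^sup>2 = (K k * (?s k \<rho>)\<^sup>2 / (?s m \<rho>)\<^sup>2) * (?s m \<rho>)\<^sup>2" using False by simp
      hence "energy_bound k (fourier_coeff H \<rho>) ((K k * (?s k \<rho>)\<^sup>2 / (?s m \<rho>)\<^sup>2) * (?s m \<rho>)\<^sup>2)"
        using energy[OF \<rho> k(4)] by simp
      thus ?thesis using that K0[of k] by (meson divide_nonneg_nonneg less_imp_le mult_nonneg_nonneg zero_le_power2)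
    qed
    obtain c1 where c1: "c1 > 0" "\<And>\<rho> N W. test_fun L \<rho> \<Longrightarrow> 0 < N \<Longrightarrow> even N \<Longrightarrow> energy_bound k (fourier_coeff H \<rho>) W \<Longrightarrow>
        Linf_norm (cube L) (ktm_error U L N \<alpha> \<rho>)
          \<le> ereal (c1 * real N powr - (real k - real CARD('d) / 2 - real (mi_size \<alpha>)) * sqrt W)"
      using ktm_Linf_uniform[OF L_pos U k(1,2)] unfolding H_def by blast
    obtain c2 where c2: "c2 > 0" "\<And>\<rho> N W. test_fun L \<rho> \<Longrightarrow> 0 < N \<Longrightarrow> even N \<Longrightarrow> energy_bound k (fourier_coeff H \<rho>) W \<Longrightarrow>
        L2_norm (cube L) (ktm_error U L N \<alpha> \<rho>)
          \<le> ereal (c2 * real N powr - (real k - real (mi_size \<alpha>)) * sqrt W)"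
      using ktm_L2_uniform[OF L_pos U k(1,3)] unfolding H_def by blast
    define c where "c = (c1 + c2) * sqrt C + 1"
    \<comment> \<open>Here \<open>e\<close> is \<open>d/2 + |\<alpha>|\<close> for the maximum norm
      and \<open>|\<alpha>|\<close> for the mean square, and \<open>ci\<close> is \<open>c1\<close>
      or \<open>c2\<close>.\<close>
    have mono: "ci * real N powr - (real k - e) * (sqrt C * ?s m \<rho>) \<le> c * real N powr - (real m - e) * ?s m \<rho>"
      if "0 < N" "0 < ci" "ci \<le> c1 + c2" for N :: nat and ci e
    proof -
      have "ci * sqrt C \<le> c"
        using that(3) C(1) mult_right_mono[of ci "c1 + c2" "sqrt C"] by (simp add: c_def)
      moreover have "real N powr - (real k - e) \<le> real N powr - (real m - e)"
        using that(1) k(5) by (intro powr_mono) auto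
      ultimately have "(ci * sqrt C) * real N powr - (real k - e) \<le> c * real N powr - (real m - e)"
        using that(2) C(1) c1(1) c2(1) by (intro mult_mono) (auto simp: c_def)
      hence "(ci * sqrt C) * real N powr - (real k - e) * ?s m \<rho> \<le> c * real N powr - (real m - e) * ?s m \<rho>"
        by (rule mult_right_mono) (rule sobolev_seminorm_nonneg)
      thus ?thesis by (simp only: mult_ac)
    qed
    show ?thesis
    proof (intro exI[of _ c] conjI allI impI)
      show "0 < c" using c1(1) c2(1) C(1) by (simp add: c_def add_nonneg_pos)
      fix N :: nat assume N: "0 < N \<and> even N"
      note tf = admissible_test_fun[OF \<rho>]
      have "Linf_norm (cube L) (ktm_error U L N \<alpha> \<rho>)
          \<le> ereal (c1 * real N powr - (real k - (real CARD('d) / 2 + real (mi_size \<alpha>))) * (sqrt C * ?s m \<rho>))"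
        using c1(2)[OF tf _ _ C(2), of N] N unfolding sq by (simp add: algebra_simps)
      also have "\<dots> \<le> ereal (c * real N powr - (real m - (real CARD('d) / 2 + real (mi_size \<alpha>))) * ?s m \<rho>)"
        unfolding ereal_less_eq using N c1(1) c2(1) by (intro mono) auto
      finally show "Linf_norm (cube L) (ktm_error U L N \<alpha> \<rho>)
          \<le> ereal (c * real N powr - (real m - real CARD('d) / 2 - real (mi_size \<alpha>)) * ?s m \<rho>)"
        by (simp add: algebra_simps)
      have "L2_norm (cube L) (ktm_error U L N \<alpha> \<rho>)
          \<le> ereal (c2 * real N powr - (real k - real (mi_size \<alpha>)) * (sqrt C * ?s m \<rho>))"
        using c2(2)[OF tf _ _ C(2), of N] N unfolding sq by simp
      also have "\<dots> \<le> ereal (c * real N powr - (real m - real (mi_size \<alpha>)) * ?s m \<rho>)"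
        unfolding ereal_less_eq using N c1(1) c2(1) by (intro mono) auto
      finally show "L2_norm (cube L) (ktm_error U L N \<alpha> \<rho>)
          \<le> ereal (c * real N powr - (real m - real (mi_size \<alpha>)) * ?s m \<rho>)" .
    qed
  qed

  have zero: "\<exists>c>0. \<forall>\<rho> N. admissible_density L \<rho> \<and> 0 < N \<and> even N \<longrightarrow>
           Linf_norm (cube L) (\<lambda>x. potential U \<rho> x - ktm_approx U L N (\<lambda>_. 0) \<rho> x)
             \<le> ereal (c * real N powr - (real m - real CARD('d) / 2) * ?s m \<rho>) \<and>
           L2_norm (cube L) (\<lambda>x. potential U \<rho> x - ktm_approx U L N (\<lambda>_. 0) \<rho> x)
             \<le> ereal (c * real N powr - real m * ?s m \<rho>)"
  proof -
    have mi0: "mi_size (\<lambda>_ :: 'd. 0) = 0" by (simp add: mi_size_def)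
    have err0: "(\<lambda>x. potential U \<rho> x - ktm_approx U L N (\<lambda>_. 0) \<rho> x) = ktm_error U L N (\<lambda>_. 0) \<rho>" for N \<rho>
      by (simp add: ktm_error_def multi_partial_zero fun_eq_iff)
    obtain c1 where c1: "c1 > 0" "\<And>\<rho> N. admissible_density L \<rho> \<Longrightarrow> 0 < N \<Longrightarrow> even N \<Longrightarrow>
        Linf_norm (cube L) (ktm_error U L N (\<lambda>_. 0) \<rho>)
          \<le> ereal (c1 * real N powr - (real m - real CARD('d) / 2) * ?s m \<rho>)"
      using Linf[of "\<lambda>_. 0"] m_gt unfolding mi0 by auto
    obtain c2 where c2: "c2 > 0" "\<And>\<rho> N. admissible_density L \<rho> \<Longrightarrow> 0 < N \<Longrightarrow> even N \<Longrightarrow>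
        L2_norm (cube L) (ktm_error U L N (\<lambda>_. 0) \<rho>)
          \<le> ereal (c2 * real N powr - real m * ?s m \<rho>)"
      using L2[of "\<lambda>_. 0"] unfolding mi0 by auto
    have mono: "ereal (ci * p * ?s m \<rho>) \<le> ereal (max c1 c2 * p * ?s m \<rho>)"
      if "ci \<le> max c1 c2" "0 \<le> p" for ci p \<rho>
      using that sobolev_seminorm_nonneg[of m "cube L" \<rho>] by (simp add: mult_right_mono)
    show ?thesis
      unfolding err0
    proof (intro exI[of _ "max c1 c2"] conjI allI impI)
      show "0 < max c1 c2" using c1(1) by simp
      fix \<rho> :: "(real, 'd) vec \<Rightarrow> complex" and N :: nat
      assume A: "admissible_density L \<rho> \<and> 0 < N \<and> even N"
      show "Linf_norm (cube L) (ktm_error U L N (\<lambda>_. 0) \<rho>)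
          \<le> ereal (max c1 c2 * real N powr - (real m - real CARD('d) / 2) * ?s m \<rho>)"
        using A by (intro order_trans[OF c1(2) mono]) auto
      show "L2_norm (cube L) (ktm_error U L N (\<lambda>_. 0) \<rho>) \<le> ereal (max c1 c2 * real N powr - real m * ?s m \<rho>)"
        using A by (intro order_trans[OF c2(2) mono]) auto
    qed
  qed
  show ?thesis using fixed Linf[of \<alpha>] L2[of \<alpha>] zero by (intro conjI allI impI)
qed

end
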